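(* Fix integers $d_1,d_2\ge1$, $s>0$, $L>0$, $\alpha\in(0,1)$ and $\beta\in(0,1-\alpha)$. Consider the independence testing problem within the class $\mathcal{P}^{(d_1+d_2,s)}_{\text{Hölder}}$, with null hypothesis $H_0:f_{YZ}=f_Yf_Z$ and alternative $H_1:\|f_{YZ}-f_Yf_Z\|_{L_2}\ge\epsilon_n$, based on $n$ i.i.d. observations from $P_{YZ}$. Then the minimum separation satisfies $$\epsilon_n^\dagger\ \asymp\ n^{-2s/(4s+d_1+d_2)} .$$
   Context: Hölder class: $\mathcal{H}^{d_1+d_2}_s(L)$ is the class of functions $f:[0,1]^{d_1+d_2}\to\mathbb{R}$ with (1) $|f^{(\lfloor s\rfloor)}(x)-f^{(\lfloor s\rfloor)}(x')|\le L\|x-x'\|^{s-\lfloor s\rfloor}$ for all $x,x'$, and (2) $\|f^{(s')}\|_\infty\le L$ for each $s'\in\{1,\dots,\lfloor s\rfloor\}$, where $f^{(k)}$ denotes the $k$-th order derivative (the array of all order-$k$ partial derivatives). $\mathcal{P}^{(d_1+d_2,s)}_{\text{Hölder}}$ is the set of joint distributions $P_{YZ}$ of $(Y,Z)\in[0,1]^{d_1}\times[0,1]^{d_2}$ such that both the joint Lebesgue density $f_{YZ}$ and the product of marginal densities $f_Yf_Z$ belong to $\mathcal{H}^{d_1+d_2}_s(L)$. $\|f\|_{L_2}^2=\int f^2$. Minimum separation: let $\mathcal{P}_0$ be the set of $P_{YZ}$ in the class with $f_{YZ}=f_Yf_Z$ and $\mathcal{P}_1(\epsilon)$ the set of those with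 $\|f_{YZ}-f_Yf_Z\|_{L_2}\ge\epsilon$. A test is a measurable map $\phi$ from the data to $\{0,1\}$; $\Phi_{n,\alpha}$ is the set of tests with $\sup_{P\in\mathcal{P}_0}\mathbb{P}_P^{(n)}(\phi=1)\le\alpha$; $R^\dagger_{n,\epsilon}:=\inf_{\phi\in\Phi_{n,\alpha}}\sup_{P\in\mathcal{P}_1(\epsilon)}\mathbb{P}^{(n)}_P(\phi=0)$ (a supremum over the empty set being $0$); and $\epsilon_n^\dagger:=\inf\{\epsilon>0:R^\dagger_{n,\epsilon}\le\beta\}$. The notation $a_n\asymp b_n$ means $a_n/b_n$ is bounded away from $0$ and $\infty$ for large $n$ (the bounds may depend on the fixed quantities $s,d_1,d_2,L,\alpha,\beta$). *)

theory Defs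
  imports "HOL-Probability.Probability" "HOL-Library.Landau_Symbols"
begin

abbreviation unit_cube :: "'a::euclidean_space set" where
  "unit_cube \<equiv> cbox 0 One"

text \<open>
  Derivatives are taken within the closed cube, so they are one-sided at the boundary; only the
  values of the function on the cube matter, and derivatives there are unique because the cube
  has nonempty interior.
\<close>

fun iterated_partial :: "'a::euclidean_space list \<Rightarrow> ('a \<Rightarrow> real) \<Rightarrow> 'a \<Rightarrow> real" where
  "iterated_partial [] f = f"
| "iterated_partial (b # bs) f =
     (\<lambda>x. frechet_derivative (iterated_partial bs f) (at x within unit_cube) b)"

definition directions :: "nat \<Rightarrow> 'a::euclidean_space list set" where
  "directions k = {bs. set bs \<subseteq> Basis \<and> length bs = k}"

definition times_differentiable :: "nat \<Rightarrow> ('a::euclidean_space \<Rightarrow> real) \<Rightarrow> bool" where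
  "times_differentiable k f \<longleftrightarrow>
     (\<forall>j<k. \<forall>bs\<in>directions j. iterated_partial bs f differentiable_on unit_cube)"

text \<open>
  The size of an array of partial derivatives is its Euclidean norm. At \<open>x = x'\<close> the convention
  \<open>0 powr 0 = 0\<close> is harmless, since then the left-hand side of the Hoelder condition is zero.
\<close>

definition holder_class :: "real \<Rightarrow> real \<Rightarrow> ('a::euclidean_space \<Rightarrow> real) set" where
  "holder_class s L = {f.
     times_differentiable (nat \<lfloor>s\<rfloor>) f \<and>
     (\<forall>x\<in>unit_cube. \<forall>x'\<in>unit_cube.
        L2_set (\<lambda>bs. iterated_partial bs f x - iterated_partial bs f x') (directions (nat \<lfloor>s\<rfloor>))
          \<le> L * norm (x - x') powr (s - of_int \<lfloor>s\<rfloor>)) \<and>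
     (\<forall>k\<in>{1..nat \<lfloor>s\<rfloor>}. \<forall>x\<in>unit_cube.
        L2_set (\<lambda>bs. iterated_partial bs f x) (directions k) \<le> L)}"

definition cube_lebesgue :: "'a::euclidean_space measure" where
  "cube_lebesgue = restrict_space lborel unit_cube"

text \<open>Nonnegativity is required because \<open>ennreal\<close> truncates negative values to zero.\<close>

definition lebesgue_density :: "'a::euclidean_space measure \<Rightarrow> ('a \<Rightarrow> real) \<Rightarrow> bool" where
  "lebesgue_density P f \<longleftrightarrow>
     f \<in> borel_measurable cube_lebesgue \<and> (\<forall>x\<in>unit_cube. 0 \<le> f x) \<and>
     P = density cube_lebesgue (\<lambda>x. ennreal (f x))"

text \<open>
  \<open>holder_model s L P f fY fZ\<close>: the distribution \<open>P\<close> belongs to the class, with joint density \<open>f\<close>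
  and marginal densities \<open>fY\<close> and \<open>fZ\<close>. Densities are determined only almost everywhere; \<open>f\<close> and
  the product of \<open>fY\<close> and \<open>fZ\<close> are versions that lie in the Hoelder class. For \<open>s > 0\<close> such
  versions are continuous, hence unique on the cube.
\<close>

definition holder_model ::
  "real \<Rightarrow> real \<Rightarrow> ('a::euclidean_space \<times> 'b::euclidean_space) measure \<Rightarrow>
   ('a \<times> 'b \<Rightarrow> real) \<Rightarrow> ('a \<Rightarrow> real) \<Rightarrow> ('b \<Rightarrow> real) \<Rightarrow> bool" where
  "holder_model s L P f fY fZ \<longleftrightarrow>
     prob_space P \<and>
     lebesgue_density P f \<and>
     lebesgue_density (distr P cube_lebesgue fst) fY \<and>
     lebesgue_density (distr P cube_lebesgue snd) fZ \<and>
     f \<in> holder_class s L \<and>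
     (\<lambda>(y, z). fY y * fZ z) \<in> holder_class s L"

definition null_class ::
  "real \<Rightarrow> real \<Rightarrow> ('a::euclidean_space \<times> 'b::euclidean_space) measure set" where
  "null_class s L = {P. \<exists>f fY fZ. holder_model s L P f fY fZ \<and>
     (\<forall>(y, z)\<in>unit_cube. f (y, z) = fY y * fZ z)}"

definition L2_norm :: "('a::euclidean_space \<Rightarrow> real) \<Rightarrow> real" where
  "L2_norm h = sqrt (\<integral>x. (h x)\<^sup>2 \<partial>cube_lebesgue)"

definition alternative_class ::
  "real \<Rightarrow> real \<Rightarrow> real \<Rightarrow> ('a::euclidean_space \<times> 'b::euclidean_space) measure set" where
  "alternative_class s L \<epsilon> = {P. \<exists>f fY fZ. holder_model s L P f fY fZ \<and>
     L2_norm (\<lambda>(y, z). f (y, z) - fY y * fZ z) \<ge> \<epsilon>}"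

definition iid_sample :: "nat \<Rightarrow> 'a measure \<Rightarrow> (nat \<Rightarrow> 'a) measure" where
  "iid_sample n P = (\<Pi>\<^sub>M i\<in>{..<n}. P)"

definition tests :: "nat \<Rightarrow> ((nat \<Rightarrow> 'a::euclidean_space) \<Rightarrow> nat) set" where
  "tests n = iid_sample n cube_lebesgue \<rightarrow>\<^sub>M count_space {0, 1}"

definition prob_decision ::
  "nat \<Rightarrow> 'a measure \<Rightarrow> ((nat \<Rightarrow> 'a) \<Rightarrow> nat) \<Rightarrow> nat \<Rightarrow> ennreal" where
  "prob_decision n P \<phi> i =
     emeasure (iid_sample n P) {\<omega> \<in> space (iid_sample n P). \<phi> \<omega> = i}"

definition level_tests ::
  "real \<Rightarrow> real \<Rightarrow> real \<Rightarrow> nat \<Rightarrow>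
   ((nat \<Rightarrow> 'a::euclidean_space \<times> 'b::euclidean_space) \<Rightarrow> nat) set" where
  "level_tests s L \<alpha> n =
     {\<phi> \<in> tests n. (SUP P\<in>null_class s L. prob_decision n P \<phi> 1) \<le> ennreal \<alpha>}"

text \<open>
  Probabilities are taken in \<open>ennreal\<close>, where the supremum of the empty set is zero.
  The \<open>itself\<close> arguments fix the spaces in which the two components take their values.
\<close>

definition minimax_risk ::
  "'a::euclidean_space itself \<Rightarrow> 'b::euclidean_space itself \<Rightarrow>
   real \<Rightarrow> real \<Rightarrow> real \<Rightarrow> nat \<Rightarrow> real \<Rightarrow> ennreal" where
  "minimax_risk _ _ s L \<alpha> n \<epsilon> =
     (INF \<phi>\<in>(level_tests s L \<alpha> n :: ((nat \<Rightarrow> 'a \<times> 'b) \<Rightarrow> nat) set).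
        SUP P\<in>alternative_class s L \<epsilon>. prob_decision n P \<phi> 0)"

definition minimum_separation ::
  "'a::euclidean_space itself \<Rightarrow> 'b::euclidean_space itself \<Rightarrow>
   real \<Rightarrow> real \<Rightarrow> real \<Rightarrow> real \<Rightarrow> nat \<Rightarrow> real" where
  "minimum_separation A B s L \<alpha> \<beta> n =
     Inf {\<epsilon>. \<epsilon> > 0 \<and> minimax_risk A B s L \<alpha> n \<epsilon> \<le> ennreal \<beta>}"

end

theory Submission
  imports Defs "HOL-Computational_Algebra.Polynomial"
begin

text \<open>
  Upper bound: two observations that are independent of a third one provide, by recombination, a
  draw from the product of the marginals, so that the sample yields independent pairs of draws from
  \<open>f\<^sub>Y\<^sub>Z\<close> and from \<open>f\<^sub>Y f\<^sub>Z\<close>. With the differences of cell counts of these pairs in two halves of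
  the sample, the sum over cells of the products of the two halves is an unbiased estimator of the
  squared distance between the cell probabilities; its variance is controlled because Hoelder
  densities on the cube are bounded, and Chebyshev's inequality gives the test. Cell averages do not
  lose the rate for smoothness above \<open>1\<close>, because \<open>\<lfloor>s\<rfloor> + 1\<close> consecutive averages determine a
  polynomial of degree \<open>\<lfloor>s\<rfloor>\<close>, and hence a smooth function up to its Taylor remainder.

  Lower bound: the uniform distribution is tested against the mixture of its perturbations by
  randomly signed bumps, one in each cell of a grid. The bumps have vanishing marginals, so that the
  product of the marginal densities remains uniform.
\<close>

section \<open>Reconstructing smooth functions from cell averages in one dimension\<close>

text \<open>Both bounds lead to the same grid. With \<open>R\<close> boxes per axis and
  \<open>d\<close> the total dimension, cell probabilities are of order \<open>R^-d\<close>, so the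
  statistic resolves a squared L2 distance of order \<open>R^(d/2) / n\<close>, while passing to
  cell averages costs \<open>R^(-2 s)\<close>; equality gives \<open>R = n^(2/(4 s + d))\<close> and
  the squared separation \<open>R^(-2 s)\<close>. On the other side, bumps of width
  \<open>1 / N\<close> and height \<open>N^-s\<close> stay in the class, and their mixture is
  undetectable as long as \<open>n^2 N^(-4 s - d)\<close> is small, which is the same equation. The
  class constrains the joint density and the product of the marginal densities, not the two marginal
  densities separately. Hence the difference of the two is treated as a function on the whole
  product cube, and reconstruction is proved for the difference of two members of the class.
  Squaring the differences of cell counts would put the variance of the counts into the mean of the
  statistic; multiplying two independent halves removes these diagonal terms.\<close>

lemma pderiv_sum: "pderiv (\<Sum>x\<in>A. f x) = (\<Sum>x\<in>A. pderiv (f x))"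
  by (induction A rule: infinite_finite_induct) (auto simp: pderiv_add)

text \<open>Differentiating the Lagrange interpolant at the nodes \<open>i / r\<close> gives a
  linear form in the nodal values. It annihilates constants and can therefore be rewritten in
  increments over the cells; if \<open>P\<close> is an antiderivative, these are cell integrals. The
  weights are bounded by compactness of the unit interval.\<close>

lemma lagrange_derivative_weights:
  fixes r :: nat
  assumes "r \<ge> 1"
  obtains w :: "nat \<Rightarrow> real \<Rightarrow> real" and C :: real
  where "C \<ge> 0" "\<And>i t. 0 \<le> t \<Longrightarrow> t \<le> 1 \<Longrightarrow> \<bar>w i t\<bar> \<le> C"
    "\<And>P t. degree P \<le> r \<Longrightarrow>
       poly (pderiv P) t = (\<Sum>j<r. w j t * (poly P (real (Suc j) / real r) - poly P (real j / real r)))"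
proof -
  define x where "x i = real i / real r" for i
  have x_inj: "x i = x j \<longleftrightarrow> i = j" for i j
    using assms by (auto simp: x_def)
  define q where "q i = (\<Prod>j\<in>{..r}-{i}. [:- x j, 1:])" for i
  define l where "l i = smult (inverse (poly (q i) (x i))) (q i)" for i
  have deg_l: "degree (l i) \<le> r" if "i \<le> r" for i
  proof -
    have "degree (q i) \<le> (\<Sum>j\<in>{..r}-{i}. degree [:- x j, 1:])"
      unfolding q_def using degree_prod_sum_le[of "{..r}-{i}" "\<lambda>j. [:- x j, 1:]"] by (simp add: o_def)
    also have "\<dots> = card ({..r}-{i})" by simp
    also have "\<dots> = r" using that by simp
    finally show ?thesis unfolding l_def by (meson degree_smult_le order_trans)
  qed
  have q_nz: "poly (q i) (x i) \<noteq> 0" for i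
    unfolding q_def poly_prod by (auto simp: x_inj)
  have l_nodes: "poly (l i) (x j) = (if i = j then 1 else 0)" if "i \<le> r" "j \<le> r" for i j
  proof (cases "i = j")
    case True
    then show ?thesis using q_nz[of i] by (simp add: l_def)
  next
    case False
    then have "poly (q i) (x j) = 0"
      unfolding q_def poly_prod using that by (intro prod_zero) auto
    then show ?thesis using False by (simp add: l_def)
  qed
  have interp: "P = (\<Sum>i\<le>r. smult (poly P (x i)) (l i))" if "degree P \<le> r" for P
  proof (rule poly_eqI_degree[where A = "x ` {..r}"])
    have c: "card (x ` {..r}) = Suc r"
      by (subst card_image) (auto simp: inj_on_def x_inj)
    show "card (x ` {..r}) > degree P" using that c by simp
    have "degree (\<Sum>i\<le>r. smult (poly P (x i)) (l i)) \<le> r"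
      by (rule degree_sum_le) (auto intro: order_trans[OF degree_smult_le] deg_l)
    then show "card (x ` {..r}) > degree (\<Sum>i\<le>r. smult (poly P (x i)) (l i))" using c by simp
    fix y assume "y \<in> x ` {..r}"
    then obtain j where j: "j \<le> r" "y = x j" by auto
    have "(\<Sum>i\<le>r. poly P (x i) * poly (l i) (x j)) = (\<Sum>i\<le>r. if i = j then poly P (x i) else 0)"
      by (rule sum.cong) (use j l_nodes in auto)
    then show "poly P y = poly (\<Sum>i\<le>r. smult (poly P (x i)) (l i)) y"
      using j by (simp add: poly_sum)
  qed
  \<comment> \<open>Summation by parts: the increment over cell \<open>j\<close> enters the value at
    every node to its right, so its weight collects the basis derivatives of those nodes.\<close>
  define w where "w j t = (\<Sum>i\<in>{j<..r}. poly (pderiv (l i)) t)" for j t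
  \<comment> \<open>The basis polynomials sum to \<open>1\<close>; hence the common value
    \<open>poly P (x 0)\<close> contributes nothing to the derivative.\<close>
  have zero: "(\<Sum>i\<le>r. poly (pderiv (l i)) t) = 0" for t
  proof -
    have "(1::real poly) = (\<Sum>i\<le>r. l i)" using interp[of 1] by simp
    then have "pderiv (1::real poly) = (\<Sum>i\<le>r. pderiv (l i))"
      by (metis (mono_tags, lifting) pderiv_sum sum.cong)
    then show ?thesis by (metis poly_0 poly_sum pderiv_1)
  qed
  have repr: "poly (pderiv P) t = (\<Sum>j<r. w j t * (poly P (x (Suc j)) - poly P (x j)))"
    if "degree P \<le> r" for P t
  proof -
    let ?d = "\<lambda>j. poly P (x (Suc j)) - poly P (x j)"
    have tele: "poly P (x i) = poly P (x 0) + (\<Sum>j<i. ?d j)" for i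
      by (induction i) auto
    have "poly (pderiv P) t = (\<Sum>i\<le>r. poly P (x i) * poly (pderiv (l i)) t)"
      by (subst interp[OF that]) (simp add: pderiv_sum poly_sum pderiv_smult)
    also have "\<dots> = (\<Sum>i\<le>r. poly P (x 0) * poly (pderiv (l i)) t + (\<Sum>j<i. ?d j) * poly (pderiv (l i)) t)"
      by (subst tele) (simp add: algebra_simps)
    also have "\<dots> = (\<Sum>i\<le>r. (\<Sum>j<i. ?d j * poly (pderiv (l i)) t))"
      by (simp add: sum.distrib zero flip: sum_distrib_left sum_distrib_right)
    also have "\<dots> = (\<Sum>i\<in>{..r}. \<Sum>j\<in>{j\<in>{..<r}. j < i}. ?d j * poly (pderiv (l i)) t)"
      by (intro sum.cong) auto
    also have "\<dots> = (\<Sum>j\<in>{..<r}. \<Sum>i\<in>{i\<in>{..r}. j < i}. ?d j * poly (pderiv (l i)) t)"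
      by (rule sum.swap_restrict) auto
    also have "\<dots> = (\<Sum>j<r. w j t * ?d j)"
      unfolding w_def by (intro sum.cong refl) (auto simp: sum_distrib_left sum_distrib_right mult.commute intro!: sum.cong)
    finally show ?thesis .
  qed
  have "\<exists>c. \<forall>t\<in>{0..1}. \<bar>poly (pderiv (l i)) t\<bar> \<le> c" for i
  proof -
    have "compact ((\<lambda>t. poly (pderiv (l i)) t) ` {0..1})"
      by (intro compact_continuous_image continuous_intros) auto
    then show ?thesis
      by (metis compact_imp_bounded bounded_real imageI)
  qed
  note ex = this
  define c where "c i = (SOME c. \<forall>t\<in>{0..1}. \<bar>poly (pderiv (l i)) t\<bar> \<le> c)" for i
  have c: "\<bar>poly (pderiv (l i)) t\<bar> \<le> c i" if "t \<in> {0..1}" for i t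
    using someI_ex[OF ex[of i]] that unfolding c_def by (rule bspec)
  show ?thesis
  proof (rule that[of "\<Sum>i\<le>r. \<bar>c i\<bar>" w])
    fix j and t :: real assume t: "0 \<le> t" "t \<le> 1"
    have "\<bar>w j t\<bar> \<le> (\<Sum>i\<in>{j<..r}. \<bar>poly (pderiv (l i)) t\<bar>)"
      unfolding w_def by (rule sum_abs)
    also have "\<dots> \<le> (\<Sum>i\<le>r. \<bar>poly (pderiv (l i)) t\<bar>)"
      by (rule sum_mono2) auto
    also have "\<dots> \<le> (\<Sum>i\<le>r. \<bar>c i\<bar>)"
    proof (rule sum_mono)
      fix i show "\<bar>poly (pderiv (l i)) t\<bar> \<le> \<bar>c i\<bar>" using c[of t i] t by simp
    qed
    finally show "\<bar>w j t\<bar> \<le> (\<Sum>i\<le>r. \<bar>c i\<bar>)" .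
  next
    show "poly (pderiv P) t = (\<Sum>j<r. w j t * (poly P (real (Suc j) / real r) - poly P (real j / real r)))"
      if "degree P \<le> r" for P t
      using repr[OF that] by (simp add: x_def)
  qed (intro sum_nonneg abs_ge_zero)
qed

text \<open>Taylor expansion at the midpoint: the order-\<open>k\<close> derivative in the Lagrange
  remainder is compared with its value at the midpoint, so only its oscillation enters, which is
  what a Hoelder condition controls. The open interval avoids one-sided derivatives.\<close>

lemma taylor_polynomial:
  fixes g :: "nat \<Rightarrow> real \<Rightarrow> real"
  assumes D: "\<And>m t. m < k \<Longrightarrow> 0 < t \<Longrightarrow> t < 1 \<Longrightarrow> (g m has_real_derivative g (Suc m) t) (at t)"
    and H: "\<And>u v. 0 < u \<Longrightarrow> u < 1 \<Longrightarrow> 0 < v \<Longrightarrow> v < 1 \<Longrightarrow> \<bar>g k u - g k v\<bar> \<le> \<delta>"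
  shows "\<exists>p. degree p \<le> k \<and> (\<forall>t. 0 < t \<and> t < 1 \<longrightarrow> \<bar>g 0 t - poly p t\<bar> \<le> \<delta>)"
proof (intro exI conjI allI impI)
  let ?p = "\<Sum>m\<le>k. smult (g m (1/2) / fact m) ([:- 1/2, 1:] ^ m)"
  show "degree ?p \<le> k"
    by (intro degree_sum_le) (auto intro!: order_trans[OF degree_smult_le] order_trans[OF degree_power_le])
  fix t :: real assume t: "0 < t \<and> t < 1"
  have p: "poly ?p t = (\<Sum>m<k. g m (1/2) / fact m * (t - 1/2) ^ m) + g k (1/2) / fact k * (t - 1/2) ^ k"
    by (simp add: poly_sum lessThan_Suc_atMost[symmetric] del: lessThan_Suc_atMost)
  have \<delta>: "\<delta> \<ge> 0" using H[of "1/2" "1/2"] by simp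
  show "\<bar>g 0 t - poly ?p t\<bar> \<le> \<delta>"
  \<comment> \<open>\<open>Taylor\<close> requires a positive order and a point different from the
    centre.\<close>
  proof (cases "k = 0")
    case True
    then show ?thesis using H[of t "1/2"] t by (simp add: p)
  next
    case k: False
    show ?thesis
    proof (cases "t = 1/2")
      case True
      have "poly ?p (1/2) = (\<Sum>m\<le>k. if m = 0 then g 0 (1/2) else 0)"
        unfolding poly_sum by (rule sum.cong) auto
      then show ?thesis using \<delta> unfolding True by (simp only: sum.delta finite_atMost atMost_iff if_True zero_le diff_self abs_zero)
    next
      case False
      have "\<exists>\<xi>. (if t < 1/2 then t < \<xi> \<and> \<xi> < 1/2 else 1/2 < \<xi> \<and> \<xi> < t) \<and>
        g 0 t = (\<Sum>m<k. (g m (1/2) / fact m) * (t - 1/2) ^ m) + (g k \<xi> / fact k) * (t - 1/2) ^ k"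
        by (rule Taylor[where a = "min t (1/2)" and b = "max t (1/2)"]) (use k t False D in auto)
      then obtain \<xi> where "if t < 1/2 then t < \<xi> \<and> \<xi> < 1/2 else 1/2 < \<xi> \<and> \<xi> < t" and
        eq: "g 0 t = (\<Sum>m<k. (g m (1/2) / fact m) * (t - 1/2) ^ m) + (g k \<xi> / fact k) * (t - 1/2) ^ k"
        by blast
      then have \<xi>: "0 < \<xi>" "\<xi> < 1" using t by (simp_all split: if_splits)
      have "\<bar>g 0 t - poly ?p t\<bar> = \<bar>g k \<xi> - g k (1/2)\<bar> * (\<bar>t - 1/2\<bar> ^ k / fact k)"
        unfolding p eq by (simp add: abs_mult power_abs flip: diff_divide_distrib left_diff_distrib)
      also have "\<dots> \<le> \<delta> * 1"
      proof (intro mult_mono H \<xi>)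
        have "\<bar>t - 1/2\<bar> ^ k \<le> 1" using t by (intro power_le_one) auto
        then show "\<bar>t - 1/2\<bar> ^ k / fact k \<le> 1"
          by (metis divide_le_eq_1_pos fact_ge_1 fact_gt_zero order_trans)
      qed (use \<delta> in auto)
      finally show ?thesis by simp
    qed
  qed
qed

lemma poly_antiderivative:
  fixes p :: "real poly"
  obtains P where "pderiv P = p" "degree P \<le> Suc (degree p)"
proof
  let ?P = "\<Sum>i\<le>degree p. monom (coeff p i / real (Suc i)) (Suc i)"
  have "pderiv ?P = (\<Sum>i\<le>degree p. monom (coeff p i) i)"
    by (simp add: pderiv_sum pderiv_monom del: of_nat_Suc)
  then show "pderiv ?P = p" by (simp add: poly_as_sum_of_monoms)
  show "degree ?P \<le> Suc (degree p)"
    by (rule degree_sum_le) (auto intro: order_trans[OF degree_monom_le])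
qed

lemma integral_poly_Icc:
  fixes a b :: real
  assumes "a \<le> b"
  shows "(\<integral>u. indicator {a..b} u * poly (pderiv P) u \<partial>lborel) = poly P b - poly P a"
  using integral_FTC_Icc_real[OF assms, of "poly P" "poly (pderiv P)"]
  by (auto simp: mult.commute poly_DERIV)

text \<open>
  A polynomial of degree below \<open>r\<close> is recovered from its cell integrals by differentiating the
  Lagrange interpolant of its antiderivative; the error of the Taylor polynomial is then
  reproduced stably.
\<close>

lemma cell_reconstruction:
  fixes k :: nat
  obtains w :: "nat \<Rightarrow> real \<Rightarrow> real" and C :: real
  where "C \<ge> 1" "\<And>i t. 0 \<le> t \<Longrightarrow> t \<le> 1 \<Longrightarrow> \<bar>w i t\<bar> \<le> C"
    "\<And>g \<delta> t. \<lbrakk>\<And>m t. m < k \<Longrightarrow> 0 < t \<Longrightarrow> t < 1 \<Longrightarrow> (g m has_real_derivative g (Suc m) t) (at t);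
       \<And>u v. 0 < u \<Longrightarrow> u < 1 \<Longrightarrow> 0 < v \<Longrightarrow> v < 1 \<Longrightarrow> \<bar>g k u - g k v\<bar> \<le> \<delta>;
       continuous_on {0..1} (g 0); 0 < t; t < 1\<rbrakk> \<Longrightarrow>
       \<bar>g 0 t - (\<Sum>i<Suc k. w i t *
         (\<integral>u. indicator {real i / real (Suc k)..real (Suc i) / real (Suc k)} u * g 0 u \<partial>lborel))\<bar> \<le> C * \<delta>"
proof -
  let ?r = "Suc k"
  obtain w and C :: real where C: "C \<ge> 0" and w: "\<And>i t. 0 \<le> t \<Longrightarrow> t \<le> 1 \<Longrightarrow> \<bar>w i t\<bar> \<le> C"
    and repr: "\<And>P t. degree P \<le> ?r \<Longrightarrow>
      poly (pderiv P) t = (\<Sum>j<?r. w j t * (poly P (real (Suc j) / real ?r) - poly P (real j / real ?r)))"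
    by (rule lagrange_derivative_weights[of ?r]) auto
  show ?thesis
  proof (rule that[of "1 + C" w])
    fix g :: "nat \<Rightarrow> real \<Rightarrow> real" and \<delta> t :: real
    assume D: "\<And>m t. m < k \<Longrightarrow> 0 < t \<Longrightarrow> t < 1 \<Longrightarrow> (g m has_real_derivative g (Suc m) t) (at t)"
      and H: "\<And>u v. 0 < u \<Longrightarrow> u < 1 \<Longrightarrow> 0 < v \<Longrightarrow> v < 1 \<Longrightarrow> \<bar>g k u - g k v\<bar> \<le> \<delta>"
      and cont: "continuous_on {0..1} (g 0)" and t: "0 < t" "t < 1"
    have \<delta>: "\<delta> \<ge> 0" using H[of "1/2" "1/2"] by simp
    obtain p where p: "degree p \<le> k" "\<And>t. 0 < t \<Longrightarrow> t < 1 \<Longrightarrow> \<bar>g 0 t - poly p t\<bar> \<le> \<delta>"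
      using taylor_polynomial[of k g \<delta>, OF D H] by blast
    obtain P where P: "pderiv P = p" "degree P \<le> Suc (degree p)" by (rule poly_antiderivative)
    let ?I = "\<lambda>i. {real i / real ?r..real (Suc i) / real ?r}"
    have sub: "?I i \<subseteq> {0..1}" if "i < ?r" for i
      using that by (auto simp: field_simps intro: order_trans)
    have le: "real i / real ?r \<le> real (Suc i) / real ?r" for i by (simp add: divide_right_mono)
    have int_g: "integrable lborel (\<lambda>u. indicator (?I i) u * g 0 u)" if "i < ?r" for i
      using borel_integrable_atLeastAtMost'[OF continuous_on_subset[OF cont sub[OF that]]]
      by (simp only: set_integrable_def real_scaleR_def)
    have int_p: "integrable lborel (\<lambda>u. indicator (?I i) u * poly p u)" for i
    proof -
      have "continuous_on (?I i) (poly p)" by (intro continuous_intros)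
      from borel_integrable_atLeastAtMost'[OF this] show ?thesis by (simp only: set_integrable_def real_scaleR_def)
    qed
    have cell: "\<bar>(\<integral>u. indicator (?I i) u * g 0 u \<partial>lborel) - (\<integral>u. indicator (?I i) u * poly p u \<partial>lborel)\<bar>
        \<le> \<delta> / real ?r" if i: "i < ?r" for i
    proof -
      have "\<bar>(\<integral>u. indicator (?I i) u * g 0 u \<partial>lborel) - (\<integral>u. indicator (?I i) u * poly p u \<partial>lborel)\<bar>
          = \<bar>\<integral>u. indicator (?I i) u * g 0 u - indicator (?I i) u * poly p u \<partial>lborel\<bar>"
        by (subst Bochner_Integration.integral_diff) (use int_g[OF i] int_p in auto)
      also have "\<dots> \<le> (\<integral>u. \<bar>indicator (?I i) u * g 0 u - indicator (?I i) u * poly p u\<bar> \<partial>lborel)"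
        by (rule integral_abs_bound)
      also have "\<dots> \<le> (\<integral>u. indicator (?I i) u * \<delta> \<partial>lborel)"
      proof (rule integral_mono_AE)
        show "integrable lborel (\<lambda>u. \<bar>indicator (?I i) u * g 0 u - indicator (?I i) u * poly p u\<bar>)"
          using int_g[OF i] int_p by auto
        show "integrable lborel (\<lambda>u. indicator (?I i) u * \<delta>)"
          by (intro integrable_mult_left integrable_real_indicator) (simp_all add: emeasure_lborel_Icc_eq)
        \<comment> \<open>The Taylor bound holds in the open unit interval only; the two endpoints
          are negligible.\<close>
        have "AE u in lborel. u \<noteq> 0 \<and> u \<noteq> (1::real)"
          using AE_lborel_singleton[of "0::real"] AE_lborel_singleton[of "1::real"] by eventually_elim auto
        then show "AE u in lborel. \<bar>indicator (?I i) u * g 0 u - indicator (?I i) u * poly p u\<bar>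
            \<le> indicator (?I i) u * \<delta>"
        proof eventually_elim
          case (elim u)
          have "0 < u \<and> u < 1" if "u \<in> ?I i"
            using subsetD[OF sub[OF i] that] elim by simp
          then show ?case using p(2)[of u] by (cases "u \<in> ?I i") simp_all
        qed
      qed
      also have "\<dots> = \<delta> / real ?r" using le[of i] by (simp add: diff_divide_distrib[symmetric])
      finally show ?thesis .
    qed
    have pt: "poly p t = (\<Sum>i<?r. w i t * (\<integral>u. indicator (?I i) u * poly p u \<partial>lborel))"
    proof -
      have "degree P \<le> ?r" using P(2) p(1) by simp
      from repr[OF this, of t] show ?thesis
        unfolding P(1) integral_poly_Icc[OF le, where P = P, unfolded P(1)] .
    qed
    \<comment> \<open>Reproduction is exact for \<open>p\<close>, so the error for
      \<open>g 0\<close> is that for the difference: one \<open>\<delta>\<close> at the point itself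
      and \<open>C * \<delta>\<close> from \<open>?r\<close> cells carrying at most
      \<open>\<delta> / ?r\<close> each.\<close>
    have "\<bar>g 0 t - (\<Sum>i<?r. w i t * (\<integral>u. indicator (?I i) u * g 0 u \<partial>lborel))\<bar>
        = \<bar>(g 0 t - poly p t) - (\<Sum>i<?r. w i t * ((\<integral>u. indicator (?I i) u * g 0 u \<partial>lborel)
              - (\<integral>u. indicator (?I i) u * poly p u \<partial>lborel)))\<bar>"
      unfolding right_diff_distrib sum_subtractf pt[symmetric] by (simp del: sum.lessThan_Suc)
    also have "\<dots> \<le> \<delta> + (\<Sum>i<?r. C * (\<delta> / real ?r))"
    proof (rule order_trans[OF abs_triangle_ineq4 add_mono])
      show "\<bar>g 0 t - poly p t\<bar> \<le> \<delta>" using p(2) t by auto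
      show "\<bar>\<Sum>i<?r. w i t * ((\<integral>u. indicator (?I i) u * g 0 u \<partial>lborel)
              - (\<integral>u. indicator (?I i) u * poly p u \<partial>lborel))\<bar> \<le> (\<Sum>i<?r. C * (\<delta> / real ?r))"
      proof (intro order_trans[OF sum_abs] sum_mono)
        fix i assume "i \<in> {..<?r}"
        then have "\<bar>w i t\<bar> \<le> C" "i < ?r" using w t by auto
        then show "\<bar>w i t * ((\<integral>u. indicator (?I i) u * g 0 u \<partial>lborel)
              - (\<integral>u. indicator (?I i) u * poly p u \<partial>lborel))\<bar> \<le> C * (\<delta> / real ?r)"
          unfolding abs_mult using C by (intro mult_mono cell) auto
      qed
    qed
    also have "\<dots> = (1 + C) * \<delta>" by (simp add: algebra_simps del: sum.lessThan_Suc of_nat_Suc)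
    finally show "\<bar>g 0 t - (\<Sum>i<?r. w i t * (\<integral>u. indicator (?I i) u * g 0 u \<partial>lborel))\<bar> \<le> (1 + C) * \<delta>" .
  next
    show "\<bar>w i t\<bar> \<le> 1 + C" if "0 \<le> t" "t \<le> 1" for i t
      using w[OF that, of i] by simp
  qed (use C in simp)
qed


section \<open>Tensor products\<close>

lemma integral_lborel_eq_PiM:
  fixes F :: "'a::euclidean_space \<Rightarrow> real"
  assumes [measurable]: "F \<in> borel_measurable borel"
  shows "(\<integral>x. F x \<partial>lborel) = (\<integral>y. F (\<Sum>b\<in>Basis. y b *\<^sub>R b) \<partial>(\<Pi>\<^sub>M b\<in>(Basis::'a set). lborel))"
proof -
  have "(\<integral>x. F x \<partial>lborel) =
      (\<integral>x. F x \<partial>distr (\<Pi>\<^sub>M b\<in>(Basis::'a set). lborel) borel (\<lambda>f. \<Sum>b\<in>Basis. f b *\<^sub>R b))"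
    using lborel_eq[where 'a = 'a] by (rule arg_cong)
  also have "\<dots> = (\<integral>y. F (\<Sum>b\<in>Basis. y b *\<^sub>R b) \<partial>(\<Pi>\<^sub>M b\<in>(Basis::'a set). lborel))"
    by (rule integral_distr) measurable
  finally show ?thesis .
qed

lemma integrable_lborel_iff_PiM:
  fixes F :: "'a::euclidean_space \<Rightarrow> real"
  assumes [measurable]: "F \<in> borel_measurable borel"
  shows "integrable lborel F \<longleftrightarrow>
    integrable (\<Pi>\<^sub>M b\<in>(Basis::'a set). lborel) (\<lambda>y. F (\<Sum>b\<in>Basis. y b *\<^sub>R b))"
proof -
  have "integrable lborel F \<longleftrightarrow>
      integrable (distr (\<Pi>\<^sub>M b\<in>(Basis::'a set). lborel) borel (\<lambda>f. \<Sum>b\<in>Basis. f b *\<^sub>R b)) F"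
    using lborel_eq[where 'a = 'a] by (rule arg_cong)
  also have "\<dots> \<longleftrightarrow> integrable (\<Pi>\<^sub>M b\<in>(Basis::'a set). lborel) (\<lambda>y. F (\<Sum>b\<in>Basis. y b *\<^sub>R b))"
    by (rule integrable_distr_eq) measurable
  finally show ?thesis .
qed

lemma sum_Basis_inner:
  "b \<in> Basis \<Longrightarrow> (\<Sum>b'\<in>Basis. y b' *\<^sub>R b') \<bullet> b = (y b :: real)" for b :: "'a::euclidean_space"
  by (simp add: inner_sum_left inner_Basis if_distrib cong: if_cong)

lemma
  fixes g :: "'a::euclidean_space \<Rightarrow> real \<Rightarrow> real"
  assumes "\<And>b. b \<in> Basis \<Longrightarrow> integrable lborel (g b)"
  shows integrable_prod_lborel: "integrable lborel (\<lambda>x. \<Prod>b\<in>Basis. g b (x \<bullet> b))"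
    and integral_prod_lborel:
      "(\<integral>x. (\<Prod>b\<in>Basis. g b (x \<bullet> b)) \<partial>lborel) = (\<Prod>b\<in>Basis. \<integral>u. g b u \<partial>lborel)"
proof -
  interpret product_sigma_finite "\<lambda>_::'a. lborel :: real measure" by standard
  have [measurable]: "b \<in> Basis \<Longrightarrow> g b \<in> borel_measurable borel" for b
    using assms[of b] by simp
  have meas: "(\<lambda>x. \<Prod>b\<in>Basis. g b (x \<bullet> b)) \<in> borel_measurable borel" by measurable
  have "integrable (\<Pi>\<^sub>M b\<in>(Basis::'a set). lborel) (\<lambda>y. \<Prod>b\<in>Basis. g b (y b))"
    by (rule product_integrable_prod) (use assms in auto)
  then show "integrable lborel (\<lambda>x. \<Prod>b\<in>Basis. g b (x \<bullet> b))"
    unfolding integrable_lborel_iff_PiM[OF meas] by (simp add: sum_Basis_inner cong: prod.cong)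
  have "(\<integral>y. (\<Prod>b\<in>Basis. g b (y b)) \<partial>(\<Pi>\<^sub>M b\<in>(Basis::'a set). lborel)) = (\<Prod>b\<in>Basis. \<integral>u. g b u \<partial>lborel)"
    by (rule product_integral_prod) (use assms in auto)
  then show "(\<integral>x. (\<Prod>b\<in>Basis. g b (x \<bullet> b)) \<partial>lborel) = (\<Prod>b\<in>Basis. \<integral>u. g b u \<partial>lborel)"
    unfolding integral_lborel_eq_PiM[OF meas] by (simp add: sum_Basis_inner cong: prod.cong)
qed

text \<open>
  Coordinates are frozen one at a time, so that only the one-dimensional slices of \<open>H\<close> itself,
  and not those of its partial averages, have to be reproduced by the kernels.
\<close>

lemma tensor_reproduction:
  fixes K :: "'i \<Rightarrow> real \<Rightarrow> real" and H :: "('i \<Rightarrow> real) \<Rightarrow> real"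
  assumes "finite I" "B \<ge> 1" "\<delta> \<ge> 0"
    and "\<And>j. j \<in> I \<Longrightarrow> integrable lborel (K j)"
    and "\<And>j. j \<in> I \<Longrightarrow> (\<integral>u. \<bar>K j u\<bar> \<partial>lborel) \<le> B"
    and "\<And>j u. j \<in> I \<Longrightarrow> u \<notin> {0..1} \<Longrightarrow> K j u = 0"
    and "x \<in> I \<rightarrow>\<^sub>E {0..1}"
    and "H \<in> borel_measurable (\<Pi>\<^sub>M i\<in>I. lborel)"
    and "\<And>y. \<bar>H y\<bar> \<le> M"
    and "\<And>j y. j \<in> I \<Longrightarrow> y \<in> I \<rightarrow>\<^sub>E {0..1} \<Longrightarrow>
      \<bar>H (y(j := x j)) - (\<integral>u. K j u * H (y(j := u)) \<partial>lborel)\<bar> \<le> \<delta>"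
  shows "\<bar>H x - (\<integral>y. (\<Prod>j\<in>I. K j (y j)) * H y \<partial>(\<Pi>\<^sub>M i\<in>I. lborel))\<bar> \<le> real (card I) * B ^ card I * \<delta>"
  using assms
proof (induction I arbitrary: H x rule: finite_induct)
  case empty
  then have "x = (\<lambda>_. undefined)" by auto
  then show ?case by (simp add: PiM_empty lebesgue_integral_count_space_finite)
next
  case (insert j I)
  interpret product_sigma_finite "\<lambda>_::'i. lborel :: real measure" by standard
  note [simp] = insert.hyps
  have K_int: "integrable lborel (K i)" if "i \<in> insert j I" for i using insert.prems(3)[OF that] .
  have K_B: "(\<integral>u. \<bar>K i u\<bar> \<partial>lborel) \<le> B" if "i \<in> insert j I" for i using insert.prems(4)[OF that] .
  have K_supp: "K i u = 0" if "i \<in> insert j I" "u \<notin> {0..1}" for i u using insert.prems(5)[OF that] .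
  have x: "x \<in> insert j I \<rightarrow>\<^sub>E {0..1}" by fact
  have H_bd: "\<bar>H y\<bar> \<le> M" for y by fact
  have rep: "\<bar>H (y(i := x i)) - (\<integral>u. K i u * H (y(i := u)) \<partial>lborel)\<bar> \<le> \<delta>"
    if "i \<in> insert j I" "y \<in> insert j I \<rightarrow>\<^sub>E {0..1}" for i y using insert.prems(9)[OF that] .
  have H_meas[measurable]: "H \<in> borel_measurable (\<Pi>\<^sub>M i\<in>insert j I. lborel)" by fact
  have B: "B \<ge> 1" and \<delta>: "\<delta> \<ge> 0" by fact+
  have Kj[measurable]: "K j \<in> borel_measurable borel" using K_int[of j] by simp
  let ?M = "\<Pi>\<^sub>M i\<in>I. (lborel :: real measure)"
  define P where "P y = (\<Prod>i\<in>I. K i (y i))" for y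
  have P_int: "integrable ?M P"
    unfolding P_def by (rule product_integrable_prod) (use K_int in auto)
  have P_meas[measurable]: "P \<in> borel_measurable ?M" using P_int by simp
  have P_abs: "(\<integral>y. \<bar>P y\<bar> \<partial>?M) \<le> B ^ card I"
  proof -
    have "(\<integral>y. \<bar>P y\<bar> \<partial>?M) = (\<Prod>i\<in>I. \<integral>u. \<bar>K i u\<bar> \<partial>lborel)"
      unfolding P_def abs_prod by (rule product_integral_prod) (use K_int in auto)
    also have "\<dots> \<le> (\<Prod>i\<in>I. B)" by (rule prod_mono) (use K_B in auto)
    finally show ?thesis by simp
  qed
  have [measurable]: "(\<lambda>(y, u). y(j := u)) \<in> ?M \<Otimes>\<^sub>M lborel \<rightarrow>\<^sub>M (\<Pi>\<^sub>M i\<in>insert j I. lborel)"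
    using measurable_add_dim[of j I "\<lambda>_. lborel"] by simp
  have H2[measurable]: "(\<lambda>(y, u). H (y(j := u))) \<in> borel_measurable (?M \<Otimes>\<^sub>M lborel)"
    using measurable_compose[OF \<open>(\<lambda>(y, u). y(j := u)) \<in> _\<close> H_meas] by (simp add: split_beta')
  \<comment> \<open>\<open>J\<close> averages coordinate \<open>j\<close> against its kernel, while
    \<open>H'\<close> below freezes it at \<open>x j\<close>. The reproduction hypothesis compares
    the two, and the induction hypothesis is applied to \<open>H'\<close>.\<close>
  define J where "J y = (\<integral>u. K j u * H (y(j := u)) \<partial>lborel)" for y
  have J_meas[measurable]: "J \<in> borel_measurable ?M"
    unfolding J_def by (rule lborel.borel_measurable_lebesgue_integral) (simp add: split_beta', measurable)
  define H' where "H' y = H (y(j := x j))" for y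
  have H'_meas[measurable]: "H' \<in> borel_measurable ?M"
    unfolding H'_def
    by (rule measurable_compose[OF _ H_meas]) (auto intro!: measurable_fun_upd[where J = I])
  have H'_bd: "\<bar>H' y\<bar> \<le> M" for y using H_bd by (simp add: H'_def)
  have M: "M \<ge> 0" using H_bd[of x] by linarith
  have J_bd: "\<bar>J y\<bar> \<le> M * B" if y: "y \<in> space ?M" for y
  proof -
    have "\<bar>J y\<bar> \<le> (\<integral>u. \<bar>K j u * H (y(j := u))\<bar> \<partial>lborel)"
      unfolding J_def by (rule integral_abs_bound)
    also have "\<dots> \<le> (\<integral>u. M * \<bar>K j u\<bar> \<partial>lborel)"
    proof (rule integral_mono')
      show "integrable lborel (\<lambda>u. M * \<bar>K j u\<bar>)" using K_int[of j] by simp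
      fix u show "\<bar>K j u * H (y(j := u))\<bar> \<le> M * \<bar>K j u\<bar>"
        using mult_left_mono[OF H_bd, of "\<bar>K j u\<bar>" "y(j := u)"] by (simp add: abs_mult mult.commute)
    qed (use M in simp)
    also have "\<dots> \<le> M * B" using K_B[of j] M by (simp add: mult_left_mono)
    finally show ?thesis .
  qed
  have F_int: "integrable (\<Pi>\<^sub>M i\<in>insert j I. lborel) (\<lambda>y. (\<Prod>i\<in>insert j I. K i (y i)) * H y)"
  proof (rule Bochner_Integration.integrable_bound)
    show "integrable (\<Pi>\<^sub>M i\<in>insert j I. lborel) (\<lambda>y. (\<Prod>i\<in>insert j I. K i (y i)) * M)"
      by (intro integrable_mult_left product_integrable_prod) (use K_int in auto)
    have "(\<lambda>y. \<Prod>i\<in>insert j I. K i (y i)) \<in> borel_measurable (\<Pi>\<^sub>M i\<in>insert j I. lborel)"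
      by (rule borel_measurable_integrable, rule product_integrable_prod) (use K_int in auto)
    then show "(\<lambda>y. (\<Prod>i\<in>insert j I. K i (y i)) * H y) \<in> borel_measurable (\<Pi>\<^sub>M i\<in>insert j I. lborel)"
      by simp
    have "\<bar>H y\<bar> \<le> \<bar>M\<bar>" for y using H_bd[of y] by linarith
    then show "AE y in \<Pi>\<^sub>M i\<in>insert j I. lborel. norm ((\<Prod>i\<in>insert j I. K i (y i)) * H y)
        \<le> norm ((\<Prod>i\<in>insert j I. K i (y i)) * M)"
      unfolding real_norm_def abs_mult by (intro AE_I2 mult_left_mono) auto
  qed
  have fub: "(\<integral>y. (\<Prod>i\<in>insert j I. K i (y i)) * H y \<partial>(\<Pi>\<^sub>M i\<in>insert j I. lborel)) = (\<integral>y. P y * J y \<partial>?M)"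
  proof -
    have "(\<Prod>i\<in>insert j I. K i ((y(j := u)) i)) * H (y(j := u)) = P y * (K j u * H (y(j := u)))" for y u
      by (auto simp: P_def intro!: prod.cong)
    then show ?thesis
      by (subst product_integral_insert[OF insert.hyps F_int]) (simp only: J_def integral_mult_right_zero)
  qed
  have PH_int: "integrable ?M (\<lambda>y. P y * H' y)"
  proof (rule Bochner_Integration.integrable_bound)
    show "integrable ?M (\<lambda>y. P y * M)" using P_int by simp
    show "AE y in ?M. norm (P y * H' y) \<le> norm (P y * M)"
      using H'_bd M by (auto simp: abs_mult intro!: mult_left_mono)
  qed simp
  have PJ_int: "integrable ?M (\<lambda>y. P y * J y)"
  proof (rule Bochner_Integration.integrable_bound)
    show "integrable ?M (\<lambda>y. P y * (M * B))" using P_int by simp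
    show "AE y in ?M. norm (P y * J y) \<le> norm (P y * (M * B))"
    proof (rule AE_I2)
      fix y assume "y \<in> space ?M"
      then show "norm (P y * J y) \<le> norm (P y * (M * B))"
        unfolding real_norm_def abs_mult[of "P y"] using J_bd[of y] by (intro mult_left_mono) auto
    qed
  qed simp
  have "\<bar>(\<integral>y. P y * H' y \<partial>?M) - (\<integral>y. P y * J y \<partial>?M)\<bar> = \<bar>\<integral>y. P y * H' y - P y * J y \<partial>?M\<bar>"
    using PH_int PJ_int by simp
  also have "\<dots> \<le> (\<integral>y. \<bar>P y * H' y - P y * J y\<bar> \<partial>?M)" by (rule integral_abs_bound)
  also have "\<dots> \<le> (\<integral>y. \<bar>P y\<bar> * \<delta> \<partial>?M)"
  proof (rule integral_mono)
    show "integrable ?M (\<lambda>y. \<bar>P y * H' y - P y * J y\<bar>)" using PH_int PJ_int by simp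
    show "integrable ?M (\<lambda>y. \<bar>P y\<bar> * \<delta>)" using P_int by simp
    fix y assume y: "y \<in> space ?M"
    show "\<bar>P y * H' y - P y * J y\<bar> \<le> \<bar>P y\<bar> * \<delta>"
    proof (cases "\<forall>i\<in>I. y i \<in> {0..1}")
      case True
      \<comment> \<open>The reproduction hypothesis speaks of points indexed by
        \<open>insert j I\<close>; any value in the unit interval may stand at \<open>j\<close>,
        since it is overwritten.\<close>
      define z where "z = y(j := 0)"
      have "z \<in> insert j I \<rightarrow>\<^sub>E {0..1}"
        using True y by (auto simp: z_def space_PiM PiE_def extensional_def)
      from rep[OF _ this, of j] have "\<bar>H' y - J y\<bar> \<le> \<delta>"
        by (simp add: H'_def J_def z_def)
      then show ?thesis
        unfolding right_diff_distrib[symmetric] abs_mult by (intro mult_left_mono) auto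
    next
      case False
      then have "P y = 0" using K_supp unfolding P_def by (intro prod_zero) auto
      then show ?thesis by simp
    qed
  qed
  also have "\<dots> \<le> B ^ card I * \<delta>" using P_abs \<delta> by (simp add: mult_right_mono)
  finally have step: "\<bar>(\<integral>y. P y * H' y \<partial>?M) - (\<integral>y. P y * J y \<partial>?M)\<bar> \<le> B ^ card I * \<delta>" .
  define x' where "x' = restrict x I"
  have x'_j: "x'(j := x j) = x"
    using x by (auto simp: x'_def fun_eq_iff PiE_def extensional_def)
  have "\<bar>H' x' - (\<integral>y. (\<Prod>i\<in>I. K i (y i)) * H' y \<partial>?M)\<bar> \<le> real (card I) * B ^ card I * \<delta>"
  proof (rule insert.IH[OF B \<delta> _ _ _ _ H'_meas H'_bd])
    show "x' \<in> I \<rightarrow>\<^sub>E {0..1}" using x by (auto simp: x'_def)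
    fix i and y :: "'i \<Rightarrow> real" assume i: "i \<in> I" and y: "y \<in> I \<rightarrow>\<^sub>E {0..1}"
    have "i \<noteq> j" using i insert.hyps by auto
    have "y(j := x j) \<in> insert j I \<rightarrow>\<^sub>E {0..1}" using x y by (auto simp: PiE_def extensional_def)
    from rep[OF _ this, of i] i \<open>i \<noteq> j\<close>
    show "\<bar>H' (y(i := x' i)) - (\<integral>u. K i u * H' (y(i := u)) \<partial>lborel)\<bar> \<le> \<delta>"
      by (simp add: H'_def x'_def fun_upd_twist)
  qed (use K_int K_B K_supp in auto)
  then have ih: "\<bar>H x - (\<integral>y. P y * H' y \<partial>?M)\<bar> \<le> real (card I) * B ^ card I * \<delta>"
    by (simp add: H'_def x'_j P_def)
  \<comment> \<open>One more coordinate costs \<open>B ^ card I * \<delta>\<close>; as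
    \<open>B \<ge> 1\<close>, the exponent can then be raised to the new cardinality.\<close>
  have "\<bar>H x - (\<integral>y. P y * J y \<partial>?M)\<bar> \<le> (real (card I) + 1) * (B ^ card I * \<delta>)"
    using ih step by (simp add: algebra_simps)
  also have "\<dots> \<le> (real (card I) + 1) * (B ^ Suc (card I) * \<delta>)"
    using B \<delta> by (intro mult_left_mono mult_right_mono power_increasing) auto
  finally show ?case unfolding fub by (simp add: algebra_simps)
qed


section \<open>Consequences of Hoelder smoothness\<close>

text \<open>The parameter is the new value of coordinate \<open>b\<close> and not a displacement, so
  that all slices of the cube are parametrised by the unit interval.\<close>

definition coord_line :: "'a::euclidean_space \<Rightarrow> 'a \<Rightarrow> real \<Rightarrow> 'a" where
  "coord_line x b u = x + (u - x \<bullet> b) *\<^sub>R b"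

lemma coord_line_inner:
  "b \<in> Basis \<Longrightarrow> c \<in> Basis \<Longrightarrow> coord_line x b u \<bullet> c = (if c = b then u else x \<bullet> c)"
  by (simp add: coord_line_def inner_add_left inner_Basis)

lemma coord_line_in_cube:
  "x \<in> unit_cube \<Longrightarrow> b \<in> Basis \<Longrightarrow> 0 \<le> u \<Longrightarrow> u \<le> 1 \<Longrightarrow> coord_line x b u \<in> unit_cube"
  by (simp add: mem_box coord_line_inner)

lemma finite_directions: "finite (directions k :: 'a::euclidean_space list set)"
  unfolding directions_def by (rule finite_lists_length_eq) simp

lemma replicate_in_directions: "b \<in> Basis \<Longrightarrow> replicate k b \<in> directions k"
  by (auto simp: directions_def)

lemma abs_le_L2_set:
  assumes "finite A" "i \<in> A"
  shows "\<bar>f i\<bar> \<le> L2_set f A"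
  using member_le_L2_set[OF assms, of "\<lambda>i. \<bar>f i\<bar>"] by (simp add: L2_set_def)

context
  fixes s L :: real and f :: "'a::euclidean_space \<Rightarrow> real"
  assumes s: "s > 0" and L: "L > 0" and f: "f \<in> holder_class s L"
begin

lemma holder_class_partial_has_derivative:
  assumes "j < nat \<lfloor>s\<rfloor>" "bs \<in> directions j" "x \<in> unit_cube"
  shows "(iterated_partial bs f has_derivative
    frechet_derivative (iterated_partial bs f) (at x within unit_cube)) (at x within unit_cube)"
  using f assms unfolding holder_class_def times_differentiable_def differentiable_on_def
  by (auto simp: frechet_derivative_works)

lemma holder_class_partial_bound:
  assumes "1 \<le> j" "j \<le> nat \<lfloor>s\<rfloor>" "bs \<in> directions j" "x \<in> unit_cube"
  shows "\<bar>iterated_partial bs f x\<bar> \<le> L"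
proof -
  have "L2_set (\<lambda>bs. iterated_partial bs f x) (directions j) \<le> L"
    using f assms unfolding holder_class_def by auto
  with abs_le_L2_set[OF finite_directions assms(3), of "\<lambda>bs. iterated_partial bs f x"]
  show ?thesis by linarith
qed

lemma holder_class_top_increment:
  assumes "bs \<in> directions (nat \<lfloor>s\<rfloor>)" "x \<in> unit_cube" "x' \<in> unit_cube"
  shows "\<bar>iterated_partial bs f x - iterated_partial bs f x'\<bar>
    \<le> L * norm (x - x') powr (s - of_int \<lfloor>s\<rfloor>)"
proof -
  have "L2_set (\<lambda>bs. iterated_partial bs f x - iterated_partial bs f x') (directions (nat \<lfloor>s\<rfloor>))
      \<le> L * norm (x - x') powr (s - of_int \<lfloor>s\<rfloor>)"
    using f assms unfolding holder_class_def by auto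
  with abs_le_L2_set[OF finite_directions assms(1),
      of "\<lambda>bs. iterated_partial bs f x - iterated_partial bs f x'"]
  show ?thesis by linarith
qed

text \<open>The chain rule along a segment inside the cube. For interior parameters a neighbourhood
  of the parameter is mapped into the cube, so the derivative within the cube becomes a two-sided
  derivative in the parameter.\<close>

lemma holder_class_slice_derivative:
  assumes b: "b \<in> Basis" and x: "x \<in> unit_cube" and m: "m < nat \<lfloor>s\<rfloor>" and u: "0 < u" "u < 1"
  shows "((\<lambda>u. iterated_partial (replicate m b) f (coord_line x b u)) has_real_derivative
    iterated_partial (replicate (Suc m) b) f (coord_line x b u)) (at u)"
proof -
  let ?z = "coord_line x b u" and ?S = "{0<..<1::real}"
  let ?F = "frechet_derivative (iterated_partial (replicate m b) f) (at ?z within unit_cube)"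
  have z: "?z \<in> unit_cube" using coord_line_in_cube[OF x b] u by simp
  have F: "(iterated_partial (replicate m b) f has_derivative ?F) (at ?z within unit_cube)"
    by (rule holder_class_partial_has_derivative[OF m replicate_in_directions[OF b] z])
  have "coord_line x b ` ?S \<subseteq> unit_cube" using coord_line_in_cube[OF x b] by auto
  then have F': "(iterated_partial (replicate m b) f has_derivative ?F) (at ?z within coord_line x b ` ?S)"
    using F has_derivative_subset by blast
  have line: "(coord_line x b has_derivative (\<lambda>h. h *\<^sub>R b)) (at u within ?S)"
    unfolding coord_line_def by (auto intro!: derivative_eq_intros)
  have "((\<lambda>u. iterated_partial (replicate m b) f (coord_line x b u)) has_derivative (\<lambda>h. ?F (h *\<^sub>R b)))
      (at u within ?S)"
    by (rule has_derivative_in_compose[OF line F'])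
  moreover have "?F (h *\<^sub>R b) = ?F b * h" for h
    using linear_scale[OF has_derivative_linear[OF F], of h b] by simp
  ultimately show ?thesis
    using u by (simp add: has_field_derivative_def at_within_open[of u ?S])
qed

lemma holder_class_slice_increment:
  assumes b: "b \<in> Basis" and x: "x \<in> unit_cube" and u: "0 < u" "u < 1" and v: "0 < v" "v < 1"
  shows "\<bar>iterated_partial (replicate (nat \<lfloor>s\<rfloor>) b) f (coord_line x b u) -
      iterated_partial (replicate (nat \<lfloor>s\<rfloor>) b) f (coord_line x b v)\<bar>
    \<le> L * \<bar>u - v\<bar> powr (s - of_int \<lfloor>s\<rfloor>)"
proof -
  have "coord_line x b u - coord_line x b v = (u - v) *\<^sub>R b"
    by (simp add: coord_line_def algebra_simps)
  then have "norm (coord_line x b u - coord_line x b v) = \<bar>u - v\<bar>" using b by simp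
  with holder_class_top_increment[OF replicate_in_directions[OF b], of "coord_line x b u" "coord_line x b v"]
  show ?thesis using coord_line_in_cube[OF x b] u v by simp
qed

text \<open>Below smoothness \<open>1\<close> this is the Hoelder condition on \<open>f\<close>
  itself. Otherwise the mean value inequality on the convex cube applies, the operator norm of the
  derivative being at most the sum of its \<open>DIM('a)\<close> entries.\<close>

lemma holder_class_modulus:
  assumes "x \<in> unit_cube" "x' \<in> unit_cube"
  shows "\<bar>f x - f x'\<bar> \<le> L * real DIM('a) * norm (x - x') powr min s 1"
proof (cases "s < 1")
  case True
  then have fl: "\<lfloor>s\<rfloor> = 0" using s by linarith
  have "\<bar>f x - f x'\<bar> \<le> L * norm (x - x') powr s"
    using holder_class_top_increment[of "[]" x x'] assms by (simp add: fl directions_def)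
  also have "\<dots> \<le> L * real DIM('a) * norm (x - x') powr s"
    using L DIM_positive[where 'a = 'a] by (intro mult_right_mono) auto
  finally show ?thesis using True by simp
next
  case False
  then have k: "0 < nat \<lfloor>s\<rfloor>" by linarith
  have D: "(f has_derivative frechet_derivative f (at y within unit_cube)) (at y within unit_cube)"
    if "y \<in> unit_cube" for y
    using holder_class_partial_has_derivative[of 0 "[]" y] k that by (simp add: directions_def)
  have "norm (f x - f x') \<le> (real DIM('a) * L) * norm (x - x')"
  proof (rule differentiable_bound[OF _ D _ assms])
    fix y :: 'a assume y: "y \<in> unit_cube"
    let ?F = "frechet_derivative f (at y within unit_cube)"
    have lin: "linear ?F" using D[OF y] by (rule has_derivative_linear)
    show "onorm ?F \<le> real DIM('a) * L"
    proof (rule onorm_bound)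
      fix h :: 'a
      have "?F h = ?F (\<Sum>b\<in>Basis. (h \<bullet> b) *\<^sub>R b)" by (simp add: euclidean_representation)
      also have "\<dots> = (\<Sum>b\<in>Basis. (h \<bullet> b) * ?F b)"
        by (simp add: linear_sum[OF lin] linear_scale[OF lin])
      also have "\<bar>\<dots>\<bar> \<le> (\<Sum>b\<in>(Basis::'a set). norm h * L)"
      proof (intro order_trans[OF sum_abs] sum_mono)
        fix b :: 'a assume b: "b \<in> Basis"
        have "\<bar>?F b\<bar> \<le> L"
          using holder_class_partial_bound[of 1 "[b]" y] k y b by (simp add: directions_def)
        then show "\<bar>(h \<bullet> b) * ?F b\<bar> \<le> norm h * L"
          unfolding abs_mult using Basis_le_norm[OF b] by (intro mult_mono) auto
      qed
      finally show "norm (?F h) \<le> real DIM('a) * L * norm h" by (simp add: mult_ac)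
    qed (use L in simp)
  qed (auto intro: convex_box)
  then show ?thesis using False by (simp add: mult_ac min_def)
qed

lemma holder_class_continuous_on: "continuous_on unit_cube f"
  unfolding continuous_on_def
proof
  fix x :: 'a assume x: "x \<in> unit_cube"
  have "((\<lambda>y. norm (y - x) powr min s 1) \<longlongrightarrow> 0) (at x within unit_cube)"
    by (rule tendsto_zero_powrI[where b = "min s 1"]) (use s in \<open>auto intro!: tendsto_eq_intros\<close>)
  then have lim: "((\<lambda>y. L * real DIM('a) * norm (y - x) powr min s 1) \<longlongrightarrow> 0) (at x within unit_cube)"
    by (rule tendsto_mult_right_zero)
  have "((\<lambda>y. f y - f x) \<longlongrightarrow> 0) (at x within unit_cube)"
  proof (rule Lim_null_comparison[OF _ lim])
    show "\<forall>\<^sub>F y in at x within unit_cube. norm (f y - f x) \<le> L * real DIM('a) * norm (y - x) powr min s 1"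
      using holder_class_modulus[OF _ x] by (auto simp: eventually_at_filter)
  qed
  then show "(f \<longlongrightarrow> f x) (at x within unit_cube)" by (simp add: LIM_zero_iff)
qed

text \<open>The class bounds derivatives and increments but no value of \<open>f\<close>;
  boundedness of densities is later derived from this oscillation. One factor \<open>DIM('a)\<close>
  is the l1-diameter of the cube.\<close>

lemma holder_class_oscillation:
  assumes "x \<in> unit_cube" "x' \<in> unit_cube"
  shows "\<bar>f x - f x'\<bar> \<le> L * (real DIM('a))\<^sup>2"
proof -
  have D: "1 \<le> real DIM('a)" using DIM_positive[where 'a = 'a] by linarith
  have "norm (x - x') \<le> (\<Sum>b\<in>(Basis::'a set). \<bar>(x - x') \<bullet> b\<bar>)" by (rule norm_le_l1)
  also have "\<dots> \<le> (\<Sum>b\<in>(Basis::'a set). 1)"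
  proof (rule sum_mono)
    fix b :: 'a assume b: "b \<in> Basis"
    then have "0 \<le> x \<bullet> b" "x \<bullet> b \<le> 1" "0 \<le> x' \<bullet> b" "x' \<bullet> b \<le> 1"
      using assms by (auto simp: mem_box)
    then show "\<bar>(x - x') \<bullet> b\<bar> \<le> 1" by (simp add: inner_diff_left)
  qed
  finally have n: "norm (x - x') \<le> real DIM('a)" by simp
  have "norm (x - x') powr min s 1 \<le> real DIM('a) powr min s 1"
    using n s by (intro powr_mono2) auto
  also have "\<dots> \<le> real DIM('a) powr 1" using D by (intro powr_mono) auto
  finally have "norm (x - x') powr min s 1 \<le> real DIM('a)" using D by simp
  then have "L * real DIM('a) * norm (x - x') powr min s 1 \<le> L * real DIM('a) * real DIM('a)"
    using L by (intro mult_left_mono) auto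
  then show ?thesis using holder_class_modulus[OF assms] by (simp add: power2_eq_square)
qed

end


section \<open>Reconstructing Hoelder functions from cell averages\<close>

text \<open>Half-open cells are pairwise disjoint; the faces of the cube with a coordinate equal to
  \<open>1\<close> stay uncovered, which is a null set.\<close>

definition grid_cell :: "nat \<Rightarrow> ('a::euclidean_space \<Rightarrow> nat) \<Rightarrow> 'a set" where
  "grid_cell N \<kappa> = {x. \<forall>b\<in>Basis. real (\<kappa> b) / real N \<le> x \<bullet> b \<and> x \<bullet> b < real (Suc (\<kappa> b)) / real N}"

abbreviation grid :: "nat \<Rightarrow> ('a::euclidean_space \<Rightarrow> nat) set" where
  "grid N \<equiv> Basis \<rightarrow>\<^sub>E {..<N}"

lemma finite_grid: "finite (grid N :: ('a::euclidean_space \<Rightarrow> nat) set)"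
  by (intro finite_PiE) auto

lemma card_grid: "card (grid N :: ('a::euclidean_space \<Rightarrow> nat) set) = N ^ DIM('a)"
  by (simp add: card_PiE)

lemma grid_cell_borel[measurable]: "grid_cell N \<kappa> \<in> sets borel"
proof -
  have "grid_cell N \<kappa> = {x\<in>space borel. \<forall>b\<in>Basis. real (\<kappa> b) / real N \<le> x \<bullet> b \<and> x \<bullet> b < real (Suc (\<kappa> b)) / real N}"
    by (simp add: grid_cell_def)
  also have "\<dots> \<in> sets borel" by measurable
  finally show ?thesis .
qed

lemma indicator_grid_cell:
  "indicator (grid_cell N \<kappa>) x =
    (\<Prod>b\<in>Basis. indicator {real (\<kappa> b) / real N..<real (Suc (\<kappa> b)) / real N} (x \<bullet> b) :: real)"
proof (cases "x \<in> grid_cell N \<kappa>")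
  case True
  then show ?thesis by (auto simp: grid_cell_def intro!: prod.neutral[symmetric])
next
  case False
  then obtain b where "b \<in> Basis" "x \<bullet> b \<notin> {real (\<kappa> b) / real N..<real (Suc (\<kappa> b)) / real N}"
    by (auto simp: grid_cell_def)
  then have "(\<Prod>b\<in>Basis. indicator {real (\<kappa> b) / real N..<real (Suc (\<kappa> b)) / real N} (x \<bullet> b) :: real) = 0"
    by (intro prod_zero) (auto intro!: bexI[of _ b] simp: indicator_def simp del: of_nat_Suc)
  then show ?thesis using False by simp
qed

lemma grid_cell_subset_cube:
  assumes "\<kappa> \<in> Basis \<rightarrow> {..<N}" shows "grid_cell N \<kappa> \<subseteq> unit_cube"
proof
  fix x assume x: "x \<in> grid_cell N \<kappa>"
  show "x \<in> unit_cube"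
  proof (clarsimp simp: mem_box)
    fix b :: 'a assume b: "b \<in> Basis"
    then have k: "\<kappa> b < N" using assms by auto
    then have "real (Suc (\<kappa> b)) / real N \<le> 1" by simp
    moreover have "0 \<le> real (\<kappa> b) / real N" by simp
    moreover have "real (\<kappa> b) / real N \<le> x \<bullet> b" "x \<bullet> b < real (Suc (\<kappa> b)) / real N"
      using x b unfolding grid_cell_def by auto
    ultimately show "0 \<le> x \<bullet> b \<and> x \<bullet> b \<le> 1" by linarith
  qed
qed

lemma lborel_grid_cell:
  assumes "N > 0"
  shows "emeasure lborel (grid_cell N \<kappa> :: 'a::euclidean_space set) = ennreal (1 / real N ^ DIM('a))"
    "measure lborel (grid_cell N \<kappa> :: 'a::euclidean_space set) = 1 / real N ^ DIM('a)"
proof -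
  let ?J = "\<lambda>b::'a. {real (\<kappa> b) / real N..<real (Suc (\<kappa> b)) / real N}"
  have le: "real (\<kappa> b) / real N \<le> real (Suc (\<kappa> b)) / real N" for b
    by (simp add: divide_right_mono)
  have int: "integrable lborel (indicator (?J b) :: real \<Rightarrow> real)" for b
    using le[of b] by (intro integrable_real_indicator) auto
  have "(\<integral>u. indicator (?J b) u \<partial>lborel) = 1 / real N" for b
    using le[of b] by (simp add: diff_divide_distrib[symmetric])
  with integral_prod_lborel[OF int, where 'a = 'a]
  have i: "(\<integral>x. indicator (grid_cell N \<kappa>) (x::'a) \<partial>lborel) = (1 / real N) ^ DIM('a)"
    unfolding indicator_grid_cell by simp
  have "integrable lborel (indicator (grid_cell N \<kappa>) :: 'a \<Rightarrow> real)"
    unfolding indicator_grid_cell[abs_def] by (rule integrable_prod_lborel[OF int])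
  then have fin: "emeasure lborel (grid_cell N \<kappa> :: 'a set) < \<infinity>"
    by (simp add: integrable_indicator_iff)
  show m: "measure lborel (grid_cell N \<kappa> :: 'a set) = 1 / real N ^ DIM('a)"
    using i by (simp add: power_divide)
  show "emeasure lborel (grid_cell N \<kappa> :: 'a set) = ennreal (1 / real N ^ DIM('a))"
    using fin unfolding m[symmetric] by (simp add: emeasure_eq_ennreal_measure less_top)
qed

text \<open>Rescaling an interval of length \<open>1 / R\<close> to the unit interval multiplies a
  derivative of order \<open>\<lfloor>s\<rfloor>\<close> by \<open>R^-\<lfloor>s\<rfloor>\<close>,
  and the Hoelder exponent supplies the missing \<open>s - \<lfloor>s\<rfloor>\<close>, in total
  \<open>R powr - s\<close>. The sum over subcells is written as one kernel under the integral, the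
  form required by \<open>tensor_reproduction\<close>.\<close>

lemma holder_slice_reconstruction:
  fixes s :: real
  assumes s: "s > 0"
  obtains w :: "nat \<Rightarrow> real \<Rightarrow> real" and C :: real
  where "C \<ge> 1" "\<And>i t. 0 \<le> t \<Longrightarrow> t \<le> 1 \<Longrightarrow> \<bar>w i t\<bar> \<le> C"
    "\<And>L f q (b::'a::euclidean_space) x R \<mu> t. \<lbrakk>L > 0; f \<in> holder_class s L; q \<in> holder_class s L; b \<in> Basis;
       x \<in> unit_cube; \<mu> < R; real \<mu> / real R < t; t < real (Suc \<mu>) / real R\<rbrakk> \<Longrightarrow>
       \<bar>(f (coord_line x b t) - q (coord_line x b t)) -
         (\<integral>u. (\<Sum>i<Suc (nat \<lfloor>s\<rfloor>). w i (real R * t - real \<mu>) * (real R *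
            indicator {real (Suc (nat \<lfloor>s\<rfloor>) * \<mu> + i) / real (Suc (nat \<lfloor>s\<rfloor>) * R)..<
              real (Suc (Suc (nat \<lfloor>s\<rfloor>) * \<mu> + i)) / real (Suc (nat \<lfloor>s\<rfloor>) * R)} u)) *
            (f (coord_line x b u) - q (coord_line x b u)) \<partial>lborel)\<bar> \<le> C * L * real R powr - s"
proof -
  define k where "k = nat \<lfloor>s\<rfloor>"
  obtain w and C :: real where C: "C \<ge> 1" and w: "\<And>i t. 0 \<le> t \<Longrightarrow> t \<le> 1 \<Longrightarrow> \<bar>w i t\<bar> \<le> C"
    and rec: "\<And>g \<delta> t. \<lbrakk>\<And>m t. m < k \<Longrightarrow> 0 < t \<Longrightarrow> t < 1 \<Longrightarrow> (g m has_real_derivative g (Suc m) t) (at t);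
       \<And>u v. 0 < u \<Longrightarrow> u < 1 \<Longrightarrow> 0 < v \<Longrightarrow> v < 1 \<Longrightarrow> \<bar>g k u - g k v\<bar> \<le> \<delta>;
       continuous_on {0..1} (g 0); 0 < t; t < 1\<rbrakk> \<Longrightarrow>
       \<bar>g 0 t - (\<Sum>i<Suc k. w i t *
         (\<integral>u. indicator {real i / real (Suc k)..real (Suc i) / real (Suc k)} u * g 0 u \<partial>lborel))\<bar> \<le> C * \<delta>"
    by (rule cell_reconstruction[of k]) blast
  show ?thesis
  \<comment> \<open>The factor \<open>2\<close> arises because \<open>f\<close> and \<open>q\<close>
    each contribute a Hoelder bound to their difference.\<close>
  proof (rule that[of "2 * C" w], unfold k_def[symmetric])
    fix L :: real and f q :: "'a \<Rightarrow> real" and b x :: 'a and R \<mu> :: nat and t :: real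
    assume L: "L > 0" and f: "f \<in> holder_class s L" and q: "q \<in> holder_class s L" and b: "b \<in> Basis"
      and x: "x \<in> unit_cube" and \<mu>: "\<mu> < R" and t: "real \<mu> / real R < t" "t < real (Suc \<mu>) / real R"
    have R: "real R > 0" using \<mu> by simp
    let ?r = "Suc k"
    let ?pt = "\<lambda>v. (real \<mu> + v) / real R"
    let ?ip = "\<lambda>f m u. iterated_partial (replicate m b) f (coord_line x b u)"
    \<comment> \<open>The factor \<open>(1 / R) ^ m\<close> makes \<open>g (Suc m)\<close> the
      derivative of \<open>g m\<close> in the rescaled variable.\<close>
    define g where "g m v = (1 / real R) ^ m * (?ip f m (?pt v) - ?ip q m (?pt v))" for m v
    have pt: "0 < ?pt v" "?pt v < 1" if "0 < v" "v < 1" for v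
    proof -
      show "0 < ?pt v" using that R by (intro divide_pos_pos) auto
      have "real \<mu> + 1 \<le> real R" using \<mu> by simp
      then show "?pt v < 1" using that R by simp
    qed
    have pt': "0 \<le> ?pt v" "?pt v \<le> 1" if "0 \<le> v" "v \<le> 1" for v
    proof -
      show "0 \<le> ?pt v" using that R by (intro divide_nonneg_pos) auto
      have "real \<mu> + 1 \<le> real R" using \<mu> by simp
      then show "?pt v \<le> 1" using that R by simp
    qed
    have D: "(g m has_real_derivative g (Suc m) v) (at v)" if m: "m < k" and v: "0 < v" "v < 1" for m v
    proof -
      have pt_d: "((\<lambda>v. ?pt v) has_real_derivative 1 / real R) (at v)"
        using R by (auto intro!: derivative_eq_intros)
      have "((\<lambda>v. ?ip h m (?pt v)) has_real_derivative ?ip h (Suc m) (?pt v) * (1 / real R)) (at v)"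
        if h: "h \<in> holder_class s L" for h
        by (rule DERIV_chain'[OF pt_d holder_class_slice_derivative[OF s L h b x]])
           (use m v pt in \<open>auto simp: k_def\<close>)
      from this[OF f] this[OF q] show ?thesis
        unfolding g_def by (auto intro!: derivative_eq_intros simp: algebra_simps)
    qed
    have H: "\<bar>g k u - g k v\<bar> \<le> 2 * L * real R powr - s"
      if u: "0 < u" "u < 1" and v: "0 < v" "v < 1" for u v
    proof -
      have k: "s - of_int \<lfloor>s\<rfloor> = s - real k" using s by (simp add: k_def)
      have "\<bar>u - v\<bar> \<le> 1" using u v by simp
      then have "\<bar>?pt u - ?pt v\<bar> \<le> 1 / real R"
        using R by (simp add: diff_divide_distrib[symmetric] divide_right_mono)
      moreover have "0 \<le> s - real k" unfolding k[symmetric] by simp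
      ultimately have p: "\<bar>?pt u - ?pt v\<bar> powr (s - real k) \<le> (1 / real R) powr (s - real k)"
        by (intro powr_mono2) auto
      have inc: "\<bar>?ip h k (?pt u) - ?ip h k (?pt v)\<bar> \<le> L * (1 / real R) powr (s - real k)"
        if h: "h \<in> holder_class s L" for h
      proof -
        have "\<bar>?ip h k (?pt u) - ?ip h k (?pt v)\<bar> \<le> L * \<bar>?pt u - ?pt v\<bar> powr (s - real k)"
          using holder_class_slice_increment[OF s L h b x pt[OF u] pt[OF v]]
          unfolding k k_def[symmetric] .
        also have "\<dots> \<le> L * (1 / real R) powr (s - real k)"
          using p L by (intro mult_left_mono) auto
        finally show ?thesis .
      qed
      have "\<bar>g k u - g k v\<bar> = (1 / real R) ^ k *
          \<bar>(?ip f k (?pt u) - ?ip f k (?pt v)) - (?ip q k (?pt u) - ?ip q k (?pt v))\<bar>"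
      proof -
        have "a * (p - q) - a * (p' - q') = a * ((p - p') - (q - q'))" for a p q p' q' :: real
          by (simp add: algebra_simps)
        then show ?thesis unfolding g_def by (simp only: abs_mult power_abs abs_divide abs_one abs_of_nat)
      qed
      also have "\<dots> \<le> (1 / real R) ^ k * (2 * (L * (1 / real R) powr (s - real k)))"
        using inc[OF f] inc[OF q] R by (intro mult_left_mono) auto
      also have "\<dots> = 2 * L * ((1 / real R) powr real k * (1 / real R) powr (s - real k))"
        using R by (simp add: powr_realpow)
      also have "\<dots> = 2 * L * (1 / real R) powr s" by (simp add: powr_add[symmetric])
      also have "(1 / real R) powr s = real R powr - s"
        using R by (simp add: powr_divide powr_minus_divide)
      finally show ?thesis .
    qed
    define h where "h u = f (coord_line x b u) - q (coord_line x b u)" for u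
    have g0: "g 0 v = h (?pt v)" for v by (simp add: g_def h_def)
    have cont_h: "continuous_on {0..1} h"
    proof -
      have "continuous_on {0..1} (\<lambda>u. F (coord_line x b u))" if "F \<in> holder_class s L" for F
        by (rule continuous_on_compose2[OF holder_class_continuous_on[OF s L that]])
           (auto simp: coord_line_def intro!: continuous_intros coord_line_in_cube[OF x b, unfolded coord_line_def])
      then show ?thesis unfolding h_def using f q by (intro continuous_intros)
    qed
    have cont: "continuous_on {0..1} (g 0)"
      unfolding g0 by (rule continuous_on_compose2[OF cont_h]) (use R pt' in \<open>auto intro!: continuous_intros\<close>)
    define \<tau> where "\<tau> = real R * t - real \<mu>"
    have \<tau>: "0 < \<tau>" "\<tau> < 1" "?pt \<tau> = t"
      using t R by (auto simp: \<tau>_def field_simps)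
    let ?J = "\<lambda>i. {real (?r * \<mu> + i) / real (?r * R)..<real (Suc (?r * \<mu> + i)) / real (?r * R)}"
    have cell: "(\<integral>v. indicator {real i / real ?r..real (Suc i) / real ?r} v * g 0 v \<partial>lborel)
        = (\<integral>u. real R * indicator (?J i) u * h u \<partial>lborel)" if "i < ?r" for i
    proof -
      have "(\<integral>u. indicator (?J i) u * h u \<partial>lborel) =
          \<bar>1 / real R\<bar> *\<^sub>R (\<integral>v. indicator (?J i) (real \<mu> / real R + 1 / real R * v) *
            h (real \<mu> / real R + 1 / real R * v) \<partial>lborel)"
        by (rule lborel_integral_real_affine) (use R in simp)
      also have "(\<integral>v. indicator (?J i) (real \<mu> / real R + 1 / real R * v) *
            h (real \<mu> / real R + 1 / real R * v) \<partial>lborel) =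
          (\<integral>v. indicator {real i / real ?r..<real (Suc i) / real ?r} v * g 0 v \<partial>lborel)"
      proof (rule Bochner_Integration.integral_cong[OF refl])
        fix v :: real
        have e: "real (?r * \<mu> + j) / real (?r * R) = real \<mu> / real R + 1 / real R * (real j / real ?r)" for j
        proof -
          have "(a * m + c) / (a * p) = m / p + 1 / p * (c / a)" if "a > 0" "p > 0" for a m c p :: real
            using that by (simp add: field_simps)
          then show ?thesis using R unfolding of_nat_add of_nat_mult by simp
        qed
        have "real \<mu> / real R + 1 / real R * v \<in> ?J i \<longleftrightarrow> v \<in> {real i / real ?r..<real (Suc i) / real ?r}"
        proof -
          have "0 < 1 / real R" using R by simp
          then show ?thesis
            unfolding atLeastLessThan_iff add_Suc_right[symmetric] e add_le_cancel_left add_less_cancel_left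
            by (simp only: mult_le_cancel_left_pos mult_less_cancel_left_pos)
        qed
        then show "indicator (?J i) (real \<mu> / real R + 1 / real R * v) * h (real \<mu> / real R + 1 / real R * v) =
            indicator {real i / real ?r..<real (Suc i) / real ?r} v * g 0 v"
          unfolding g0 by (simp add: indicator_def add_divide_distrib)
      qed
      also have "\<dots> = (\<integral>v. indicator {real i / real ?r..real (Suc i) / real ?r} v * g 0 v \<partial>lborel)"
      proof -
        \<comment> \<open>\<open>cell_reconstruction\<close> uses closed cells and the grid
          half-open ones; they differ in one endpoint.\<close>
        have "AE v in lborel. v \<noteq> real (Suc i) / real ?r" by (rule AE_lborel_singleton)
        then have ae: "AE v in lborel. indicator {real i / real ?r..<real (Suc i) / real ?r} v * g 0 v =
           indicator {real i / real ?r..real (Suc i) / real ?r} v * g 0 v"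
          by eventually_elim (auto simp: indicator_def)
        have sub: "{real i / real ?r..real (Suc i) / real ?r} \<subseteq> {0..1}"
          using that by (auto simp: field_simps intro: order_trans)
        have "set_integrable lborel {real i / real ?r..real (Suc i) / real ?r} (g 0)"
          by (rule borel_integrable_atLeastAtMost'[OF continuous_on_subset[OF cont sub]])
        moreover from this
        have "set_integrable lborel {real i / real ?r..<real (Suc i) / real ?r} (g 0)"
          by (rule set_integrable_subset) auto
        ultimately show ?thesis
          unfolding set_integrable_def real_scaleR_def
          by (intro integral_cong_AE ae) (rule borel_measurable_integrable, assumption)+
      qed
      finally show ?thesis using R by (simp add: mult.assoc)
    qed
    have hJ: "integrable lborel (\<lambda>u. indicator (?J i) u * h u)" if "i < ?r" for i
    proof -
      have h01: "set_integrable lborel {0..1} h"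
        by (rule borel_integrable_atLeastAtMost'[OF cont_h])
      have "?J i \<subseteq> {0..1}"
      proof -
        have "?r * \<mu> + i < ?r * R"
          using that \<mu> mult_le_mono2[of "Suc \<mu>" R ?r] by simp
        then have "real (Suc (?r * \<mu> + i)) \<le> real (?r * R)" by (simp only: of_nat_le_iff Suc_le_eq)
        then have "real (Suc (?r * \<mu> + i)) / real (?r * R) \<le> 1"
        proof -
          have "0 < real (?r * R)" unfolding of_nat_mult by (rule mult_pos_pos) (use R in simp_all)
          from divide_le_eq_1_pos[OF this, THEN iffD2] show ?thesis
            using \<open>real (Suc (?r * \<mu> + i)) \<le> real (?r * R)\<close> .
        qed
        moreover have "0 \<le> real (?r * \<mu> + i) / real (?r * R)" by simp
        ultimately show ?thesis by (intro subsetI) (simp only: atLeastLessThan_iff atLeastAtMost_iff, linarith)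
      qed
      from set_integrable_subset[OF h01 _ this] have "set_integrable lborel (?J i) h" by simp
      then show ?thesis by (simp only: set_integrable_def real_scaleR_def)
    qed
    have "\<bar>g 0 \<tau> - (\<Sum>i<?r. w i \<tau> *
         (\<integral>v. indicator {real i / real ?r..real (Suc i) / real ?r} v * g 0 v \<partial>lborel))\<bar>
        \<le> C * (2 * L * real R powr - s)"
      by (rule rec[OF D H cont \<tau>(1,2)])
    also have "(\<Sum>i<?r. w i \<tau> * (\<integral>v. indicator {real i / real ?r..real (Suc i) / real ?r} v * g 0 v \<partial>lborel))
       = (\<integral>u. (\<Sum>i<?r. w i \<tau> * (real R * indicator (?J i) u)) * h u \<partial>lborel)"
    proof -
      have "(\<integral>u. (\<Sum>i<?r. w i \<tau> * (real R * indicator (?J i) u)) * h u \<partial>lborel)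
          = (\<integral>u. (\<Sum>i<?r. w i \<tau> * (real R * (indicator (?J i) u * h u))) \<partial>lborel)"
        by (simp only: sum_distrib_right mult.assoc)
      also have "\<dots> = (\<Sum>i<?r. \<integral>u. w i \<tau> * (real R * (indicator (?J i) u * h u)) \<partial>lborel)"
        by (rule Bochner_Integration.integral_sum) (use hJ in auto)
      also have "\<dots> = (\<Sum>i<?r. w i \<tau> * (\<integral>u. real R * indicator (?J i) u * h u \<partial>lborel))"
        by (simp only: integral_mult_right_zero mult.assoc)
      finally show ?thesis using cell by (simp cong: sum.cong_simp)
    qed
    finally have "\<bar>h t - (\<integral>u. (\<Sum>i<?r. w i \<tau> * (real R * indicator (?J i) u)) * h u \<partial>lborel)\<bar>
        \<le> 2 * C * L * real R powr - s"
      unfolding g0 \<tau>(3) by (simp only: mult.assoc mult.left_commute[of C 2])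
    then show "\<bar>(f (coord_line x b t) - q (coord_line x b t)) -
         (\<integral>u. (\<Sum>i<?r. w i (real R * t - real \<mu>) * (real R * indicator (?J i) u)) *
            (f (coord_line x b u) - q (coord_line x b u)) \<partial>lborel)\<bar> \<le> 2 * C * L * real R powr - s"
      unfolding h_def \<tau>_def .
  next
    show "\<bar>w i t\<bar> \<le> 2 * C" if "0 \<le> t" "t \<le> 1" for i t
      using w[OF that, of i] C by linarith
  qed (use C in simp)
qed

lemma AE_inner_Basis_neq:
  fixes b :: "'a::euclidean_space"
  assumes "b \<in> Basis" shows "AE x in lborel. x \<bullet> b \<noteq> c"
proof -
  have "{x. x \<bullet> b = c} \<in> null_sets lebesgue"
    using negligible_standard_hyperplane[OF assms, of c] by (simp add: negligible_iff_null_sets)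
  then have "AE x in lebesgue. x \<notin> {x. x \<bullet> b = c}" by (rule AE_not_in)
  then show ?thesis by (simp add: AE_completion_iff)
qed

lemma grid_cell_cong: "(\<And>b. b \<in> Basis \<Longrightarrow> \<kappa> b = \<kappa>' b) \<Longrightarrow> grid_cell N \<kappa> = grid_cell N \<kappa>'"
  by (simp add: grid_cell_def)

lemma holder_class_borel_measurable_indicator:
  assumes "s > 0" "L > 0" "f \<in> holder_class s L"
  shows "(\<lambda>x. indicator unit_cube x * f x) \<in> borel_measurable borel"
  using borel_measurable_continuous_on_indicator[OF _ holder_class_continuous_on[OF assms]] by simp

lemma holder_class_indicator_bounded:
  assumes "s > 0" "L > 0" "f \<in> holder_class s L"
  obtains M where "\<And>x. \<bar>indicator unit_cube x * f x\<bar> \<le> M"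
proof -
  have "compact (f ` unit_cube)"
    by (intro compact_continuous_image holder_class_continuous_on[OF assms] compact_cbox)
  then obtain M where M: "\<And>y. y \<in> f ` unit_cube \<Longrightarrow> \<bar>y\<bar> \<le> M"
    by (metis compact_imp_bounded bounded_real)
  have "\<bar>indicator unit_cube x * f x\<bar> \<le> max 0 M" for x
    using M[of "f x"] by (cases "x \<in> unit_cube") auto
  then show ?thesis by (rule that)
qed

text \<open>Inside a box, the product of the one-dimensional kernels reproduces \<open>f - q\<close>
  by \<open>tensor_reproduction\<close>. Multiplying out the kernels leaves one term for each
  subcell, with weight at most \<open>C ^ DIM('a)\<close> and normalisation
  \<open>R ^ DIM('a)\<close>, so that only cell integrals of \<open>f - q\<close> occur.\<close>

lemma holder_box_reconstruction:
  fixes s :: real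
  assumes s: "s > 0"
  obtains C :: real where "C \<ge> 0"
    "\<And>L f q R \<mu> (x::'a::euclidean_space). \<lbrakk>L > 0; f \<in> holder_class s L; q \<in> holder_class s L;
       \<And>b. b \<in> Basis \<Longrightarrow> \<mu> b < R;
       \<And>b. b \<in> Basis \<Longrightarrow> real (\<mu> b) / real R < x \<bullet> b;
       \<And>b. b \<in> Basis \<Longrightarrow> x \<bullet> b < real (Suc (\<mu> b)) / real R\<rbrakk> \<Longrightarrow>
       \<bar>f x - q x\<bar> \<le> C * (real R ^ DIM('a) * (\<Sum>i\<in>grid (Suc (nat \<lfloor>s\<rfloor>)).
         \<bar>\<integral>y. indicator (grid_cell (Suc (nat \<lfloor>s\<rfloor>) * R) (\<lambda>b. Suc (nat \<lfloor>s\<rfloor>) * \<mu> b + i b)) y * (f y - q y) \<partial>lborel\<bar>)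
         + L * real R powr - s)"
proof -
  define r where "r = Suc (nat \<lfloor>s\<rfloor>)"
  have r: "r > 0" by (simp add: r_def)
  obtain w and C :: real where C: "C \<ge> 1" and w: "\<And>i t. 0 \<le> t \<Longrightarrow> t \<le> 1 \<Longrightarrow> \<bar>w i t\<bar> \<le> C"
    and rec: "\<And>L f q (b::'a) x R \<mu> t. \<lbrakk>L > 0; f \<in> holder_class s L; q \<in> holder_class s L; b \<in> Basis;
       x \<in> unit_cube; \<mu> < R; real \<mu> / real R < t; t < real (Suc \<mu>) / real R\<rbrakk> \<Longrightarrow>
       \<bar>(f (coord_line x b t) - q (coord_line x b t)) -
         (\<integral>u. (\<Sum>i<r. w i (real R * t - real \<mu>) * (real R *
            indicator {real (r * \<mu> + i) / real (r * R)..<real (Suc (r * \<mu> + i)) / real (r * R)} u)) *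
            (f (coord_line x b u) - q (coord_line x b u)) \<partial>lborel)\<bar> \<le> C * L * real R powr - s"
    unfolding r_def by (rule holder_slice_reconstruction[OF s, where 'a = 'a]) blast
  define D where "D = real DIM('a) * C ^ DIM('a) * C"
  have D: "D \<ge> 0" using C by (simp add: D_def)
  show ?thesis
  proof (rule that[of "C ^ DIM('a) + D"], unfold r_def[symmetric])
    fix L :: real and f q :: "'a \<Rightarrow> real" and R :: nat and \<mu> :: "'a \<Rightarrow> nat" and x :: 'a
    assume L: "L > 0" and f: "f \<in> holder_class s L" and q: "q \<in> holder_class s L"
      and \<mu>: "\<And>b. b \<in> Basis \<Longrightarrow> \<mu> b < R"
      and lo: "\<And>b. b \<in> Basis \<Longrightarrow> real (\<mu> b) / real R < x \<bullet> b"
      and hi: "\<And>b. b \<in> Basis \<Longrightarrow> x \<bullet> b < real (Suc (\<mu> b)) / real R"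
    have R: "R > 0" using \<mu> nonempty_Basis by fastforce
    define \<tau> where "\<tau> b = real R * (x \<bullet> b) - real (\<mu> b)" for b
    have \<tau>: "0 \<le> \<tau> b" "\<tau> b \<le> 1" if "b \<in> Basis" for b
      using lo[OF that] hi[OF that] R by (auto simp: \<tau>_def field_simps)
    define J where "J b i = {real (r * \<mu> b + i) / real (r * R)..<real (Suc (r * \<mu> b + i)) / real (r * R)}" for b i
    define K where "K b u = (\<Sum>i<r. w i (\<tau> b) * (real R * indicator (J b i) u))" for b u
    \<comment> \<open>Off the cube \<open>f\<close> and \<open>q\<close> are arbitrary; extension by
      zero gives a function that is globally bounded and measurable.\<close>
    define h where "h y = indicator unit_cube y * f y - indicator unit_cube y * q y" for y :: 'a
    define emb where "emb y = (\<Sum>b\<in>Basis. y b *\<^sub>R b)" for y :: "'a \<Rightarrow> real"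
    define H where "H y = h (emb y)" for y
    have J_le: "real (r * \<mu> b + i) / real (r * R) \<le> real (Suc (r * \<mu> b + i)) / real (r * R)" for b i
      by (rule divide_right_mono) auto
    have J_int: "integrable lborel (indicator (J b i) :: real \<Rightarrow> real)" for b i
      unfolding J_def using J_le[of b i] by (intro integrable_real_indicator) auto
    have J_len: "(\<integral>u. indicator (J b i) u \<partial>lborel) = 1 / real (r * R)" for b i
      unfolding J_def using J_le[of b i] by (simp add: diff_divide_distrib[symmetric])
    have sub: "J b i \<subseteq> {0..1}" if b: "b \<in> Basis" and i: "i < r" for b i
    proof -
      have "r * \<mu> b + i < r * R"
        using i mult_le_mono2[of "Suc (\<mu> b)" R r] \<mu>[OF b] by simp
      then have "real (Suc (r * \<mu> b + i)) \<le> real (r * R)" by (simp only: of_nat_le_iff Suc_le_eq)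
      then have "real (Suc (r * \<mu> b + i)) / real (r * R) \<le> 1"
        using R r by (subst divide_le_eq_1_pos) auto
      moreover have "0 \<le> real (r * \<mu> b + i) / real (r * R)" by simp
      ultimately show ?thesis unfolding J_def
        by (intro subsetI) (simp only: atLeastLessThan_iff atLeastAtMost_iff, linarith)
    qed
    have K_int: "integrable lborel (K b)" for b
      unfolding K_def using J_int by (intro Bochner_Integration.integrable_sum integrable_mult_right) auto
    \<comment> \<open>Each of the \<open>r\<close> subintervals has length \<open>1 / (r R)\<close>
      and carries a height of at most \<open>C R\<close>.\<close>
    have K_B: "(\<integral>u. \<bar>K b u\<bar> \<partial>lborel) \<le> C" if b: "b \<in> Basis" for b
    proof -
      have "(\<integral>u. \<bar>K b u\<bar> \<partial>lborel) \<le> (\<integral>u. (\<Sum>i<r. C * (real R * indicator (J b i) u)) \<partial>lborel)"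
      proof (rule integral_mono)
        show "integrable lborel (\<lambda>u. \<bar>K b u\<bar>)" using K_int by simp
        show "integrable lborel (\<lambda>u. \<Sum>i<r. C * (real R * indicator (J b i) u))"
          using J_int by (intro Bochner_Integration.integrable_sum integrable_mult_right) auto
        fix u :: real
        show "\<bar>K b u\<bar> \<le> (\<Sum>i<r. C * (real R * indicator (J b i) u))"
          unfolding K_def
        proof (intro order_trans[OF sum_abs] sum_mono)
          fix i
          show "\<bar>w i (\<tau> b) * (real R * indicator (J b i) u)\<bar> \<le> C * (real R * indicator (J b i) u)"
            unfolding abs_mult[of "w i (\<tau> b)"] using w[OF \<tau>[OF b], of i] C by (intro mult_mono) auto
        qed
      qed
      also have "\<dots> = (\<Sum>i<r. C * (real R * (\<integral>u. indicator (J b i) u \<partial>lborel)))"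
        using J_int by (subst Bochner_Integration.integral_sum) (auto intro!: integrable_mult_right)
      also have "\<dots> = C" unfolding J_len using r R by simp
      finally show ?thesis .
    qed
    have K_supp: "K b u = 0" if "b \<in> Basis" "u \<notin> {0..1}" for b u
    proof -
      have "u \<notin> J b i" if "i < r" for i using sub[OF \<open>b \<in> Basis\<close> that] \<open>u \<notin> {0..1}\<close> by blast
      then show ?thesis unfolding K_def by (intro sum.neutral) simp
    qed
    have h_meas[measurable]: "h \<in> borel_measurable borel"
      unfolding h_def using holder_class_borel_measurable_indicator[OF s L f] holder_class_borel_measurable_indicator[OF s L q]
      by (rule borel_measurable_diff)
    obtain Mf Mq where Mf: "\<And>x. \<bar>indicator unit_cube x * f x\<bar> \<le> Mf"
      and Mq: "\<And>x. \<bar>indicator unit_cube x * q x\<bar> \<le> Mq"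
      using holder_class_indicator_bounded[OF s L f] holder_class_indicator_bounded[OF s L q] by metis
    have h_bd: "\<bar>h y\<bar> \<le> Mf + Mq" for y
      unfolding h_def using Mf[of y] Mq[of y] by linarith
    have x: "x \<in> unit_cube"
    proof (clarsimp simp: mem_box)
      fix b :: 'a assume b: "b \<in> Basis"
      have "real (Suc (\<mu> b)) / real R \<le> 1" "0 \<le> real (\<mu> b) / real R" using \<mu>[OF b] R by auto
      then show "0 \<le> x \<bullet> b \<and> x \<bullet> b \<le> 1" using lo[OF b] hi[OF b] by linarith
    qed
    have h_cube: "h y = f y - q y" if "y \<in> unit_cube" for y using that by (simp add: h_def)
    define x' where "x' = (\<lambda>b\<in>Basis. x \<bullet> b)"
    have emb_x: "emb x' = x" by (simp add: emb_def x'_def euclidean_representation)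
    have emb_upd: "emb (y(b := u)) = coord_line (emb y) b u" if "b \<in> Basis" for y b u
      by (rule euclidean_eqI) (simp add: coord_line_inner that emb_def sum_Basis_inner)
    have emb_cube: "emb y \<in> unit_cube" if "y \<in> Basis \<rightarrow>\<^sub>E {0..1}" for y
      using that by (auto simp: mem_box emb_def sum_Basis_inner)
    have "\<bar>H x' - (\<integral>y. (\<Prod>b\<in>Basis. K b (y b)) * H y \<partial>(\<Pi>\<^sub>M b\<in>(Basis::'a set). lborel))\<bar>
        \<le> real (card (Basis::'a set)) * C ^ card (Basis::'a set) * (C * L * real R powr - s)"
    proof (rule tensor_reproduction[where M = "Mf + Mq"])
      show "x' \<in> Basis \<rightarrow>\<^sub>E {0..1}" using x by (auto simp: x'_def mem_box)
      show "H \<in> borel_measurable (\<Pi>\<^sub>M i\<in>Basis. lborel)" unfolding H_def emb_def by measurable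
      show "\<bar>H y\<bar> \<le> Mf + Mq" for y unfolding H_def by (rule h_bd)
      show "0 \<le> C * L * real R powr - s" using C L by simp
      fix b :: 'a and y :: "'a \<Rightarrow> real" assume b: "b \<in> Basis" and y: "y \<in> Basis \<rightarrow>\<^sub>E {0..1}"
      have line: "H (y(b := u)) = f (coord_line (emb y) b u) - q (coord_line (emb y) b u)" if "u \<in> {0..1}" for u
        unfolding H_def emb_upd[OF b] using that by (intro h_cube coord_line_in_cube[OF emb_cube[OF y] b]) auto
      have xb: "x' b \<in> {0..1}" "x' b = x \<bullet> b" using b x by (auto simp: x'_def mem_box)
      have "(\<lambda>u. K b u * H (y(b := u))) =
          (\<lambda>u. K b u * (f (coord_line (emb y) b u) - q (coord_line (emb y) b u)))"
      proof
        fix u show "K b u * H (y(b := u)) = K b u * (f (coord_line (emb y) b u) - q (coord_line (emb y) b u))"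
          using line K_supp[OF b] by (cases "u \<in> {0..1}") auto
      qed
      note eq = this
      have rb: "\<bar>(f (coord_line (emb y) b (x \<bullet> b)) - q (coord_line (emb y) b (x \<bullet> b))) -
          (\<integral>u. K b u * (f (coord_line (emb y) b u) - q (coord_line (emb y) b u)) \<partial>lborel)\<bar> \<le> C * L * real R powr - s"
        using rec[OF L f q b emb_cube[OF y] \<mu>[OF b] lo[OF b] hi[OF b]]
        unfolding K_def \<tau>_def J_def .
      show "\<bar>H (y(b := x' b)) - (\<integral>u. K b u * H (y(b := u)) \<partial>lborel)\<bar> \<le> C * L * real R powr - s"
        unfolding eq line[OF xb(1)] unfolding xb(2) by (rule rb)
    qed (use C K_int K_B K_supp in auto)
    moreover have "(\<integral>y. (\<Prod>b\<in>Basis. K b (y b)) * H y \<partial>(\<Pi>\<^sub>M b\<in>(Basis::'a set). lborel))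
        = (\<integral>y. (\<Prod>b\<in>Basis. K b (y \<bullet> b)) * h y \<partial>lborel)"
    proof -
      have [measurable]: "K b \<in> borel_measurable borel" for b using K_int[of b] by simp
      have "(\<lambda>y. (\<Prod>b\<in>Basis. K b (y \<bullet> b)) * h y) \<in> borel_measurable borel" by measurable
      from integral_lborel_eq_PiM[OF this] show ?thesis
        by (simp add: H_def emb_def sum_Basis_inner cong: prod.cong)
    qed
    ultimately have main: "\<bar>f x - q x\<bar> \<le> \<bar>\<integral>y. (\<Prod>b\<in>Basis. K b (y \<bullet> b)) * h y \<partial>lborel\<bar> + D * (L * real R powr - s)"
      by (simp add: H_def emb_x h_cube[OF x] D_def mult_ac)
    let ?cell = "\<lambda>i. grid_cell (r * R) (\<lambda>b. r * \<mu> b + i b) :: 'a set"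
    have prod_K: "(\<Prod>b\<in>Basis. K b (y \<bullet> b)) * h y = (\<Sum>i\<in>grid r. (\<Prod>b\<in>Basis. w (i b) (\<tau> b)) * real R ^ DIM('a) *
        (indicator (?cell i) y * h y))" for y
      unfolding K_def
      by (subst prod_sum_PiE) (auto simp: sum_distrib_right prod.distrib indicator_grid_cell J_def mult.assoc intro!: sum.cong)
    have cell_sub: "?cell i \<subseteq> unit_cube" if "i \<in> grid r" for i
    proof (rule grid_cell_subset_cube, rule Pi_I)
      fix b :: 'a assume b: "b \<in> Basis"
      then have "i b < r" using that by auto
      then show "r * \<mu> b + i b \<in> {..<r * R}"
        using mult_le_mono2[of "Suc (\<mu> b)" R r] \<mu>[OF b] by simp
    qed
    have int_cell: "integrable lborel (\<lambda>y. indicator (?cell i) y * h y)" for i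
    proof (rule Bochner_Integration.integrable_bound)
      show "integrable lborel (\<lambda>y. indicator (?cell i) y * (Mf + Mq))"
        using lborel_grid_cell(1)[where 'a = 'a and N = "r * R"] R r by (intro integrable_mult_left integrable_real_indicator) auto
      show "AE y in lborel. norm (indicator (?cell i) y * h y) \<le> norm (indicator (?cell i) y * (Mf + Mq))"
        using h_bd by (intro AE_I2) (auto simp: indicator_def intro: order_trans[OF _ abs_ge_self])
    qed simp
    have "\<bar>\<integral>y. (\<Prod>b\<in>Basis. K b (y \<bullet> b)) * h y \<partial>lborel\<bar> =
        \<bar>\<Sum>i\<in>grid r. (\<Prod>b\<in>Basis. w (i b) (\<tau> b)) * real R ^ DIM('a) * (\<integral>y. indicator (?cell i) y * h y \<partial>lborel)\<bar>"
      unfolding prod_K using int_cell by (subst Bochner_Integration.integral_sum) auto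
    also have "\<dots> \<le> (\<Sum>i\<in>grid r. C ^ DIM('a) * real R ^ DIM('a) * \<bar>\<integral>y. indicator (?cell i) y * (f y - q y) \<partial>lborel\<bar>)"
    proof (intro order_trans[OF sum_abs] sum_mono)
      fix i :: "'a \<Rightarrow> nat" assume i: "i \<in> grid r"
      have "indicator (?cell i) y * h y = indicator (?cell i) y * (f y - q y)" for y
        using cell_sub[OF i] h_cube[of y] by (auto simp: indicator_def)
      then have e: "(\<integral>y. indicator (?cell i) y * h y \<partial>lborel) = (\<integral>y. indicator (?cell i) y * (f y - q y) \<partial>lborel)"
        by presburger
      have "\<bar>\<Prod>b\<in>Basis. w (i b) (\<tau> b)\<bar> \<le> (\<Prod>b\<in>(Basis::'a set). C)"
        unfolding abs_prod using w \<tau> by (intro prod_mono) auto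
      then show "\<bar>(\<Prod>b\<in>Basis. w (i b) (\<tau> b)) * real R ^ DIM('a) * (\<integral>y. indicator (?cell i) y * h y \<partial>lborel)\<bar>
          \<le> C ^ DIM('a) * real R ^ DIM('a) * \<bar>\<integral>y. indicator (?cell i) y * (f y - q y) \<partial>lborel\<bar>"
        unfolding e abs_mult by (intro mult_right_mono) (auto intro!: mult_right_mono)
    qed
    finally have "\<bar>\<integral>y. (\<Prod>b\<in>Basis. K b (y \<bullet> b)) * h y \<partial>lborel\<bar> \<le> C ^ DIM('a) * (real R ^ DIM('a) *
        (\<Sum>i\<in>grid r. \<bar>\<integral>y. indicator (?cell i) y * (f y - q y) \<partial>lborel\<bar>))"
      by (simp add: sum_distrib_left mult.assoc)
    also have "\<dots> \<le> (C ^ DIM('a) + D) * (real R ^ DIM('a) *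
        (\<Sum>i\<in>grid r. \<bar>\<integral>y. indicator (?cell i) y * (f y - q y) \<partial>lborel\<bar>))"
      using D by (intro mult_right_mono mult_nonneg_nonneg sum_nonneg) auto
    finally have 1: "\<bar>\<integral>y. (\<Prod>b\<in>Basis. K b (y \<bullet> b)) * h y \<partial>lborel\<bar> \<le> (C ^ DIM('a) + D) * (real R ^ DIM('a) *
        (\<Sum>i\<in>grid r. \<bar>\<integral>y. indicator (?cell i) y * (f y - q y) \<partial>lborel\<bar>))" .
    have "D * (L * real R powr - s) \<le> (C ^ DIM('a) + D) * (L * real R powr - s)"
      using C L by (intro mult_right_mono) auto
    with 1 main show "\<bar>f x - q x\<bar> \<le> (C ^ DIM('a) + D) * (real R ^ DIM('a) *
        (\<Sum>i\<in>grid r. \<bar>\<integral>y. indicator (?cell i) y * (f y - q y) \<partial>lborel\<bar>) + L * real R powr - s)"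
      unfolding distrib_left[of "C ^ DIM('a) + D"] by linarith
  qed (use C D in simp)
qed

lemma ex_open_grid_cell:
  fixes x :: "'a::euclidean_space"
  assumes x: "x \<in> unit_cube" and off: "\<And>b n. b \<in> Basis \<Longrightarrow> n \<le> R \<Longrightarrow> x \<bullet> b \<noteq> real n / real R" and R: "R > 0"
  obtains \<mu> where "\<mu> \<in> grid R" "\<And>b. b \<in> Basis \<Longrightarrow> real (\<mu> b) / real R < x \<bullet> b"
    "\<And>b. b \<in> Basis \<Longrightarrow> x \<bullet> b < real (Suc (\<mu> b)) / real R"
proof
  define \<mu> where "\<mu> = (\<lambda>b\<in>(Basis::'a set). nat \<lfloor>real R * (x \<bullet> b)\<rfloor>)"
  have *: "\<mu> b < R \<and> real (\<mu> b) / real R < x \<bullet> b \<and> x \<bullet> b < real (Suc (\<mu> b)) / real R"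
    if b: "b \<in> Basis" for b
  proof -
    have x01: "0 \<le> x \<bullet> b" "x \<bullet> b \<le> 1" using x b by (auto simp: mem_box)
    then have "x \<bullet> b < 1" using off[OF b, of R] R by simp
    then have lt: "real R * (x \<bullet> b) < real R" using R by simp
    have ge: "0 \<le> real R * (x \<bullet> b)" using x01 by simp
    have "real (\<mu> b) = of_int \<lfloor>real R * (x \<bullet> b)\<rfloor>" using ge b by (simp add: \<mu>_def)
    then have fl: "real (\<mu> b) \<le> real R * (x \<bullet> b)" "real R * (x \<bullet> b) < real (\<mu> b) + 1" by linarith+
    then have lt': "\<mu> b < R" using lt by linarith
    moreover have "x \<bullet> b \<noteq> real (\<mu> b) / real R" using off[OF b, of "\<mu> b"] lt' by simp
    moreover have "real (\<mu> b) / real R \<le> x \<bullet> b" using fl(1) R by (simp add: divide_le_eq mult.commute)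
    moreover have "x \<bullet> b < real (Suc (\<mu> b)) / real R" using fl(2) R by (simp add: less_divide_eq mult.commute)
    ultimately show ?thesis by linarith
  qed
  then show "\<mu> \<in> grid R" by (auto simp: \<mu>_def)
  show "real (\<mu> b) / real R < x \<bullet> b" "x \<bullet> b < real (Suc (\<mu> b)) / real R" if "b \<in> Basis" for b
    using *[OF that] by auto
qed

text \<open>The pointwise bound is squared and integrated box by box. Cauchy-Schwarz over the fixed
  number of subcells turns the sum of absolute values into a sum of squares, and the volume of a box
  reduces the squared normalisation \<open>R^(2 d)\<close> to \<open>R^d\<close>.\<close>

lemma holder_L2_reconstruction:
  fixes s :: real
  assumes s: "s > 0"
  obtains C :: real and r :: nat where "C > 0" "r > 0"
    "\<And>L f q R. \<lbrakk>L > 0; f \<in> holder_class s L; q \<in> holder_class s L; R > 0\<rbrakk> \<Longrightarrow>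
       (\<integral>x. indicator unit_cube x * (f x - q x)\<^sup>2 \<partial>lborel) \<le>
       C * (real R ^ DIM('a) * (\<Sum>\<kappa>\<in>grid (r * R). (\<integral>y. indicator (grid_cell (r * R) \<kappa>) (y::'a::euclidean_space) * (f y - q y) \<partial>lborel)\<^sup>2)
         + L\<^sup>2 * real R powr - (2 * s))"
proof -
  define r where "r = Suc (nat \<lfloor>s\<rfloor>)"
  have r: "r > 0" by (simp add: r_def)
  obtain C :: real where C: "C \<ge> 0" and box:
    "\<And>L f q R \<mu> (x::'a). \<lbrakk>L > 0; f \<in> holder_class s L; q \<in> holder_class s L;
       \<And>b. b \<in> Basis \<Longrightarrow> \<mu> b < R;
       \<And>b. b \<in> Basis \<Longrightarrow> real (\<mu> b) / real R < x \<bullet> b;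
       \<And>b. b \<in> Basis \<Longrightarrow> x \<bullet> b < real (Suc (\<mu> b)) / real R\<rbrakk> \<Longrightarrow>
       \<bar>f x - q x\<bar> \<le> C * (real R ^ DIM('a) * (\<Sum>i\<in>grid r.
         \<bar>\<integral>y. indicator (grid_cell (r * R) (\<lambda>b. r * \<mu> b + i b)) y * (f y - q y) \<partial>lborel\<bar>)
         + L * real R powr - s)"
    unfolding r_def by (rule holder_box_reconstruction[OF s, where 'a = 'a]) blast
  define A where "A = 2 * C\<^sup>2 * real (r ^ DIM('a))"
  have A: "A \<ge> 0" by (simp add: A_def)
  show ?thesis
  proof (rule that[of "A + 2 * C\<^sup>2 + 1" r])
    fix L :: real and f q :: "'a \<Rightarrow> real" and R :: nat
    assume L: "L > 0" and f: "f \<in> holder_class s L" and q: "q \<in> holder_class s L" and R: "R > 0"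
    let ?d = "DIM('a)"
    define \<theta> where "\<theta> \<kappa> = (\<integral>y. indicator (grid_cell (r * R) \<kappa>) y * (f y - q y) \<partial>lborel)" for \<kappa> :: "'a \<Rightarrow> nat"
    \<comment> \<open>The index, on the grid with \<open>r * R\<close> cells per axis, of subcell
      \<open>i\<close> of box \<open>\<mu>\<close>; restriction to \<open>Basis\<close> makes it a
      member of the extensional set \<open>grid (r * R)\<close>.\<close>
    define join where "join \<mu> i = (\<lambda>b\<in>(Basis::'a set). r * \<mu> b + i b :: nat)" for \<mu> i
    have \<theta>_join: "(\<integral>y. indicator (grid_cell (r * R) (\<lambda>b. r * \<mu> b + i b)) y * (f y - q y) \<partial>lborel) = \<theta> (join \<mu> i)" for \<mu> i
      unfolding \<theta>_def join_def by (subst grid_cell_cong[of _ "\<lambda>b\<in>Basis. r * \<mu> b + i b"]) auto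
    define E where "E \<mu> = A * real R ^ (2 * ?d) * (\<Sum>i\<in>grid r. (\<theta> (join \<mu> i))\<^sup>2)" for \<mu>
    define F where "F = 2 * C\<^sup>2 * (L\<^sup>2 * real R powr - (2 * s))"
    have pointwise: "(f x - q x)\<^sup>2 \<le> E \<mu> + F"
      if \<mu>: "\<And>b. b \<in> Basis \<Longrightarrow> \<mu> b < R" "\<And>b. b \<in> Basis \<Longrightarrow> real (\<mu> b) / real R < x \<bullet> b"
       "\<And>b. b \<in> Basis \<Longrightarrow> x \<bullet> b < real (Suc (\<mu> b)) / real R" for x \<mu>
    proof -
      let ?S = "real R ^ ?d * (\<Sum>i\<in>grid r. \<bar>\<theta> (join \<mu> i)\<bar>)" and ?T = "L * real R powr - s"
      have "\<bar>f x - q x\<bar> \<le> C * (?S + ?T)"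
        using box[OF L f q \<mu>] unfolding \<theta>_join .
      then have "(f x - q x)\<^sup>2 \<le> (C * (?S + ?T))\<^sup>2"
        by (metis abs_ge_zero power2_abs power_mono)
      also have "\<dots> = C\<^sup>2 * (?S + ?T)\<^sup>2" by (rule power_mult_distrib)
      also have "\<dots> \<le> C\<^sup>2 * (2 * ?S\<^sup>2 + 2 * ?T\<^sup>2)"
      proof (rule mult_left_mono)
        have "0 \<le> (?S - ?T)\<^sup>2" by simp
        then show "(?S + ?T)\<^sup>2 \<le> 2 * ?S\<^sup>2 + 2 * ?T\<^sup>2" by (simp only: power2_sum power2_diff)
      qed simp
      also have "\<dots> = 2 * C\<^sup>2 * ?S\<^sup>2 + F"
      proof -
        have "(real R powr - s)\<^sup>2 = real R powr - (2 * s)"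
          by (simp add: power2_eq_square powr_add[symmetric])
        then show ?thesis by (simp add: F_def power_mult_distrib algebra_simps)
      qed
      also have "2 * C\<^sup>2 * ?S\<^sup>2 \<le> E \<mu>"
      proof -
        have "(\<Sum>i\<in>grid r. \<bar>\<theta> (join \<mu> i)\<bar>)\<^sup>2 \<le> (\<Sum>i\<in>grid r. (\<bar>\<theta> (join \<mu> i)\<bar>)\<^sup>2) * real (card (grid r :: ('a \<Rightarrow> nat) set))"
          by (rule sum_squared_le_sum_of_squares)
        then have "2 * C\<^sup>2 * (real R ^ ?d)\<^sup>2 * (\<Sum>i\<in>grid r. \<bar>\<theta> (join \<mu> i)\<bar>)\<^sup>2 \<le>
            2 * C\<^sup>2 * (real R ^ ?d)\<^sup>2 * ((\<Sum>i\<in>grid r. (\<theta> (join \<mu> i))\<^sup>2) * real (r ^ ?d))"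
          by (intro mult_left_mono) (simp_all add: card_grid)
        then show ?thesis
          by (simp add: E_def A_def power_mult_distrib power_mult[symmetric] mult_ac)
      qed
      finally show ?thesis by simp
    qed
    have "(\<integral>x. indicator unit_cube x * (f x - q x)\<^sup>2 \<partial>lborel) \<le>
        (\<integral>x. (\<Sum>\<mu>\<in>grid R. indicator (grid_cell R \<mu>) x * E \<mu>) + indicator unit_cube x * F \<partial>lborel)"
    proof (rule integral_mono_AE)
      have c: "integrable lborel (\<lambda>x::'a. indicator unit_cube x * (G::real))" for G
        by (intro integrable_mult_left integrable_real_indicator) (simp_all add: emeasure_lborel_cbox_eq)
      obtain Mf Mq where Mf: "\<And>x. \<bar>indicator unit_cube x * f x\<bar> \<le> Mf"
        and Mq: "\<And>x. \<bar>indicator unit_cube x * q x\<bar> \<le> Mq"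
        using holder_class_indicator_bounded[OF s L f] holder_class_indicator_bounded[OF s L q] by metis
      have eq: "indicator unit_cube x * (f x - q x)\<^sup>2 = (indicator unit_cube x * f x - indicator unit_cube x * q x)\<^sup>2" for x
        by (simp add: indicator_def)
      show "integrable lborel (\<lambda>x. indicator unit_cube x * (f x - q x)\<^sup>2)"
      proof (rule Bochner_Integration.integrable_bound[OF c[of "(Mf + Mq)\<^sup>2"]])
        show "(\<lambda>x. indicator unit_cube x * (f x - q x)\<^sup>2) \<in> borel_measurable lborel"
          unfolding eq using holder_class_borel_measurable_indicator[OF s L f]
            holder_class_borel_measurable_indicator[OF s L q] by simp
        show "AE x in lborel. norm (indicator unit_cube x * (f x - q x)\<^sup>2) \<le> norm (indicator unit_cube x * (Mf + Mq)\<^sup>2)"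
        proof (rule AE_I2)
          fix x
          have "(f x - q x)\<^sup>2 \<le> (Mf + Mq)\<^sup>2" if "x \<in> unit_cube"
          proof -
            have "\<bar>f x - q x\<bar> \<le> Mf + Mq" using Mf[of x] Mq[of x] that by simp
            then show ?thesis by (metis abs_ge_zero power2_abs power_mono)
          qed
          then show "norm (indicator unit_cube x * (f x - q x)\<^sup>2) \<le> norm (indicator unit_cube x * (Mf + Mq)\<^sup>2)"
            by (simp add: indicator_def)
        qed
      qed
      show "integrable lborel (\<lambda>x. (\<Sum>\<mu>\<in>grid R. indicator (grid_cell R \<mu>) x * E \<mu>) + indicator unit_cube x * F)"
        using R by (intro Bochner_Integration.integrable_add Bochner_Integration.integrable_sum c
            integrable_mult_left integrable_real_indicator) (simp_all add: lborel_grid_cell)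
      \<comment> \<open>The point avoids finitely many grid hyperplanes, each of measure zero, and
        so lies strictly inside a box.\<close>
      have "AE x in lborel. \<forall>p\<in>(Basis::'a set) \<times> {..R}. x \<bullet> fst p \<noteq> real (snd p) / real R"
        by (rule AE_finite_allI) (auto intro: AE_inner_Basis_neq)
      then show "AE x in lborel. indicator unit_cube x * (f x - q x)\<^sup>2 \<le>
          (\<Sum>\<mu>\<in>grid R. indicator (grid_cell R \<mu>) x * E \<mu>) + indicator unit_cube x * F"
      proof eventually_elim
        case (elim x)
        have E: "E \<mu> \<ge> 0" for \<mu> unfolding E_def using A by (intro mult_nonneg_nonneg sum_nonneg) auto
        show ?case
        proof (cases "x \<in> unit_cube")
          case True
          have off: "x \<bullet> b \<noteq> real n / real R" if "b \<in> Basis" "n \<le> R" for b n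
            using bspec[OF elim, of "(b, n)"] that by simp
          obtain \<mu> where \<mu>: "\<mu> \<in> grid R" "\<And>b. b \<in> Basis \<Longrightarrow> real (\<mu> b) / real R < x \<bullet> b"
            "\<And>b. b \<in> Basis \<Longrightarrow> x \<bullet> b < real (Suc (\<mu> b)) / real R"
            by (rule ex_open_grid_cell[OF True off R], assumption, assumption) (rule that)
          then have "(f x - q x)\<^sup>2 \<le> E \<mu> + F" by (intro pointwise) auto
          also have "E \<mu> = indicator (grid_cell R \<mu>) x * E \<mu>"
            using \<mu> by (auto simp: grid_cell_def indicator_def less_imp_le)
          also have "\<dots> \<le> (\<Sum>\<mu>\<in>grid R. indicator (grid_cell R \<mu>) x * E \<mu>)"
            using \<mu>(1) E by (intro member_le_sum finite_grid) auto
          finally show ?thesis using True by simp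
        next
          case False
          then show ?thesis using E by (simp add: sum_nonneg)
        qed
      qed
    qed
    also have "\<dots> = (\<Sum>\<mu>\<in>grid R. E \<mu> / real R ^ ?d) + F"
    proof -
      have "integrable lborel (\<lambda>x::'a. indicator unit_cube x * F)"
        by (intro integrable_mult_left integrable_real_indicator) (simp_all add: emeasure_lborel_cbox_eq)
      moreover have g: "integrable lborel (\<lambda>x::'a. indicator (grid_cell R \<mu>) x * E \<mu>)" for \<mu>
        using R by (intro integrable_mult_left integrable_real_indicator) (simp_all add: lborel_grid_cell)
      ultimately show ?thesis
        using R by (simp add: lborel_grid_cell)
    qed
    also have "(\<Sum>\<mu>\<in>grid R. E \<mu> / real R ^ ?d) = A * real R ^ ?d * (\<Sum>\<mu>\<in>grid R. \<Sum>i\<in>grid r. (\<theta> (join \<mu> i))\<^sup>2)"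
    proof -
      have "E \<mu> / real R ^ ?d = A * real R ^ ?d * (\<Sum>i\<in>grid r. (\<theta> (join \<mu> i))\<^sup>2)" for \<mu>
        using R by (simp add: E_def mult_2 power_add)
      then show ?thesis by (simp only: sum_distrib_left)
    qed
    also have "(\<Sum>\<mu>\<in>grid R. \<Sum>i\<in>grid r. (\<theta> (join \<mu> i))\<^sup>2) \<le> (\<Sum>\<kappa>\<in>grid (r * R). (\<theta> \<kappa>)\<^sup>2)"
    proof -
      let ?G = "(grid R :: ('a \<Rightarrow> nat) set) \<times> (grid r :: ('a \<Rightarrow> nat) set)"
      \<comment> \<open>Division with remainder by \<open>r\<close> recovers box and subcell, so no
        square is counted twice on the fine grid.\<close>
      have inj: "inj_on (\<lambda>(\<mu>, i). join \<mu> i) ?G"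
      proof (intro inj_onI, clarify)
        fix \<mu> i \<mu>' i' assume g: "\<mu> \<in> grid R" "i \<in> grid r" "\<mu>' \<in> grid R" "i' \<in> grid r" and j: "join \<mu> i = join \<mu>' i'"
        have "\<mu> b = \<mu>' b \<and> i b = i' b" if b: "b \<in> Basis" for b
        proof -
          have "r * \<mu> b + i b = r * \<mu>' b + i' b" using fun_cong[OF j, of b] b by (simp add: join_def)
          moreover have "i b < r" "i' b < r" using g b by auto
          ultimately show ?thesis
            by (metis div_mult_self2 div_less mod_less mod_mult_self4 add.commute add.right_neutral add_0 gr_implies_not0 mult.commute)
        qed
        then show "\<mu> = \<mu>' \<and> i = i'"
          using PiE_ext[OF g(1,3)] PiE_ext[OF g(2,4)] by simp
      qed
      have "(\<Sum>\<mu>\<in>grid R. \<Sum>i\<in>grid r. (\<theta> (join \<mu> i))\<^sup>2) = (\<Sum>p\<in>?G. (\<theta> (case p of (\<mu>, i) \<Rightarrow> join \<mu> i))\<^sup>2)"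
        by (simp add: sum.cartesian_product split_beta)
      also have "\<dots> = (\<Sum>\<kappa>\<in>(\<lambda>(\<mu>, i). join \<mu> i) ` ?G. (\<theta> \<kappa>)\<^sup>2)"
        using sum.reindex[OF inj, of "\<lambda>\<kappa>. (\<theta> \<kappa>)\<^sup>2"] by (simp add: o_def)
      also have "\<dots> \<le> (\<Sum>\<kappa>\<in>grid (r * R). (\<theta> \<kappa>)\<^sup>2)"
      proof (rule sum_mono2[OF finite_grid])
        show "(\<lambda>(\<mu>, i). join \<mu> i) ` ?G \<subseteq> grid (r * R)"
        proof clarify
          fix \<mu> i :: "'a \<Rightarrow> nat" assume g: "\<mu> \<in> grid R" "i \<in> grid r"
          show "join \<mu> i \<in> grid (r * R)"
          proof (rule PiE_I)
            fix b :: 'a assume b: "b \<in> Basis"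
            then have "\<mu> b < R" "i b < r" using g by auto
            then show "join \<mu> i b \<in> {..<r * R}"
              using b mult_le_mono2[of "Suc (\<mu> b)" R r] by (simp add: join_def)
          qed (simp add: join_def)
        qed
      qed auto
      finally show ?thesis .
    qed
    finally have "(\<integral>x. indicator unit_cube x * (f x - q x)\<^sup>2 \<partial>lborel) \<le>
        A * real R ^ ?d * (\<Sum>\<kappa>\<in>grid (r * R). (\<theta> \<kappa>)\<^sup>2) + F"
      using A by (simp add: mult_left_mono)
    also have "\<dots> \<le> (A + 2 * C\<^sup>2 + 1) * (real R ^ ?d * (\<Sum>\<kappa>\<in>grid (r * R). (\<theta> \<kappa>)\<^sup>2) + L\<^sup>2 * real R powr - (2 * s))"
    proof -
      have "A * X + 2 * C\<^sup>2 * Y \<le> (A + 2 * C\<^sup>2 + 1) * (X + Y)" if "X \<ge> 0" "Y \<ge> 0" for X Y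
        using that A by (simp add: algebra_simps)
      from this[of "real R ^ ?d * (\<Sum>\<kappa>\<in>grid (r * R). (\<theta> \<kappa>)\<^sup>2)" "L\<^sup>2 * real R powr - (2 * s)"]
      show ?thesis by (simp add: F_def sum_nonneg mult.assoc)
    qed
    finally show "(\<integral>x. indicator unit_cube x * (f x - q x)\<^sup>2 \<partial>lborel) \<le> (A + 2 * C\<^sup>2 + 1) *
       (real R ^ ?d * (\<Sum>\<kappa>\<in>grid (r * R). (\<integral>y. indicator (grid_cell (r * R) \<kappa>) y * (f y - q y) \<partial>lborel)\<^sup>2)
         + L\<^sup>2 * real R powr - (2 * s))"
      unfolding \<theta>_def .
  qed (use A r in \<open>simp_all add: add_nonneg_pos\<close>)
qed


section \<open>Moments of the test statistic\<close>

text \<open>Independence of functions that read disjoint sets of coordinates: once the product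
  measure is split at \<open>A\<close>, the integrand separates and both integrals can be pulled
  apart.\<close>

lemma (in prob_space) integral_PiM_mult_disjoint:
  fixes f g :: "('i \<Rightarrow> 'a) \<Rightarrow> real"
  assumes I: "finite I" and A: "A \<subseteq> I"
    and [measurable]: "f \<in> borel_measurable (\<Pi>\<^sub>M i\<in>I. M)" "g \<in> borel_measurable (\<Pi>\<^sub>M i\<in>I. M)"
    and bd: "\<And>\<omega>. \<bar>f \<omega>\<bar> \<le> c" "\<And>\<omega>. \<bar>g \<omega>\<bar> \<le> c'"
    and f: "\<And>\<omega> \<omega>'. (\<And>i. i \<in> A \<Longrightarrow> \<omega> i = \<omega>' i) \<Longrightarrow> f \<omega> = f \<omega>'"
    and g: "\<And>\<omega> \<omega>'. (\<And>i. i \<in> I - A \<Longrightarrow> \<omega> i = \<omega>' i) \<Longrightarrow> g \<omega> = g \<omega>'"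
  shows "(\<integral>\<omega>. f \<omega> * g \<omega> \<partial>(\<Pi>\<^sub>M i\<in>I. M)) = (\<integral>\<omega>. f \<omega> \<partial>(\<Pi>\<^sub>M i\<in>I. M)) * (\<integral>\<omega>. g \<omega> \<partial>(\<Pi>\<^sub>M i\<in>I. M))"
proof -
  interpret P: product_prob_space "\<lambda>_::'i. M" by standard
  interpret PA: prob_space "\<Pi>\<^sub>M i\<in>A. M" by (rule prob_space_PiM) (rule prob_space_axioms)
  interpret PB: prob_space "\<Pi>\<^sub>M i\<in>I - A. M" by (rule prob_space_PiM) (rule prob_space_axioms)
  have un: "A \<union> (I - A) = I" using A by auto
  have fold: "(\<integral>\<omega>. h \<omega> \<partial>(\<Pi>\<^sub>M i\<in>I. M)) =
      (\<integral>x. (\<integral>y. h (merge A (I - A) (x, y)) \<partial>(\<Pi>\<^sub>M i\<in>I - A. M)) \<partial>(\<Pi>\<^sub>M i\<in>A. M))"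
    if "integrable (\<Pi>\<^sub>M i\<in>I. M) h" for h :: "('i \<Rightarrow> 'a) \<Rightarrow> real"
    using P.product_integral_fold[of A "I - A" h] I A that un by (simp add: finite_subset)
  have fm: "f (merge A (I - A) (x, y)) = f x" for x y by (rule f) (simp add: merge_def)
  have gm: "g (merge A (I - A) (x, y)) = g y" for x y by (rule g) (simp add: merge_def)
  have c: "c \<ge> 0" "c' \<ge> 0" using bd(1)[of undefined] bd(2)[of undefined] by linarith+
  have int_f: "integrable (\<Pi>\<^sub>M i\<in>I. M) f"
    by (rule finite_measure.integrable_const_bound[OF prob_space.finite_measure[OF prob_space_PiM[OF prob_space_axioms]], where B = c]) (use bd in auto)
  have int_g: "integrable (\<Pi>\<^sub>M i\<in>I. M) g"
    by (rule finite_measure.integrable_const_bound[OF prob_space.finite_measure[OF prob_space_PiM[OF prob_space_axioms]], where B = c']) (use bd in auto)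
  have int_fg: "integrable (\<Pi>\<^sub>M i\<in>I. M) (\<lambda>\<omega>. f \<omega> * g \<omega>)"
    by (rule finite_measure.integrable_const_bound[OF prob_space.finite_measure[OF prob_space_PiM[OF prob_space_axioms]], where B = "c * c'"]) (use bd c in \<open>auto simp: abs_mult intro!: mult_mono\<close>)
  show ?thesis
    unfolding fold[OF int_f] fold[OF int_g] fold[OF int_fg] fm gm
    by (simp add: PA.prob_space PB.prob_space)
qed

lemma integral_PiM_coordinate:
  fixes h :: "'a \<Rightarrow> real"
  assumes "prob_space M" "i \<in> I" "h \<in> borel_measurable M"
  shows "(\<integral>\<omega>. h (\<omega> i) \<partial>(\<Pi>\<^sub>M i\<in>I. M)) = (\<integral>x. h x \<partial>M)"
proof -
  have "(\<integral>x. h x \<partial>M) = (\<integral>x. h x \<partial>distr (\<Pi>\<^sub>M i\<in>I. M) M (\<lambda>\<omega>. \<omega> i))"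
    using distr_PiM_component[of I "\<lambda>_. M" i] assms by simp
  also have "\<dots> = (\<integral>\<omega>. h (\<omega> i) \<partial>(\<Pi>\<^sub>M i\<in>I. M))"
    by (rule integral_distr) (use assms in auto)
  finally show ?thesis ..
qed

text \<open>In the application \<open>a \<kappa>\<close> and \<open>b \<kappa>\<close> tell whether
  the first, respectively the second, component of an observation lies in the projection of cell
  \<open>\<kappa>\<close>. The moments depend only on the values \<open>0\<close> and
  \<open>1\<close> and on disjointness of the cells, the latter also for components of two different
  observations \<open>x\<close> and \<open>y\<close>. Each of the \<open>2 * m\<close> differences
  consumes three observations, hence \<open>6 * m\<close>.\<close>

locale cell_family = prob_space P for P :: "'x measure" +
  fixes G :: "'k set" and a b :: "'k \<Rightarrow> 'x \<Rightarrow> real" and m n :: nat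
  assumes finite_G: "finite G"
    and a01: "\<And>\<kappa> x. a \<kappa> x \<in> {0, 1}" and b01: "\<And>\<kappa> x. b \<kappa> x \<in> {0, 1}"
    and a_meas[measurable]: "\<And>\<kappa>. \<kappa> \<in> G \<Longrightarrow> a \<kappa> \<in> borel_measurable P"
    and b_meas[measurable]: "\<And>\<kappa>. \<kappa> \<in> G \<Longrightarrow> b \<kappa> \<in> borel_measurable P"
    and disjoint: "\<And>\<kappa> \<kappa>' x y. \<kappa> \<in> G \<Longrightarrow> \<kappa>' \<in> G \<Longrightarrow> \<kappa> \<noteq> \<kappa>' \<Longrightarrow> (a \<kappa> x * b \<kappa> y) * (a \<kappa>' x * b \<kappa>' y) = 0"
    and mn: "6 * m \<le> n"
begin

abbreviation "\<Omega> \<equiv> iid_sample n P"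

sublocale \<Omega>: prob_space \<Omega>
  unfolding iid_sample_def by (rule prob_space_PiM) (rule prob_space_axioms)

definition p where "p \<kappa> = (\<integral>x. a \<kappa> x * b \<kappa> x \<partial>P)"
definition q where "q \<kappa> = (\<integral>x. a \<kappa> x \<partial>P) * (\<integral>x. b \<kappa> x \<partial>P)"

text \<open>
  The observations \<open>3 j + 1\<close> and \<open>3 j + 2\<close> together provide one draw from the product of the
  marginals, independent of observation \<open>3 j\<close>.
\<close>

definition \<psi> where "\<psi> j \<kappa> \<omega> = a \<kappa> (\<omega> (3 * j)) * b \<kappa> (\<omega> (3 * j)) - a \<kappa> (\<omega> (3 * j + 1)) * b \<kappa> (\<omega> (3 * j + 2))"

definition S where "S J \<kappa> \<omega> = (\<Sum>j\<in>J. \<psi> j \<kappa> \<omega>)"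

definition T where "T \<omega> = (\<Sum>\<kappa>\<in>G. S {..<m} \<kappa> \<omega> * S {m..<2 * m} \<kappa> \<omega>)"

abbreviation "\<theta> \<kappa> \<equiv> p \<kappa> - q \<kappa>"
text \<open>The second moments of one difference \<open>\<psi> j\<close> over pairs of cells, see
  \<open>expectation_\<psi>\<psi>\<close>. The first part is diagonal because a draw lies in at most
  one cell; the other two are mixed products of the two independent draws.\<close>

definition \<Gamma> where "\<Gamma> \<kappa> \<kappa>' = (if \<kappa> = \<kappa>' then p \<kappa> + q \<kappa> else 0) - p \<kappa> * q \<kappa>' - q \<kappa> * p \<kappa>'"

lemma ab_bounds: "0 \<le> a \<kappa> x" "a \<kappa> x \<le> 1" "0 \<le> b \<kappa> x" "b \<kappa> x \<le> 1"
  using a01[of \<kappa> x] b01[of \<kappa> x] by auto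

lemma prod_bounds: "0 \<le> a \<kappa> x * b \<kappa> y" "a \<kappa> x * b \<kappa> y \<le> 1"
  using a01[of \<kappa> x] b01[of \<kappa> y] by auto

lemma \<psi>_bound: "\<bar>\<psi> j \<kappa> \<omega>\<bar> \<le> 1"
  using prod_bounds[of \<kappa> "\<omega> (3 * j)" "\<omega> (3 * j)"] prod_bounds[of \<kappa> "\<omega> (3 * j + 1)" "\<omega> (3 * j + 2)"]
  unfolding \<psi>_def by linarith

lemma coordinate_measurable[measurable]:
  "\<kappa> \<in> G \<Longrightarrow> i < n \<Longrightarrow> (\<lambda>\<omega>. a \<kappa> (\<omega> i)) \<in> borel_measurable \<Omega>"
  "\<kappa> \<in> G \<Longrightarrow> i < n \<Longrightarrow> (\<lambda>\<omega>. b \<kappa> (\<omega> i)) \<in> borel_measurable \<Omega>"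
  unfolding iid_sample_def
  by (rule measurable_compose[where f = "\<lambda>\<omega>. \<omega> i" and N = P], rule measurable_component_singleton, simp, rule a_meas b_meas, assumption)+

lemma \<psi>_measurable[measurable]: "\<kappa> \<in> G \<Longrightarrow> j < 2 * m \<Longrightarrow> \<psi> j \<kappa> \<in> borel_measurable \<Omega>"
  unfolding \<psi>_def using mn by (intro borel_measurable_diff borel_measurable_times coordinate_measurable) auto

lemma S_measurable[measurable]: "\<kappa> \<in> G \<Longrightarrow> J \<subseteq> {..<2 * m} \<Longrightarrow> S J \<kappa> \<in> borel_measurable \<Omega>"
  unfolding S_def by (intro borel_measurable_sum \<psi>_measurable) auto

lemma T_measurable[measurable]: "T \<in> borel_measurable \<Omega>"
  unfolding T_def by (intro borel_measurable_sum borel_measurable_times S_measurable) auto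

lemma expectation_mult_disjoint:
  fixes f g :: "(nat \<Rightarrow> 'x) \<Rightarrow> real"
  assumes "A \<subseteq> {..<n}" "f \<in> borel_measurable \<Omega>" "g \<in> borel_measurable \<Omega>"
    and "\<And>\<omega>. \<bar>f \<omega>\<bar> \<le> c" "\<And>\<omega>. \<bar>g \<omega>\<bar> \<le> c'"
    and "\<And>\<omega> \<omega>'. (\<And>i. i \<in> A \<Longrightarrow> \<omega> i = \<omega>' i) \<Longrightarrow> f \<omega> = f \<omega>'"
    and "\<And>\<omega> \<omega>'. (\<And>i. i < n \<Longrightarrow> i \<notin> A \<Longrightarrow> \<omega> i = \<omega>' i) \<Longrightarrow> g \<omega> = g \<omega>'"
  shows "\<Omega>.expectation (\<lambda>\<omega>. f \<omega> * g \<omega>) = \<Omega>.expectation f * \<Omega>.expectation g"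
  unfolding iid_sample_def
proof (rule integral_PiM_mult_disjoint[where A = A and c = c and c' = c'])
  fix \<omega> \<omega>' :: "nat \<Rightarrow> 'x"
  show "f \<omega> = f \<omega>'" if "\<And>i. i \<in> A \<Longrightarrow> \<omega> i = \<omega>' i" by (rule assms(6)) (rule that)
  show "g \<omega> = g \<omega>'" if "\<And>i. i \<in> {..<n} - A \<Longrightarrow> \<omega> i = \<omega>' i"
    by (rule assms(7)) (rule that, simp)
qed (use assms(1-5) in \<open>simp_all add: iid_sample_def\<close>)

lemma integrable_bounded:
  fixes f :: "(nat \<Rightarrow> 'x) \<Rightarrow> real"
  shows "f \<in> borel_measurable \<Omega> \<Longrightarrow> (\<And>\<omega>. \<bar>f \<omega>\<bar> \<le> c) \<Longrightarrow> integrable \<Omega> f"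
  by (rule \<Omega>.integrable_const_bound[where B = c]) auto

lemma expectation_a: "\<kappa> \<in> G \<Longrightarrow> i < n \<Longrightarrow> \<Omega>.expectation (\<lambda>\<omega>. a \<kappa> (\<omega> i)) = (\<integral>x. a \<kappa> x \<partial>P)"
  unfolding iid_sample_def by (rule integral_PiM_coordinate) (auto intro: prob_space_axioms)

lemma expectation_b: "\<kappa> \<in> G \<Longrightarrow> i < n \<Longrightarrow> \<Omega>.expectation (\<lambda>\<omega>. b \<kappa> (\<omega> i)) = (\<integral>x. b \<kappa> x \<partial>P)"
  unfolding iid_sample_def by (rule integral_PiM_coordinate) (auto intro: prob_space_axioms)

lemma expectation_joint:
  "\<kappa> \<in> G \<Longrightarrow> i < n \<Longrightarrow> \<Omega>.expectation (\<lambda>\<omega>. a \<kappa> (\<omega> i) * b \<kappa> (\<omega> i)) = p \<kappa>"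
  unfolding iid_sample_def p_def
  by (rule integral_PiM_coordinate[where h = "\<lambda>x. a \<kappa> x * b \<kappa> x"]) (auto intro: prob_space_axioms)

lemma expectation_paired:
  assumes "\<kappa> \<in> G" "i < n" "i' < n" "i \<noteq> i'"
  shows "\<Omega>.expectation (\<lambda>\<omega>. a \<kappa> (\<omega> i) * b \<kappa> (\<omega> i')) = q \<kappa>"
proof -
  have "\<Omega>.expectation (\<lambda>\<omega>. a \<kappa> (\<omega> i) * b \<kappa> (\<omega> i')) =
      \<Omega>.expectation (\<lambda>\<omega>. a \<kappa> (\<omega> i)) * \<Omega>.expectation (\<lambda>\<omega>. b \<kappa> (\<omega> i'))"
    by (rule expectation_mult_disjoint[where A = "{i}" and c = 1 and c' = 1])
       (use assms ab_bounds in \<open>auto simp: abs_le_iff intro: order_trans[of _ 0]\<close>)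
  then show ?thesis using assms by (simp add: expectation_a expectation_b q_def)
qed

lemma \<psi>_cong: "(\<And>i. i \<in> {3 * j, 3 * j + 1, 3 * j + 2} \<Longrightarrow> \<omega> i = \<omega>' i) \<Longrightarrow> \<psi> j \<kappa> \<omega> = \<psi> j \<kappa> \<omega>'"
  by (simp add: \<psi>_def)

lemma prod_measurable:
  "\<kappa> \<in> G \<Longrightarrow> i < n \<Longrightarrow> i' < n \<Longrightarrow> (\<lambda>\<omega>. a \<kappa> (\<omega> i) * b \<kappa> (\<omega> i')) \<in> borel_measurable \<Omega>"
  by measurable

lemma prod_integrable:
  "\<kappa> \<in> G \<Longrightarrow> i < n \<Longrightarrow> i' < n \<Longrightarrow> integrable \<Omega> (\<lambda>\<omega>. a \<kappa> (\<omega> i) * b \<kappa> (\<omega> i'))"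
  by (rule integrable_bounded[where c = 1]) (use prod_bounds in \<open>auto simp: prod_measurable abs_of_nonneg\<close>)

lemma expectation_\<psi>:
  assumes "\<kappa> \<in> G" "j < 2 * m"
  shows "\<Omega>.expectation (\<psi> j \<kappa>) = \<theta> \<kappa>"
proof -
  have j: "3 * j + 2 < n" using assms mn by linarith
  have "\<Omega>.expectation (\<psi> j \<kappa>) = \<Omega>.expectation (\<lambda>\<omega>. a \<kappa> (\<omega> (3 * j)) * b \<kappa> (\<omega> (3 * j)))
      - \<Omega>.expectation (\<lambda>\<omega>. a \<kappa> (\<omega> (3 * j + 1)) * b \<kappa> (\<omega> (3 * j + 2)))"
    unfolding \<psi>_def using assms j by (intro Bochner_Integration.integral_diff prod_integrable) auto
  also have "\<dots> = \<theta> \<kappa>"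
    using expectation_joint[OF assms(1), of "3 * j"] expectation_paired[OF assms(1), of "3 * j + 1" "3 * j + 2"] j
    by simp
  finally show ?thesis .
qed

lemma expectation_\<psi>\<psi>:
  assumes k: "\<kappa> \<in> G" "\<kappa>' \<in> G" and jm: "j < 2 * m"
  shows "\<Omega>.expectation (\<lambda>\<omega>. \<psi> j \<kappa> \<omega> * \<psi> j \<kappa>' \<omega>) = \<Gamma> \<kappa> \<kappa>'"
proof -
  have j: "3 * j + 2 < n" using jm mn by linarith
  let ?X = "\<lambda>\<kappa> \<omega>. a \<kappa> (\<omega> (3 * j)) * b \<kappa> (\<omega> (3 * j))"
  let ?Y = "\<lambda>\<kappa> \<omega>. a \<kappa> (\<omega> (3 * j + 1)) * b \<kappa> (\<omega> (3 * j + 2))"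
  have meas: "?X \<kappa> \<in> borel_measurable \<Omega>" "?Y \<kappa> \<in> borel_measurable \<Omega>" if "\<kappa> \<in> G" for \<kappa>
    using that j by (auto intro!: prod_measurable)
  have bd: "\<bar>a \<kappa> x * b \<kappa> y\<bar> \<le> 1" for \<kappa> x y using prod_bounds[of \<kappa> x y] by simp
  have bd2: "\<bar>(a \<kappa> x * b \<kappa> y) * (a \<kappa>' x' * b \<kappa>' y')\<bar> \<le> 1" for \<kappa> \<kappa>' x y x' y'
    using mult_mono[OF bd[of \<kappa> x y] bd[of \<kappa>' x' y']] by (simp add: abs_mult)
  have int: "integrable \<Omega> (\<lambda>\<omega>. ?X \<kappa> \<omega> * ?X \<kappa>' \<omega>)" "integrable \<Omega> (\<lambda>\<omega>. ?X \<kappa> \<omega> * ?Y \<kappa>' \<omega>)"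
    "integrable \<Omega> (\<lambda>\<omega>. ?Y \<kappa> \<omega> * ?X \<kappa>' \<omega>)" "integrable \<Omega> (\<lambda>\<omega>. ?Y \<kappa> \<omega> * ?Y \<kappa>' \<omega>)"
    using meas[OF k(1)] meas[OF k(2)] by (auto intro!: integrable_bounded[where c = 1] bd2)
  have diag: "(a \<kappa> x * b \<kappa> y) * (a \<kappa>' x * b \<kappa>' y) = (if \<kappa> = \<kappa>' then a \<kappa> x * b \<kappa> y else 0)" for x y
    using disjoint[OF k, of x y] a01[of \<kappa> x] b01[of \<kappa> y] by auto
  have XX: "\<Omega>.expectation (\<lambda>\<omega>. ?X \<kappa> \<omega> * ?X \<kappa>' \<omega>) = (if \<kappa> = \<kappa>' then p \<kappa> else 0)"
    unfolding diag using expectation_joint[OF k(1), of "3 * j"] j by (cases "\<kappa> = \<kappa>'") simp_all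
  have YY: "\<Omega>.expectation (\<lambda>\<omega>. ?Y \<kappa> \<omega> * ?Y \<kappa>' \<omega>) = (if \<kappa> = \<kappa>' then q \<kappa> else 0)"
    unfolding diag using expectation_paired[OF k(1), of "3 * j + 1" "3 * j + 2"] j
    by (cases "\<kappa> = \<kappa>'") simp_all
  have cross: "\<Omega>.expectation (\<lambda>\<omega>. ?X \<kappa> \<omega> * ?Y \<kappa>' \<omega>) = p \<kappa> * q \<kappa>'" if "\<kappa> \<in> G" "\<kappa>' \<in> G" for \<kappa> \<kappa>'
  proof -
    have "\<Omega>.expectation (\<lambda>\<omega>. ?X \<kappa> \<omega> * ?Y \<kappa>' \<omega>) = \<Omega>.expectation (?X \<kappa>) * \<Omega>.expectation (?Y \<kappa>')"
      by (rule expectation_mult_disjoint[where A = "{3 * j}" and c = 1 and c' = 1])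
         (use that j bd meas in auto)
    then show ?thesis
      using expectation_joint[OF that(1), of "3 * j"] expectation_paired[OF that(2), of "3 * j + 1" "3 * j + 2"] j
      by simp
  qed
  have YX: "\<Omega>.expectation (\<lambda>\<omega>. ?Y \<kappa> \<omega> * ?X \<kappa>' \<omega>) = q \<kappa> * p \<kappa>'"
    using cross[OF k(2,1)] by (simp only: mult.commute)
  have "\<Omega>.expectation (\<lambda>\<omega>. \<psi> j \<kappa> \<omega> * \<psi> j \<kappa>' \<omega>) = \<Omega>.expectation (\<lambda>\<omega>.
      ((?X \<kappa> \<omega> * ?X \<kappa>' \<omega> - ?X \<kappa> \<omega> * ?Y \<kappa>' \<omega>) - ?Y \<kappa> \<omega> * ?X \<kappa>' \<omega>) + ?Y \<kappa> \<omega> * ?Y \<kappa>' \<omega>)"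
    unfolding \<psi>_def by (simp only: left_diff_distrib right_diff_distrib) (simp add: algebra_simps)
  also have "\<dots> = (if \<kappa> = \<kappa>' then p \<kappa> else 0) - p \<kappa> * q \<kappa>' - q \<kappa> * p \<kappa>' + (if \<kappa> = \<kappa>' then q \<kappa> else 0)"
    using int unfolding XX[symmetric] YY[symmetric] YX[symmetric] cross[OF k, symmetric]
    by (simp only: Bochner_Integration.integral_add Bochner_Integration.integral_diff
        Bochner_Integration.integrable_add Bochner_Integration.integrable_diff)
  also have "\<dots> = \<Gamma> \<kappa> \<kappa>'" by (simp add: \<Gamma>_def)
  finally show ?thesis .
qed

lemma expectation_\<psi>\<psi>_neq:
  assumes k: "\<kappa> \<in> G" "\<kappa>' \<in> G" and i: "i < 2 * m" and j: "j < 2 * m" and ij: "i \<noteq> j"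
  shows "\<Omega>.expectation (\<lambda>\<omega>. \<psi> i \<kappa> \<omega> * \<psi> j \<kappa>' \<omega>) = \<theta> \<kappa> * \<theta> \<kappa>'"
proof -
  have "\<Omega>.expectation (\<lambda>\<omega>. \<psi> i \<kappa> \<omega> * \<psi> j \<kappa>' \<omega>) = \<Omega>.expectation (\<psi> i \<kappa>) * \<Omega>.expectation (\<psi> j \<kappa>')"
  proof (rule expectation_mult_disjoint[where A = "{3 * i, 3 * i + 1, 3 * i + 2}" and c = 1 and c' = 1])
    show "{3 * i, 3 * i + 1, 3 * i + 2} \<subseteq> {..<n}" using i mn by auto
    fix \<omega> \<omega>' :: "nat \<Rightarrow> 'x"
    assume *: "\<And>l. l < n \<Longrightarrow> l \<notin> {3 * i, 3 * i + 1, 3 * i + 2} \<Longrightarrow> \<omega> l = \<omega>' l"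
    show "\<psi> j \<kappa>' \<omega> = \<psi> j \<kappa>' \<omega>'"
    proof (rule \<psi>_cong, rule *)
      fix l assume l: "l \<in> {3 * j, 3 * j + 1, 3 * j + 2}"
      show "l < n" using l j mn by auto
      show "l \<notin> {3 * i, 3 * i + 1, 3 * i + 2}" using l ij by auto
    qed
  qed (use k i j in \<open>auto intro: \<psi>_bound intro!: \<psi>_cong\<close>)
  then show ?thesis using k i j by (simp add: expectation_\<psi>)
qed

lemma S_bound: "\<bar>S J \<kappa> \<omega>\<bar> \<le> real (card J)"
proof -
  have "\<bar>S J \<kappa> \<omega>\<bar> \<le> (\<Sum>j\<in>J. 1)"
    unfolding S_def by (intro order_trans[OF sum_abs] sum_mono \<psi>_bound)
  then show ?thesis by simp
qed

lemma expectation_S: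
  assumes "\<kappa> \<in> G" "J \<subseteq> {..<2 * m}"
  shows "\<Omega>.expectation (S J \<kappa>) = real (card J) * \<theta> \<kappa>"
proof -
  have "\<Omega>.expectation (S J \<kappa>) = (\<Sum>j\<in>J. \<Omega>.expectation (\<psi> j \<kappa>))"
    unfolding S_def using assms
    by (intro Bochner_Integration.integral_sum integrable_bounded[where c = 1] \<psi>_bound \<psi>_measurable) auto
  also have "\<dots> = (\<Sum>j\<in>J. \<theta> \<kappa>)" using assms by (intro sum.cong expectation_\<psi>) auto
  finally show ?thesis by simp
qed

text \<open>Equal indices contribute \<open>\<Gamma> \<kappa> \<kappa>'\<close>; distinct ones read
  disjoint observations and contribute the product of their means.\<close>

lemma expectation_SS:
  assumes k: "\<kappa> \<in> G" "\<kappa>' \<in> G" and J: "J \<subseteq> {..<2 * m}"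
  shows "\<Omega>.expectation (\<lambda>\<omega>. S J \<kappa> \<omega> * S J \<kappa>' \<omega>) =
    real (card J) * \<Gamma> \<kappa> \<kappa>' + real (card J) * (real (card J) - 1) * (\<theta> \<kappa> * \<theta> \<kappa>')"
proof -
  have fJ: "finite J" using J finite_subset by blast
  have "\<bar>\<psi> i \<kappa> \<omega> * \<psi> j \<kappa>' \<omega>\<bar> \<le> 1" for i j \<omega>
    using mult_mono[OF \<psi>_bound[of i \<kappa> \<omega>] \<psi>_bound[of j \<kappa>' \<omega>]] by (simp add: abs_mult)
  then have int: "integrable \<Omega> (\<lambda>\<omega>. \<psi> i \<kappa> \<omega> * \<psi> j \<kappa>' \<omega>)" if "i \<in> J" "j \<in> J" for i j
    using that J k by (intro integrable_bounded[where c = 1] borel_measurable_times \<psi>_measurable) auto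
  have "\<Omega>.expectation (\<lambda>\<omega>. S J \<kappa> \<omega> * S J \<kappa>' \<omega>) = (\<Sum>i\<in>J. \<Sum>j\<in>J. \<Omega>.expectation (\<lambda>\<omega>. \<psi> i \<kappa> \<omega> * \<psi> j \<kappa>' \<omega>))"
    unfolding S_def sum_product using int
    by (subst Bochner_Integration.integral_sum; (intro Bochner_Integration.integrable_sum)?; simp)
  also have "\<dots> = (\<Sum>i\<in>J. \<Sum>j\<in>J. if i = j then \<Gamma> \<kappa> \<kappa>' else \<theta> \<kappa> * \<theta> \<kappa>')"
    using J by (intro sum.cong refl) (auto simp: expectation_\<psi>\<psi>[OF k] expectation_\<psi>\<psi>_neq[OF k] subset_iff)
  also have "\<dots> = (\<Sum>i\<in>J. \<Gamma> \<kappa> \<kappa>' + (real (card J) - 1) * (\<theta> \<kappa> * \<theta> \<kappa>'))"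
  proof (rule sum.cong[OF refl])
    fix i assume i: "i \<in> J"
    have "(\<Sum>j\<in>J. if i = j then \<Gamma> \<kappa> \<kappa>' else \<theta> \<kappa> * \<theta> \<kappa>') = \<Gamma> \<kappa> \<kappa>' + (\<Sum>j\<in>J - {i}. \<theta> \<kappa> * \<theta> \<kappa>')"
      using i fJ by (subst sum.remove[of _ i]) (auto intro!: sum.cong)
    moreover have "real (card (J - {i})) = real (card J) - 1"
      using i fJ by (simp add: of_nat_diff Suc_le_eq card_gt_0_iff) (metis Suc_le_eq card_gt_0_iff empty_iff of_nat_1 of_nat_diff One_nat_def)
    ultimately show "(\<Sum>j\<in>J. if i = j then \<Gamma> \<kappa> \<kappa>' else \<theta> \<kappa> * \<theta> \<kappa>') = \<Gamma> \<kappa> \<kappa>' + (real (card J) - 1) * (\<theta> \<kappa> * \<theta> \<kappa>')"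
      by simp
  qed
  also have "\<dots> = real (card J) * \<Gamma> \<kappa> \<kappa>' + real (card J) * (real (card J) - 1) * (\<theta> \<kappa> * \<theta> \<kappa>')"
    by (simp add: algebra_simps)
  finally show ?thesis .
qed

lemma S_cong: "(\<And>i j. j \<in> J \<Longrightarrow> i \<in> {3 * j, 3 * j + 1, 3 * j + 2} \<Longrightarrow> \<omega> i = \<omega>' i) \<Longrightarrow> S J \<kappa> \<omega> = S J \<kappa> \<omega>'"
  unfolding S_def by (intro sum.cong refl \<psi>_cong) blast

definition \<Theta> where "\<Theta> = (\<Sum>\<kappa>\<in>G. (\<theta> \<kappa>)\<^sup>2)"

lemma halves: "{..<m} \<subseteq> {..<2 * m}" "{m..<2 * m} \<subseteq> {..<2 * m}" "card {..<m} = m" "card {m..<2 * m} = m"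
  by auto

lemma S_first_cong: "(\<And>i. i \<in> {..<3 * m} \<Longrightarrow> \<omega> i = \<omega>' i) \<Longrightarrow> S {..<m} \<kappa> \<omega> = S {..<m} \<kappa> \<omega>'"
  by (rule S_cong) auto

lemma S_second_cong: "(\<And>i. i < n \<Longrightarrow> i \<notin> {..<3 * m} \<Longrightarrow> \<omega> i = \<omega>' i) \<Longrightarrow> S {m..<2 * m} \<kappa> \<omega> = S {m..<2 * m} \<kappa> \<omega>'"
  using mn by (intro S_cong) auto

text \<open>The halves read observations below and from \<open>3 * m\<close> on, so each summand of
  the mean is a product of two means and contains no variance of the counts.\<close>

lemma expectation_T: "\<Omega>.expectation T = (real m)\<^sup>2 * \<Theta>"
proof -
  have "\<bar>S {..<m} \<kappa> \<omega> * S {m..<2 * m} \<kappa> \<omega>\<bar> \<le> real m * real m" for \<kappa> \<omega>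
    using mult_mono[OF S_bound[of "{..<m}" \<kappa> \<omega>] S_bound[of "{m..<2 * m}" \<kappa> \<omega>]] by (simp add: abs_mult)
  then have int: "integrable \<Omega> (\<lambda>\<omega>. S {..<m} \<kappa> \<omega> * S {m..<2 * m} \<kappa> \<omega>)" if "\<kappa> \<in> G" for \<kappa>
    using that halves by (intro integrable_bounded[where c = "real m * real m"] borel_measurable_times S_measurable) auto
  have "\<Omega>.expectation T = (\<Sum>\<kappa>\<in>G. \<Omega>.expectation (\<lambda>\<omega>. S {..<m} \<kappa> \<omega> * S {m..<2 * m} \<kappa> \<omega>))"
    unfolding T_def using int by (intro Bochner_Integration.integral_sum) auto
  also have "\<dots> = (\<Sum>\<kappa>\<in>G. \<Omega>.expectation (S {..<m} \<kappa>) * \<Omega>.expectation (S {m..<2 * m} \<kappa>))"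
    using halves mn
    by (intro sum.cong refl expectation_mult_disjoint[where A = "{..<3 * m}" and c = "real m" and c' = "real m"])
       (auto intro!: S_measurable S_first_cong S_second_cong intro: order_trans[OF S_bound])
  also have "\<dots> = (\<Sum>\<kappa>\<in>G. (real m)\<^sup>2 * (\<theta> \<kappa>)\<^sup>2)"
    using halves by (intro sum.cong refl) (simp add: expectation_S power2_eq_square)
  finally show ?thesis by (simp add: \<Theta>_def sum_distrib_left)
qed

lemma T_bound: "\<bar>T \<omega>\<bar> \<le> real (card G) * (real m * real m)"
proof -
  have "\<bar>S {..<m} \<kappa> \<omega> * S {m..<2 * m} \<kappa> \<omega>\<bar> \<le> real m * real m" for \<kappa>
    using mult_mono[OF S_bound[of "{..<m}" \<kappa> \<omega>] S_bound[of "{m..<2 * m}" \<kappa> \<omega>]] by (simp add: abs_mult)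
  then have "\<bar>T \<omega>\<bar> \<le> (\<Sum>\<kappa>\<in>G. real m * real m)"
    unfolding T_def by (intro order_trans[OF sum_abs] sum_mono)
  then show ?thesis by simp
qed

text \<open>When the square is expanded and its factors are regrouped by halves, the expectation
  factorises. Both halves have the same second moments, hence the square in each summand.\<close>

lemma expectation_T_square:
  "\<Omega>.expectation (\<lambda>\<omega>. (T \<omega>)\<^sup>2) = (\<Sum>\<kappa>\<in>G. \<Sum>\<kappa>'\<in>G. (real m * \<Gamma> \<kappa> \<kappa>' + real m * (real m - 1) * (\<theta> \<kappa> * \<theta> \<kappa>'))\<^sup>2)"
proof -
  let ?A = "\<lambda>\<kappa> \<kappa>' \<omega>. S {..<m} \<kappa> \<omega> * S {..<m} \<kappa>' \<omega>"
  let ?B = "\<lambda>\<kappa> \<kappa>' \<omega>. S {m..<2 * m} \<kappa> \<omega> * S {m..<2 * m} \<kappa>' \<omega>"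
  have A_bd: "\<bar>?A \<kappa> \<kappa>' \<omega>\<bar> \<le> real m * real m" for \<kappa> \<kappa>' \<omega>
    using mult_mono[OF S_bound[of "{..<m}" \<kappa> \<omega>] S_bound[of "{..<m}" \<kappa>' \<omega>]] by (simp add: abs_mult)
  have B_bd: "\<bar>?B \<kappa> \<kappa>' \<omega>\<bar> \<le> real m * real m" for \<kappa> \<kappa>' \<omega>
    using mult_mono[OF S_bound[of "{m..<2 * m}" \<kappa> \<omega>] S_bound[of "{m..<2 * m}" \<kappa>' \<omega>]] by (simp add: abs_mult)
  have meas: "?A \<kappa> \<kappa>' \<in> borel_measurable \<Omega>" "?B \<kappa> \<kappa>' \<in> borel_measurable \<Omega>" if "\<kappa> \<in> G" "\<kappa>' \<in> G" for \<kappa> \<kappa>'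
    using that halves by (auto intro!: borel_measurable_times S_measurable)
  have "\<bar>?A \<kappa> \<kappa>' \<omega> * ?B \<kappa> \<kappa>' \<omega>\<bar> \<le> (real m * real m) * (real m * real m)" for \<kappa> \<kappa>' \<omega>
    unfolding abs_mult[of "?A \<kappa> \<kappa>' \<omega>"] by (intro mult_mono A_bd B_bd) auto
  then have int: "integrable \<Omega> (\<lambda>\<omega>. ?A \<kappa> \<kappa>' \<omega> * ?B \<kappa> \<kappa>' \<omega>)" if "\<kappa> \<in> G" "\<kappa>' \<in> G" for \<kappa> \<kappa>'
    by (intro integrable_bounded[where c = "(real m * real m) * (real m * real m)"]
        borel_measurable_times[OF meas(1)[OF that] meas(2)[OF that]])
  have "(T \<omega>)\<^sup>2 = (\<Sum>\<kappa>\<in>G. \<Sum>\<kappa>'\<in>G. ?A \<kappa> \<kappa>' \<omega> * ?B \<kappa> \<kappa>' \<omega>)" for \<omega>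
    unfolding T_def power2_eq_square sum_product by (intro sum.cong refl) (simp add: mult_ac)
  then have "\<Omega>.expectation (\<lambda>\<omega>. (T \<omega>)\<^sup>2) = (\<Sum>\<kappa>\<in>G. \<Sum>\<kappa>'\<in>G. \<Omega>.expectation (\<lambda>\<omega>. ?A \<kappa> \<kappa>' \<omega> * ?B \<kappa> \<kappa>' \<omega>))"
    using int by (simp add: Bochner_Integration.integral_sum Bochner_Integration.integrable_sum)
  also have "\<dots> = (\<Sum>\<kappa>\<in>G. \<Sum>\<kappa>'\<in>G. \<Omega>.expectation (?A \<kappa> \<kappa>') * \<Omega>.expectation (?B \<kappa> \<kappa>'))"
  proof (intro sum.cong refl)
    fix \<kappa> \<kappa>' assume k: "\<kappa> \<in> G" "\<kappa>' \<in> G"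
    show "\<Omega>.expectation (\<lambda>\<omega>. ?A \<kappa> \<kappa>' \<omega> * ?B \<kappa> \<kappa>' \<omega>) = \<Omega>.expectation (?A \<kappa> \<kappa>') * \<Omega>.expectation (?B \<kappa> \<kappa>')"
    proof (rule expectation_mult_disjoint[where A = "{..<3 * m}" and c = "real m * real m" and c' = "real m * real m"])
      show "{..<3 * m} \<subseteq> {..<n}" using mn by auto
      fix \<omega> \<omega>' :: "nat \<Rightarrow> 'x"
      show "?A \<kappa> \<kappa>' \<omega> = ?A \<kappa> \<kappa>' \<omega>'" if "\<And>i. i \<in> {..<3 * m} \<Longrightarrow> \<omega> i = \<omega>' i"
        using S_first_cong[of \<omega> \<omega>', OF that] by simp
      show "?B \<kappa> \<kappa>' \<omega> = ?B \<kappa> \<kappa>' \<omega>'" if "\<And>i. i < n \<Longrightarrow> i \<notin> {..<3 * m} \<Longrightarrow> \<omega> i = \<omega>' i"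
        using S_second_cong[of \<omega> \<omega>', OF that] by simp
    qed (use meas[OF k] A_bd B_bd in auto)
  qed
  also have "\<dots> = (\<Sum>\<kappa>\<in>G. \<Sum>\<kappa>'\<in>G. (real m * \<Gamma> \<kappa> \<kappa>' + real m * (real m - 1) * (\<theta> \<kappa> * \<theta> \<kappa>'))\<^sup>2)"
    using halves by (intro sum.cong refl) (simp add: expectation_SS power2_eq_square)
  finally show ?thesis .
qed

end

section \<open>Variance of the statistic and error probabilities\<close>

context cell_family
begin

text \<open>Disjointness makes the sum equal to its own square, so it is \<open>0\<close> or
  \<open>1\<close>.\<close>

lemma sum_cells_le_1: "(\<Sum>\<kappa>\<in>G. a \<kappa> x * b \<kappa> y) \<le> 1"
proof -
  let ?s = "\<Sum>\<kappa>\<in>G. a \<kappa> x * b \<kappa> y"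
  have "?s * ?s = (\<Sum>\<kappa>\<in>G. \<Sum>\<kappa>'\<in>G. (a \<kappa> x * b \<kappa> y) * (a \<kappa>' x * b \<kappa>' y))" by (rule sum_product)
  also have "\<dots> = (\<Sum>\<kappa>\<in>G. \<Sum>\<kappa>'\<in>G. if \<kappa>' = \<kappa> then a \<kappa> x * b \<kappa> y else 0)"
  proof (intro sum.cong refl)
    fix \<kappa> \<kappa>' assume "\<kappa> \<in> G" "\<kappa>' \<in> G"
    then show "(a \<kappa> x * b \<kappa> y) * (a \<kappa>' x * b \<kappa>' y) = (if \<kappa>' = \<kappa> then a \<kappa> x * b \<kappa> y else 0)"
      using disjoint[of \<kappa> \<kappa>' x y] a01[of \<kappa> x] b01[of \<kappa> y] by auto
  qed
  also have "\<dots> = ?s" using finite_G by simp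
  finally have "?s * (?s - 1) = 0" by (simp add: algebra_simps)
  then show ?thesis by auto
qed

lemma p_nonneg: "0 \<le> p \<kappa>" and q_nonneg: "0 \<le> q \<kappa>"
  unfolding p_def q_def by (auto intro!: Bochner_Integration.integral_nonneg mult_nonneg_nonneg ab_bounds)

lemma sum_p_le_1: "(\<Sum>\<kappa>\<in>G. p \<kappa>) \<le> 1"
proof -
  have int: "integrable P (\<lambda>x. a \<kappa> x * b \<kappa> x)" if "\<kappa> \<in> G" for \<kappa>
    by (rule integrable_const_bound[where B = 1]) (use that prod_bounds in \<open>auto simp: abs_of_nonneg\<close>)
  have "(\<Sum>\<kappa>\<in>G. p \<kappa>) = (\<integral>x. (\<Sum>\<kappa>\<in>G. a \<kappa> x * b \<kappa> x) \<partial>P)"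
    unfolding p_def using int by (subst Bochner_Integration.integral_sum) auto
  also have "\<dots> \<le> (\<integral>x. 1 \<partial>P)"
    by (rule integral_mono) (auto intro!: int sum_cells_le_1)
  finally show ?thesis by (simp add: prob_space)
qed

text \<open>In use \<open>u\<close> is of order \<open>N^-d\<close>. Probabilities that are at most
  \<open>u\<close> and have total at most \<open>1\<close> have a sum of squares of at most
  \<open>u\<close>; the variance estimates rest on this.\<close>

context
  fixes u :: real
  assumes m: "m > 0" and p_le: "\<And>\<kappa>. \<kappa> \<in> G \<Longrightarrow> p \<kappa> \<le> u" and q_le: "\<And>\<kappa>. \<kappa> \<in> G \<Longrightarrow> q \<kappa> \<le> u" and u: "u \<ge> 0"
begin

text \<open>\<open>q \<kappa>\<close> is an expectation over components of two different
  observations, so the pointwise bound on the cells can be integrated.\<close>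

lemma sum_q_le_1: "(\<Sum>\<kappa>\<in>G. q \<kappa>) \<le> 1"
proof -
  have n: "0 < n" "1 < n" using m mn by auto
  have "(\<Sum>\<kappa>\<in>G. q \<kappa>) = (\<Sum>\<kappa>\<in>G. \<Omega>.expectation (\<lambda>\<omega>. a \<kappa> (\<omega> 0) * b \<kappa> (\<omega> 1)))"
    using n by (intro sum.cong refl expectation_paired[symmetric]) auto
  also have "\<dots> = \<Omega>.expectation (\<lambda>\<omega>. \<Sum>\<kappa>\<in>G. a \<kappa> (\<omega> 0) * b \<kappa> (\<omega> 1))"
    using n by (subst Bochner_Integration.integral_sum) (auto intro: prod_integrable)
  also have "\<dots> \<le> \<Omega>.expectation (\<lambda>\<omega>. 1)"
    using n by (intro integral_mono) (auto intro!: prod_integrable sum_cells_le_1)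
  finally show ?thesis by (simp add: \<Omega>.prob_space)
qed

lemma sum_p_square_le: "(\<Sum>\<kappa>\<in>G. (p \<kappa>)\<^sup>2) \<le> u"
proof -
  have "(\<Sum>\<kappa>\<in>G. (p \<kappa>)\<^sup>2) \<le> (\<Sum>\<kappa>\<in>G. u * p \<kappa>)"
    unfolding power2_eq_square using p_le p_nonneg by (intro sum_mono mult_right_mono) auto
  also have "\<dots> = u * (\<Sum>\<kappa>\<in>G. p \<kappa>)" by (simp add: sum_distrib_left)
  also have "\<dots> \<le> u * 1" using sum_p_le_1 u by (rule mult_left_mono)
  finally show ?thesis by simp
qed

lemma sum_q_square_le: "(\<Sum>\<kappa>\<in>G. (q \<kappa>)\<^sup>2) \<le> u" "(\<Sum>\<kappa>\<in>G. (q \<kappa>)\<^sup>2) \<le> 1"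
proof -
  have "(\<Sum>\<kappa>\<in>G. (q \<kappa>)\<^sup>2) \<le> (\<Sum>\<kappa>\<in>G. u * q \<kappa>)"
    unfolding power2_eq_square using q_le q_nonneg by (intro sum_mono mult_right_mono) auto
  also have "\<dots> = u * (\<Sum>\<kappa>\<in>G. q \<kappa>)" by (simp add: sum_distrib_left)
  also have "\<dots> \<le> u * 1" using sum_q_le_1 u by (rule mult_left_mono)
  finally show "(\<Sum>\<kappa>\<in>G. (q \<kappa>)\<^sup>2) \<le> u" by simp
  have "(q \<kappa>)\<^sup>2 \<le> q \<kappa>" if "\<kappa> \<in> G" for \<kappa>
  proof -
    have "q \<kappa> \<le> (\<Sum>\<kappa>\<in>G. q \<kappa>)" using that q_nonneg finite_G by (intro member_le_sum) auto
    then have "q \<kappa> \<le> 1" using sum_q_le_1 by linarith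
    then show ?thesis using mult_right_mono[of "q \<kappa>" 1 "q \<kappa>"] q_nonneg[of \<kappa>] by (simp add: power2_eq_square)
  qed
  then have "(\<Sum>\<kappa>\<in>G. (q \<kappa>)\<^sup>2) \<le> (\<Sum>\<kappa>\<in>G. q \<kappa>)" by (rule sum_mono)
  then show "(\<Sum>\<kappa>\<in>G. (q \<kappa>)\<^sup>2) \<le> 1" using sum_q_le_1 by linarith
qed

text \<open>Diagonal and rank-one parts are treated separately: the former contributes at most
  \<open>8 * u\<close>, and the squares of the latter factor into the sums of squares of
  \<open>p\<close> and of \<open>q\<close>, bounded by \<open>u\<close> and \<open>1\<close>, with
  coefficient \<open>8\<close>.\<close>

lemma sum_\<Gamma>_square_le: "(\<Sum>\<kappa>\<in>G. \<Sum>\<kappa>'\<in>G. (\<Gamma> \<kappa> \<kappa>')\<^sup>2) \<le> 16 * u"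
proof -
  have sq: "(x - y - z)\<^sup>2 \<le> 2 * x\<^sup>2 + 4 * y\<^sup>2 + 4 * z\<^sup>2" for x y z :: real
  proof -
    have "0 \<le> (x + y + z)\<^sup>2 + 2 * (y - z)\<^sup>2" by simp
    then show ?thesis by (simp add: power2_eq_square algebra_simps)
  qed
  have "(\<Sum>\<kappa>\<in>G. \<Sum>\<kappa>'\<in>G. (\<Gamma> \<kappa> \<kappa>')\<^sup>2) \<le>
      (\<Sum>\<kappa>\<in>G. \<Sum>\<kappa>'\<in>G. 2 * (if \<kappa> = \<kappa>' then (p \<kappa> + q \<kappa>)\<^sup>2 else 0) + 4 * ((p \<kappa>)\<^sup>2 * (q \<kappa>')\<^sup>2) + 4 * ((q \<kappa>)\<^sup>2 * (p \<kappa>')\<^sup>2))"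
  proof (intro sum_mono)
    fix \<kappa> \<kappa>'
    show "(\<Gamma> \<kappa> \<kappa>')\<^sup>2 \<le> 2 * (if \<kappa> = \<kappa>' then (p \<kappa> + q \<kappa>)\<^sup>2 else 0) + 4 * ((p \<kappa>)\<^sup>2 * (q \<kappa>')\<^sup>2) + 4 * ((q \<kappa>)\<^sup>2 * (p \<kappa>')\<^sup>2)"
      using sq[of "if \<kappa> = \<kappa>' then p \<kappa> + q \<kappa> else 0" "p \<kappa> * q \<kappa>'" "q \<kappa> * p \<kappa>'"]
      unfolding \<Gamma>_def power_mult_distrib by (cases "\<kappa> = \<kappa>'") simp_all
  qed
  also have "\<dots> = 2 * (\<Sum>\<kappa>\<in>G. (p \<kappa> + q \<kappa>)\<^sup>2) + 8 * ((\<Sum>\<kappa>\<in>G. (p \<kappa>)\<^sup>2) * (\<Sum>\<kappa>\<in>G. (q \<kappa>)\<^sup>2))"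
    using finite_G by (simp add: sum.distrib sum_distrib_left[symmetric] sum_distrib_right[symmetric])
  also have "\<dots> \<le> 2 * (4 * u) + 8 * (u * 1)"
  proof (intro add_mono mult_left_mono mult_mono sum_p_square_le sum_q_square_le)
    have "(p \<kappa> + q \<kappa>)\<^sup>2 \<le> 2 * (p \<kappa>)\<^sup>2 + 2 * (q \<kappa>)\<^sup>2" for \<kappa>
      using zero_le_power2[of "p \<kappa> - q \<kappa>"] by (simp add: power2_eq_square algebra_simps)
    then have "(\<Sum>\<kappa>\<in>G. (p \<kappa> + q \<kappa>)\<^sup>2) \<le> (\<Sum>\<kappa>\<in>G. 2 * (p \<kappa>)\<^sup>2 + 2 * (q \<kappa>)\<^sup>2)" by (rule sum_mono)
    then show "(\<Sum>\<kappa>\<in>G. (p \<kappa> + q \<kappa>)\<^sup>2) \<le> 4 * u"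
      using sum_p_square_le sum_q_square_le(1) by (simp add: sum.distrib sum_distrib_left[symmetric])
  qed (use u in \<open>auto intro: sum_nonneg\<close>)
  finally show ?thesis by simp
qed

text \<open>As a quadratic form in \<open>\<theta>\<close>, the diagonal part is at most
  \<open>2 * u * \<Theta>\<close>. The rank-one parts are at most the sum of the squared inner
  products of \<open>\<theta>\<close> with \<open>p\<close> and with \<open>q\<close>, each bounded
  by \<open>u * \<Theta>\<close> through Cauchy-Schwarz.\<close>

lemma sum_\<Gamma>_\<theta>_le: "(\<Sum>\<kappa>\<in>G. \<Sum>\<kappa>'\<in>G. \<Gamma> \<kappa> \<kappa>' * (\<theta> \<kappa> * \<theta> \<kappa>')) \<le> 4 * u * \<Theta>"
proof -
  let ?A = "\<Sum>\<kappa>\<in>G. \<theta> \<kappa> * p \<kappa>" and ?B = "\<Sum>\<kappa>\<in>G. \<theta> \<kappa> * q \<kappa>"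
  have "(\<Sum>\<kappa>\<in>G. \<Sum>\<kappa>'\<in>G. \<Gamma> \<kappa> \<kappa>' * (\<theta> \<kappa> * \<theta> \<kappa>')) = (\<Sum>\<kappa>\<in>G. \<Sum>\<kappa>'\<in>G.
      (if \<kappa>' = \<kappa> then (p \<kappa> + q \<kappa>) * (\<theta> \<kappa>)\<^sup>2 else 0) - (\<theta> \<kappa> * p \<kappa>) * (\<theta> \<kappa>' * q \<kappa>') - (\<theta> \<kappa> * q \<kappa>) * (\<theta> \<kappa>' * p \<kappa>'))"
    by (intro sum.cong refl) (auto simp: \<Gamma>_def power2_eq_square algebra_simps)
  also have "\<dots> = (\<Sum>\<kappa>\<in>G. (p \<kappa> + q \<kappa>) * (\<theta> \<kappa>)\<^sup>2) - ?A * ?B - ?B * ?A"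
    unfolding sum_product using finite_G by (simp add: sum_subtractf)
  also have "\<dots> \<le> 2 * u * \<Theta> + (u * \<Theta> + u * \<Theta>)"
  proof -
    have "(\<Sum>\<kappa>\<in>G. (p \<kappa> + q \<kappa>) * (\<theta> \<kappa>)\<^sup>2) \<le> (\<Sum>\<kappa>\<in>G. (2 * u) * (\<theta> \<kappa>)\<^sup>2)"
    proof (intro sum_mono mult_right_mono)
      fix \<kappa> assume "\<kappa> \<in> G"
      then show "p \<kappa> + q \<kappa> \<le> 2 * u" using p_le[of \<kappa>] q_le[of \<kappa>] by simp
    qed simp
    then have 1: "(\<Sum>\<kappa>\<in>G. (p \<kappa> + q \<kappa>) * (\<theta> \<kappa>)\<^sup>2) \<le> 2 * u * \<Theta>"
      by (simp add: \<Theta>_def sum_distrib_left)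
    have \<Theta>: "\<Theta> \<ge> 0" unfolding \<Theta>_def by (intro sum_nonneg) simp
    have "?A\<^sup>2 \<le> \<Theta> * (\<Sum>\<kappa>\<in>G. (p \<kappa>)\<^sup>2)" unfolding \<Theta>_def by (rule Cauchy_Schwarz_ineq_sum)
    also have "\<dots> \<le> \<Theta> * u" using sum_p_square_le \<Theta> by (rule mult_left_mono)
    finally have 2: "?A\<^sup>2 \<le> \<Theta> * u" .
    have "?B\<^sup>2 \<le> \<Theta> * (\<Sum>\<kappa>\<in>G. (q \<kappa>)\<^sup>2)" unfolding \<Theta>_def by (rule Cauchy_Schwarz_ineq_sum)
    also have "\<dots> \<le> \<Theta> * u" using sum_q_square_le(1) \<Theta> by (rule mult_left_mono)
    finally have 3: "?B\<^sup>2 \<le> \<Theta> * u" .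
    have "- (A * B) - B * A \<le> A\<^sup>2 + B\<^sup>2" for A B :: real
      using zero_le_power2[of "A + B"] by (simp add: power2_eq_square algebra_simps)
    from this[of ?A ?B] 1 2 3 show ?thesis by (simp add: mult.commute)
  qed
  finally show ?thesis by simp
qed

text \<open>In the expanded second moment, the term quadratic in \<open>\<Theta>\<close> is absorbed
  by the squared mean, since \<open>m (m - 1) \<le> m^2\<close>. There remain the noise present
  already for \<open>\<Theta> = 0\<close>, of order \<open>m^2 u\<close>, and a term linear in
  \<open>\<Theta>\<close>.\<close>

lemma variance_T_le: "\<Omega>.variance T \<le> 16 * (real m)\<^sup>2 * u + 8 * (real m)^3 * u * \<Theta>"
proof -
  let ?m = "real m"
  have int: "integrable \<Omega> T" by (rule integrable_bounded[OF T_measurable T_bound])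
  have "\<bar>(T \<omega>)\<^sup>2\<bar> \<le> (real (card G) * (?m * ?m))\<^sup>2" for \<omega>
    using power_mono[OF T_bound abs_ge_zero, of \<omega> 2] by simp
  then have int2: "integrable \<Omega> (\<lambda>\<omega>. (T \<omega>)\<^sup>2)" by (intro integrable_bounded) auto
  have \<Theta>: "\<Theta> \<ge> 0" unfolding \<Theta>_def by (intro sum_nonneg) simp
  have "\<Omega>.variance T = (\<Sum>\<kappa>\<in>G. \<Sum>\<kappa>'\<in>G. (?m * \<Gamma> \<kappa> \<kappa>' + ?m * (?m - 1) * (\<theta> \<kappa> * \<theta> \<kappa>'))\<^sup>2) - (?m\<^sup>2 * \<Theta>)\<^sup>2"
    using \<Omega>.variance_eq[OF int int2] by (simp only: expectation_T expectation_T_square)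
  also have "(\<Sum>\<kappa>\<in>G. \<Sum>\<kappa>'\<in>G. (?m * \<Gamma> \<kappa> \<kappa>' + ?m * (?m - 1) * (\<theta> \<kappa> * \<theta> \<kappa>'))\<^sup>2) =
      (\<Sum>\<kappa>\<in>G. \<Sum>\<kappa>'\<in>G. ?m\<^sup>2 * (\<Gamma> \<kappa> \<kappa>')\<^sup>2 + (2 * ?m\<^sup>2 * (?m - 1)) * (\<Gamma> \<kappa> \<kappa>' * (\<theta> \<kappa> * \<theta> \<kappa>'))
        + (?m * (?m - 1))\<^sup>2 * ((\<theta> \<kappa>)\<^sup>2 * (\<theta> \<kappa>')\<^sup>2))"
    by (intro sum.cong refl) (simp add: power2_eq_square algebra_simps)
  also have "\<dots> = ?m\<^sup>2 * (\<Sum>\<kappa>\<in>G. \<Sum>\<kappa>'\<in>G. (\<Gamma> \<kappa> \<kappa>')\<^sup>2)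
      + (2 * ?m\<^sup>2 * (?m - 1)) * (\<Sum>\<kappa>\<in>G. \<Sum>\<kappa>'\<in>G. \<Gamma> \<kappa> \<kappa>' * (\<theta> \<kappa> * \<theta> \<kappa>')) + (?m * (?m - 1))\<^sup>2 * (\<Theta> * \<Theta>)"
    unfolding \<Theta>_def sum_product by (simp only: sum.distrib sum_distrib_left)
  also have "\<dots> - (?m\<^sup>2 * \<Theta>)\<^sup>2 \<le> ?m\<^sup>2 * (16 * u) + (2 * ?m\<^sup>2 * ?m) * (4 * u * \<Theta>)"
  proof -
    have "(2 * ?m\<^sup>2 * (?m - 1)) * (\<Sum>\<kappa>\<in>G. \<Sum>\<kappa>'\<in>G. \<Gamma> \<kappa> \<kappa>' * (\<theta> \<kappa> * \<theta> \<kappa>')) \<le> (2 * ?m\<^sup>2 * (?m - 1)) * (4 * u * \<Theta>)"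
      using sum_\<Gamma>_\<theta>_le m by (intro mult_left_mono) auto
    also have "\<dots> \<le> (2 * ?m\<^sup>2 * ?m) * (4 * u * \<Theta>)"
      using u \<Theta> by (intro mult_right_mono mult_left_mono) auto
    finally have 1: "(2 * ?m\<^sup>2 * (?m - 1)) * (\<Sum>\<kappa>\<in>G. \<Sum>\<kappa>'\<in>G. \<Gamma> \<kappa> \<kappa>' * (\<theta> \<kappa> * \<theta> \<kappa>')) \<le> (2 * ?m\<^sup>2 * ?m) * (4 * u * \<Theta>)" .
    have 2: "?m\<^sup>2 * (\<Sum>\<kappa>\<in>G. \<Sum>\<kappa>'\<in>G. (\<Gamma> \<kappa> \<kappa>')\<^sup>2) \<le> ?m\<^sup>2 * (16 * u)"
      using sum_\<Gamma>_square_le by (intro mult_left_mono) auto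
    have "?m * (?m - 1) \<le> ?m * ?m" by (intro mult_left_mono) auto
    moreover have "0 \<le> ?m * (?m - 1)" using m by simp
    ultimately have "(?m * (?m - 1))\<^sup>2 \<le> (?m * ?m)\<^sup>2" by (rule power_mono)
    then have "(?m * (?m - 1))\<^sup>2 * (\<Theta> * \<Theta>) \<le> (?m * ?m)\<^sup>2 * (\<Theta> * \<Theta>)"
      by (rule mult_right_mono) simp
    also have "\<dots> = (?m\<^sup>2 * \<Theta>)\<^sup>2" by (simp add: power2_eq_square mult_ac)
    finally show ?thesis using 1 2 by linarith
  qed
  also have "\<dots> = 16 * ?m\<^sup>2 * u + 8 * ?m^3 * u * \<Theta>" by (simp add: power2_eq_square power3_eq_cube)
  finally show ?thesis .
qed

lemma prob_deviation_le:
  assumes "t > 0"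
  shows "\<Omega>.prob {\<omega> \<in> space \<Omega>. t \<le> \<bar>T \<omega> - (real m)\<^sup>2 * \<Theta>\<bar>} \<le> (16 * (real m)\<^sup>2 * u + 8 * (real m)^3 * u * \<Theta>) / t\<^sup>2"
proof -
  have "\<bar>(T \<omega>)\<^sup>2\<bar> \<le> (real (card G) * (real m * real m))\<^sup>2" for \<omega>
    using power_mono[OF T_bound abs_ge_zero, of \<omega> 2] by simp
  then have "integrable \<Omega> (\<lambda>\<omega>. (T \<omega>)\<^sup>2)" by (intro integrable_bounded) auto
  from \<Omega>.Chebyshev_inequality[OF T_measurable this assms]
  have "\<Omega>.prob {\<omega> \<in> space \<Omega>. t \<le> \<bar>T \<omega> - (real m)\<^sup>2 * \<Theta>\<bar>} \<le> \<Omega>.variance T / t\<^sup>2"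
    by (simp add: expectation_T)
  also have "\<dots> \<le> (16 * (real m)\<^sup>2 * u + 8 * (real m)^3 * u * \<Theta>) / t\<^sup>2"
    using variance_T_le by (rule divide_right_mono) simp
  finally show ?thesis .
qed

lemma null_error_le:
  assumes "\<Theta> = 0" "\<tau> > 0"
  shows "\<Omega>.prob {\<omega> \<in> space \<Omega>. \<tau> \<le> T \<omega>} \<le> 16 * (real m)\<^sup>2 * u / \<tau>\<^sup>2"
proof -
  have "\<Omega>.prob {\<omega> \<in> space \<Omega>. \<tau> \<le> T \<omega>} \<le> \<Omega>.prob {\<omega> \<in> space \<Omega>. \<tau> \<le> \<bar>T \<omega> - (real m)\<^sup>2 * \<Theta>\<bar>}"
    by (rule \<Omega>.finite_measure_mono) (use assms in auto)
  also have "\<dots> \<le> 16 * (real m)\<^sup>2 * u / \<tau>\<^sup>2" using prob_deviation_le[OF assms(2)] assms(1) by simp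
  finally show ?thesis .
qed

text \<open>The threshold is at most half the mean, so a miss is a deviation by at least half the
  mean. The bound involves only \<open>u\<close> and \<open>m * \<Theta>\<close>, which makes
  \<open>m * \<Theta>\<close> of order \<open>sqrt u\<close> the detectable size.\<close>

lemma alternative_error_le:
  assumes "2 * \<tau> \<le> (real m)\<^sup>2 * \<Theta>" "\<Theta> > 0"
  shows "\<Omega>.prob {\<omega> \<in> space \<Omega>. T \<omega> < \<tau>} \<le> 64 * u / (real m * \<Theta>)\<^sup>2 + 32 * u / (real m * \<Theta>)"
proof -
  let ?t = "(real m)\<^sup>2 * \<Theta> / 2"
  have t: "?t > 0" using assms m by simp
  have "\<Omega>.prob {\<omega> \<in> space \<Omega>. T \<omega> < \<tau>} \<le> \<Omega>.prob {\<omega> \<in> space \<Omega>. ?t \<le> \<bar>T \<omega> - (real m)\<^sup>2 * \<Theta>\<bar>}"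
  proof (rule \<Omega>.finite_measure_mono, rule subsetI)
    fix \<omega> assume "\<omega> \<in> {\<omega> \<in> space \<Omega>. T \<omega> < \<tau>}"
    then have "\<omega> \<in> space \<Omega>" "T \<omega> < \<tau>" by auto
    moreover from this have "?t \<le> \<bar>T \<omega> - (real m)\<^sup>2 * \<Theta>\<bar>" using assms(1) t by linarith
    ultimately show "\<omega> \<in> {\<omega> \<in> space \<Omega>. ?t \<le> \<bar>T \<omega> - (real m)\<^sup>2 * \<Theta>\<bar>}" by blast
  qed simp
  also have "\<dots> \<le> (16 * (real m)\<^sup>2 * u + 8 * (real m)^3 * u * \<Theta>) / ?t\<^sup>2" by (rule prob_deviation_le[OF t])
  also have "\<dots> = 64 * u / (real m * \<Theta>)\<^sup>2 + 32 * u / (real m * \<Theta>)"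
    using m assms(2) by (simp add: power2_eq_square power3_eq_cube field_simps)
  finally show ?thesis .
qed

end

end


section \<open>The upper bound\<close>

lemma space_cube_lebesgue[simp]: "space (cube_lebesgue :: 'a::euclidean_space measure) = unit_cube"
  by (simp add: cube_lebesgue_def space_restrict_space)

lemma unit_cube_in_sets[simp]: "unit_cube \<in> sets (cube_lebesgue :: 'a::euclidean_space measure)"
  using sets.top[of "cube_lebesgue :: 'a measure"] by simp

lemma borel_measurable_cube_lebesgue: "g \<in> borel_measurable borel \<Longrightarrow> g \<in> borel_measurable cube_lebesgue"
  unfolding cube_lebesgue_def by (rule measurable_restrict_space1) simp

lemma integral_cube_lebesgue:
  fixes g :: "'a::euclidean_space \<Rightarrow> real"
  shows "(\<integral>x. g x \<partial>cube_lebesgue) = (\<integral>x. indicator unit_cube x * g x \<partial>lborel)"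
  unfolding cube_lebesgue_def by (subst integral_restrict_space) auto

lemma integrable_cube_lebesgue:
  fixes g :: "'a::euclidean_space \<Rightarrow> real"
  shows "integrable cube_lebesgue g \<longleftrightarrow> integrable lborel (\<lambda>x. indicator unit_cube x * g x)"
  unfolding cube_lebesgue_def by (subst integrable_restrict_space) auto

lemma integrable_cube_lebesgue_indicator:
  fixes g :: "'a::euclidean_space \<Rightarrow> real"
  assumes "A \<in> sets borel" "integrable cube_lebesgue g"
  shows "integrable cube_lebesgue (\<lambda>x. g x * indicator A x)"
  using integrable_real_mult_indicator[of A lborel "\<lambda>x. indicator unit_cube x * g x"] assms
  by (simp add: integrable_cube_lebesgue mult.assoc)

lemma emeasure_cube_lebesgue_space: "emeasure (cube_lebesgue :: 'a::euclidean_space measure) unit_cube = 1"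
  unfolding cube_lebesgue_def by (subst emeasure_restrict_space) (auto simp: emeasure_lborel_cbox_eq)

lemma prob_space_cube_lebesgue: "prob_space (cube_lebesgue :: 'a::euclidean_space measure)"
  by (rule prob_spaceI) (simp add: emeasure_cube_lebesgue_space)

lemma lebesgue_density_sets: "lebesgue_density P f \<Longrightarrow> sets P = sets cube_lebesgue"
  by (simp add: lebesgue_density_def)

lemma lebesgue_density_integral:
  fixes g :: "'a::euclidean_space \<Rightarrow> real"
  assumes P: "lebesgue_density P f" and g: "g \<in> borel_measurable cube_lebesgue"
  shows "(\<integral>x. g x \<partial>P) = (\<integral>x. f x * g x \<partial>cube_lebesgue)"
proof -
  have "f \<in> borel_measurable cube_lebesgue" "\<forall>x\<in>unit_cube. 0 \<le> f x" "P = density cube_lebesgue (\<lambda>x. ennreal (f x))"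
    using P by (auto simp: lebesgue_density_def)
  moreover have "AE x in cube_lebesgue. 0 \<le> f x" by (rule AE_I2) (use calculation(2) in simp)
  ultimately show ?thesis using g by (simp add: integral_density)
qed

lemma lebesgue_density_prob:
  assumes P: "lebesgue_density P f" and "prob_space P"
  shows "integrable cube_lebesgue f" "(\<integral>x. f x \<partial>cube_lebesgue) = 1"
proof -
  interpret prob_space P by fact
  have f: "f \<in> borel_measurable cube_lebesgue" "\<forall>x\<in>unit_cube. 0 \<le> f x" and P': "P = density cube_lebesgue (\<lambda>x. ennreal (f x))"
    using P by (auto simp: lebesgue_density_def)
  have "(\<integral>\<^sup>+x. ennreal (f x) \<partial>cube_lebesgue) = emeasure P (space P)"
    unfolding P' using f by (subst emeasure_density) (auto intro!: nn_integral_cong)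
  then have nn: "(\<integral>\<^sup>+x. ennreal (f x) \<partial>cube_lebesgue) = ennreal 1" by (simp add: emeasure_space_1)
  show "integrable cube_lebesgue f"
    by (rule integrableI_nonneg) (use f nn in auto)
  show "(\<integral>x. f x \<partial>cube_lebesgue) = 1"
    by (rule integral_eq_nn_integral[THEN trans]) (use f nn in auto)
qed

lemma One_prod: "(One :: 'a::euclidean_space \<times> 'b::euclidean_space) = (One, One)"
proof (rule euclidean_eqI)
  fix i :: "'a \<times> 'b" assume i: "i \<in> Basis"
  have o: "(One :: 'a) \<bullet> b = 1" if "b \<in> Basis" for b using that by (simp add: inner_sum_left inner_Basis)
  have o': "(One :: 'b) \<bullet> b = 1" if "b \<in> Basis" for b using that by (simp add: inner_sum_left inner_Basis)
  have "(One :: 'a \<times> 'b) \<bullet> i = 1" using i by (simp add: inner_sum_left inner_Basis)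
  moreover have "(One :: 'a, One :: 'b) \<bullet> i = 1"
    using i unfolding Basis_prod_def by (auto simp: o o')
  ultimately show "(One :: 'a \<times> 'b) \<bullet> i = (One, One) \<bullet> i" by simp
qed

lemma unit_cube_prod: "(unit_cube :: ('a::euclidean_space \<times> 'b::euclidean_space) set) = unit_cube \<times> unit_cube"
  by (simp add: One_prod cbox_Pair_eq zero_prod_def)

lemma measurable_cube_lebesgue_fst: "fst \<in> (cube_lebesgue :: ('a::euclidean_space \<times> 'b::euclidean_space) measure) \<rightarrow>\<^sub>M cube_lebesgue"
  and measurable_cube_lebesgue_snd: "snd \<in> (cube_lebesgue :: ('a::euclidean_space \<times> 'b::euclidean_space) measure) \<rightarrow>\<^sub>M cube_lebesgue"
proof -
  have "(fst :: 'a \<times> 'b \<Rightarrow> 'a) \<in> lborel \<rightarrow>\<^sub>M lborel" "(snd :: 'a \<times> 'b \<Rightarrow> 'b) \<in> lborel \<rightarrow>\<^sub>M lborel"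
    by (auto intro!: borel_measurable_continuous_onI continuous_intros)
  moreover have "fst x \<in> (unit_cube :: 'a set) \<and> snd x \<in> (unit_cube :: 'b set)" if "x \<in> unit_cube" for x :: "'a \<times> 'b"
    using that unfolding unit_cube_prod by (rule mem_Times_iff[THEN iffD1])
  ultimately show "fst \<in> (cube_lebesgue :: ('a \<times> 'b) measure) \<rightarrow>\<^sub>M cube_lebesgue"
    "snd \<in> (cube_lebesgue :: ('a \<times> 'b) measure) \<rightarrow>\<^sub>M cube_lebesgue"
    unfolding cube_lebesgue_def
    by (auto intro!: measurable_restrict_space2[OF _ measurable_restrict_space1] simp: space_restrict_space)
qed

lemma
  fixes g :: "'a::euclidean_space \<Rightarrow> real" and h :: "'b::euclidean_space \<Rightarrow> real"
  assumes g: "integrable cube_lebesgue g" and h: "integrable cube_lebesgue h"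
  shows integrable_cube_lebesgue_times: "integrable cube_lebesgue (\<lambda>x. g (fst x) * h (snd x))"
    and integral_cube_lebesgue_times:
      "(\<integral>x. g (fst x) * h (snd x) \<partial>cube_lebesgue) = (\<integral>x. g x \<partial>cube_lebesgue) * (\<integral>x. h x \<partial>cube_lebesgue)"
proof -
  define g' where "g' x = indicator unit_cube x * g x" for x
  define h' where "h' x = indicator unit_cube x * h x" for x
  have g': "integrable lborel g'" and h': "integrable lborel h'"
    using g h by (simp_all add: g'_def[abs_def] h'_def[abs_def] integrable_cube_lebesgue)
  have [measurable]: "g' \<in> borel_measurable borel" "h' \<in> borel_measurable borel"
    using g' h' by (auto dest: borel_measurable_integrable)
  have int: "integrable (lborel \<Otimes>\<^sub>M lborel) (\<lambda>x. g' (fst x) * h' (snd x))"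
  proof (rule lborel_pair.Fubini_integrable)
    show "(\<lambda>x. g' (fst x) * h' (snd x)) \<in> borel_measurable (lborel \<Otimes>\<^sub>M lborel)" by measurable
    show "integrable lborel (\<lambda>x. \<integral>y. norm (g' (fst (x, y)) * h' (snd (x, y))) \<partial>lborel)"
      using g' by (simp add: abs_mult)
    show "AE x in lborel. integrable lborel (\<lambda>y. g' (fst (x, y)) * h' (snd (x, y)))"
      using h' by simp
  qed
  have eq: "indicator unit_cube x * (g (fst x) * h (snd x)) = g' (fst x) * h' (snd x)" for x
    unfolding unit_cube_prod by (cases x) (auto simp: g'_def h'_def indicator_def)
  show "integrable cube_lebesgue (\<lambda>x. g (fst x) * h (snd x))"
    unfolding integrable_cube_lebesgue eq using int by (simp add: lborel_prod)
  have "(\<integral>x. g (fst x) * h (snd x) \<partial>cube_lebesgue) = (\<integral>x. g' (fst x) * h' (snd x) \<partial>(lborel \<Otimes>\<^sub>M lborel))"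
    unfolding integral_cube_lebesgue eq by (simp add: lborel_prod)
  also have "\<dots> = (\<integral>x. (\<integral>y. g' x * h' y \<partial>lborel) \<partial>lborel)"
    using lborel_pair.integral_fst'[OF int] by simp
  also have "\<dots> = (\<integral>x. g' x \<partial>lborel) * (\<integral>x. h' x \<partial>lborel)" by simp
  finally show "(\<integral>x. g (fst x) * h (snd x) \<partial>cube_lebesgue) = (\<integral>x. g x \<partial>cube_lebesgue) * (\<integral>x. h x \<partial>cube_lebesgue)"
    unfolding integral_cube_lebesgue g'_def h'_def .
qed

section \<open>Grid cells of the product cube and their probabilities\<close>

lemma grid_cell_prod:
  fixes \<kappa> :: "'a::euclidean_space \<times> 'b::euclidean_space \<Rightarrow> nat"
  shows "grid_cell N \<kappa> = grid_cell N (\<lambda>b. \<kappa> (b, 0)) \<times> grid_cell N (\<lambda>b. \<kappa> (0, b))"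
  unfolding grid_cell_def Basis_prod_def by (auto simp: ball_Un)

lemma grid_cell_disjoint:
  fixes \<kappa> \<kappa>' :: "'a::euclidean_space \<Rightarrow> nat"
  assumes N: "N > 0" and g: "\<kappa> \<in> grid N" "\<kappa>' \<in> grid N" and neq: "\<kappa> \<noteq> \<kappa>'"
  shows "grid_cell N \<kappa> \<inter> grid_cell N \<kappa>' = {}"
proof (rule ccontr)
  assume "grid_cell N \<kappa> \<inter> grid_cell N \<kappa>' \<noteq> {}"
  then obtain x where x: "x \<in> grid_cell N \<kappa>" "x \<in> grid_cell N \<kappa>'" by auto
  have "\<kappa> b = \<kappa>' b" if b: "b \<in> Basis" for b
  proof -
    have "real (\<kappa> b) \<le> x \<bullet> b * real N" "x \<bullet> b * real N < real (Suc (\<kappa> b))"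
      "real (\<kappa>' b) \<le> x \<bullet> b * real N" "x \<bullet> b * real N < real (Suc (\<kappa>' b))"
      using x b N unfolding grid_cell_def by (simp_all add: pos_divide_le_eq pos_less_divide_eq del: of_nat_Suc)
    then have "real (\<kappa> b) < real (Suc (\<kappa>' b))" "real (\<kappa>' b) < real (Suc (\<kappa> b))" by linarith+
    then show ?thesis by linarith
  qed
  then have "\<kappa> = \<kappa>'" using PiE_ext[OF g] by blast
  with neq show False by simp
qed

text \<open>The oscillation bound gives \<open>f x - L * (real DIM('a))^2 \<le> f y\<close>;
  integrating over \<open>y\<close>, where \<open>f\<close> has mean \<open>1\<close>, yields the
  claim.\<close>

lemma holder_density_le:
  fixes f :: "'a::euclidean_space \<Rightarrow> real"
  assumes s: "s > 0" and L: "L > 0" and f: "f \<in> holder_class s L"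
    and int: "integrable cube_lebesgue f" "(\<integral>x. f x \<partial>cube_lebesgue) = 1" and x: "x \<in> unit_cube"
  shows "f x \<le> 1 + L * (real DIM('a))\<^sup>2"
proof -
  interpret prob_space "cube_lebesgue :: 'a measure" by (rule prob_space_cube_lebesgue)
  have "(\<integral>y. f x - L * (real DIM('a))\<^sup>2 \<partial>(cube_lebesgue :: 'a measure)) \<le> (\<integral>y. f y \<partial>cube_lebesgue)"
  proof (rule integral_mono)
    fix y :: 'a assume "y \<in> space cube_lebesgue"
    then show "f x - L * (real DIM('a))\<^sup>2 \<le> f y"
      using holder_class_oscillation[OF s L f x, of y] by simp
  qed (use int in auto)
  then show ?thesis using int prob_space[unfolded space_cube_lebesgue] by simp
qed

text \<open>The basis of the product consists of the vectors \<open>(b, 0)\<close> and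
  \<open>(0, b)\<close>, so reading \<open>\<kappa>\<close> on one kind gives the index of the
  projected cell.\<close>

definition cell_fst :: "nat \<Rightarrow> ('a::euclidean_space \<times> 'b::euclidean_space \<Rightarrow> nat) \<Rightarrow> 'a \<times> 'b \<Rightarrow> real" where
  "cell_fst N \<kappa> x = indicator (grid_cell N (\<lambda>b. \<kappa> (b, 0))) (fst x)"

definition cell_snd :: "nat \<Rightarrow> ('a::euclidean_space \<times> 'b::euclidean_space \<Rightarrow> nat) \<Rightarrow> 'a \<times> 'b \<Rightarrow> real" where
  "cell_snd N \<kappa> x = indicator (grid_cell N (\<lambda>b. \<kappa> (0, b))) (snd x)"

lemma cell_fst_snd: "cell_fst N \<kappa> x * cell_snd N \<kappa> y = indicator (grid_cell N \<kappa>) (fst x, snd y)"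
  unfolding grid_cell_prod by (simp add: cell_fst_def cell_snd_def indicator_def)

lemma cell_family_grid:
  fixes P :: "('a::euclidean_space \<times> 'b::euclidean_space) measure"
  assumes "prob_space P" and sets: "sets P = sets cube_lebesgue" and "N > 0" and "6 * m \<le> n"
  shows "cell_family P (grid N) (cell_fst N) (cell_snd N) m n"
proof -
  interpret prob_space P by fact
  have "cell_fst N \<kappa> \<in> borel_measurable P" "cell_snd N \<kappa> \<in> borel_measurable P" for \<kappa>
  proof -
    have "cell_fst N \<kappa> \<in> borel_measurable cube_lebesgue"
      unfolding cell_fst_def[abs_def]
      by (intro measurable_compose[OF measurable_cube_lebesgue_fst] borel_measurable_cube_lebesgue borel_measurable_indicator grid_cell_borel)
    moreover have "cell_snd N \<kappa> \<in> borel_measurable cube_lebesgue"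
      unfolding cell_snd_def[abs_def]
      by (intro measurable_compose[OF measurable_cube_lebesgue_snd] borel_measurable_cube_lebesgue borel_measurable_indicator grid_cell_borel)
    ultimately show "cell_fst N \<kappa> \<in> borel_measurable P" "cell_snd N \<kappa> \<in> borel_measurable P"
      using measurable_cong_sets[OF sets refl] by auto
  qed
  moreover have "(cell_fst N \<kappa> x * cell_snd N \<kappa> y) * (cell_fst N \<kappa>' x * cell_snd N \<kappa>' y) = 0"
    if "\<kappa> \<in> grid N" "\<kappa>' \<in> grid N" "\<kappa> \<noteq> \<kappa>'" for \<kappa> \<kappa>' :: "'a \<times> 'b \<Rightarrow> nat" and x y
    using grid_cell_disjoint[OF \<open>N > 0\<close> that] unfolding cell_fst_snd by (auto simp: indicator_def)
  ultimately show ?thesis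
    using assms(4) by unfold_locales (auto simp: finite_grid cell_fst_def cell_snd_def indicator_def)
qed

text \<open>\<open>u\<close> is the uniform density bound of \<open>holder_density_le\<close> times
  the volume of a cell of side \<open>1 / N\<close>; it bounds the cell probabilities of the joint
  distribution and of the product alike.\<close>

locale holder_sample =
  fixes s L :: real and P :: "('a::euclidean_space \<times> 'b::euclidean_space) measure" and f fY fZ and N m n :: nat and u :: real
  assumes s: "s > 0" and L: "L > 0" and model: "holder_model s L P f fY fZ" and N: "N > 0"
    and mn: "6 * m \<le> n" and m: "m > 0" and u_eq: "u = (1 + L * (real DIM('a \<times> 'b))\<^sup>2) / real N ^ DIM('a \<times> 'b)"
begin

lemma P_prob: "prob_space P" and P_density: "lebesgue_density P f"
  and fst_density: "lebesgue_density (distr P cube_lebesgue fst) fY"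
  and snd_density: "lebesgue_density (distr P cube_lebesgue snd) fZ"
  and f_holder: "f \<in> holder_class s L" and prod_holder: "(\<lambda>(y, z). fY y * fZ z) \<in> holder_class s L"
  using model by (auto simp: holder_model_def)

sublocale cell_family P "grid N" "cell_fst N" "cell_snd N" m n
  using P_prob lebesgue_density_sets[OF P_density] N mn by (rule cell_family_grid)

abbreviation "fYZ \<equiv> \<lambda>x. fY (fst x) * fZ (snd x)"

lemma fYZ_holder: "fYZ \<in> holder_class s L"
proof -
  have "(\<lambda>(y, z). fY y * fZ z) = fYZ" by auto
  with prod_holder show ?thesis by simp
qed

lemma P_fst: "fst \<in> P \<rightarrow>\<^sub>M cube_lebesgue" and P_snd: "snd \<in> P \<rightarrow>\<^sub>M cube_lebesgue"
  using measurable_cube_lebesgue_fst measurable_cube_lebesgue_snd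
    measurable_cong_sets[OF lebesgue_density_sets[OF P_density] refl] by auto

lemma marginal_probs:
  "prob_space (distr P cube_lebesgue fst)" "prob_space (distr P cube_lebesgue snd)"
  using prob_space_distr P_fst P_snd by auto

text \<open>The product of the marginal densities is itself a density; since it lies in the class,
  it obeys the same uniform bound as \<open>f\<close>.\<close>

lemma fYZ_density: "integrable cube_lebesgue fYZ" "(\<integral>x. fYZ x \<partial>cube_lebesgue) = 1"
proof -
  note Y = lebesgue_density_prob[OF fst_density marginal_probs(1)]
  note Z = lebesgue_density_prob[OF snd_density marginal_probs(2)]
  show "integrable cube_lebesgue fYZ" by (rule integrable_cube_lebesgue_times[OF Y(1) Z(1)])
  show "(\<integral>x. fYZ x \<partial>cube_lebesgue) = 1"
    unfolding integral_cube_lebesgue_times[OF Y(1) Z(1)] using Y(2) Z(2) by simp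
qed

lemma f_le: "x \<in> unit_cube \<Longrightarrow> f x \<le> (1 + L * (real DIM('a \<times> 'b))\<^sup>2)"
  using holder_density_le[OF s L f_holder lebesgue_density_prob[OF P_density P_prob]] .

lemma fYZ_le: "x \<in> unit_cube \<Longrightarrow> fYZ x \<le> (1 + L * (real DIM('a \<times> 'b))\<^sup>2)"
  using holder_density_le[OF s L fYZ_holder fYZ_density] .

lemma indicator_cell_cube:
  assumes "\<kappa> \<in> grid N"
  shows "indicator unit_cube x * (g x * indicator (grid_cell N \<kappa>) x) = indicator (grid_cell N \<kappa>) (x :: 'a \<times> 'b) * (g x :: real)"
proof -
  have "grid_cell N \<kappa> \<subseteq> (unit_cube :: ('a \<times> 'b) set)" using assms by (intro grid_cell_subset_cube) auto
  then show ?thesis by (auto simp: indicator_def)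
qed

lemma p_eq: "\<kappa> \<in> grid N \<Longrightarrow> p \<kappa> = (\<integral>x. indicator (grid_cell N \<kappa>) x * f x \<partial>lborel)"
  unfolding p_def cell_fst_snd
  by (subst lebesgue_density_integral[OF P_density])
     (simp_all add: borel_measurable_cube_lebesgue integral_cube_lebesgue indicator_cell_cube)

lemma q_eq: "\<kappa> \<in> grid N \<Longrightarrow> q \<kappa> = (\<integral>x. indicator (grid_cell N \<kappa>) x * fYZ x \<partial>lborel)"
proof -
  assume k: "\<kappa> \<in> grid N"
  let ?A = "indicator (grid_cell N (\<lambda>b. \<kappa> (b, 0))) :: 'a \<Rightarrow> real"
  let ?B = "indicator (grid_cell N (\<lambda>b. \<kappa> (0, b))) :: 'b \<Rightarrow> real"
  have meas: "?A \<in> borel_measurable cube_lebesgue" "?B \<in> borel_measurable cube_lebesgue"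
    by (intro borel_measurable_cube_lebesgue borel_measurable_indicator grid_cell_borel)+
  have "(\<integral>x. cell_fst N \<kappa> x \<partial>P) = (\<integral>y. ?A y \<partial>distr P cube_lebesgue fst)"
    unfolding cell_fst_def using integral_distr[OF P_fst meas(1)] by simp
  also have "\<dots> = (\<integral>y. fY y * ?A y \<partial>cube_lebesgue)"
    by (rule lebesgue_density_integral[OF fst_density meas(1)])
  finally have a: "(\<integral>x. cell_fst N \<kappa> x \<partial>P) = (\<integral>y. fY y * ?A y \<partial>cube_lebesgue)" .
  have "(\<integral>x. cell_snd N \<kappa> x \<partial>P) = (\<integral>y. ?B y \<partial>distr P cube_lebesgue snd)"
    unfolding cell_snd_def using integral_distr[OF P_snd meas(2)] by simp
  also have "\<dots> = (\<integral>y. fZ y * ?B y \<partial>cube_lebesgue)"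
    by (rule lebesgue_density_integral[OF snd_density meas(2)])
  finally have b: "(\<integral>x. cell_snd N \<kappa> x \<partial>P) = (\<integral>y. fZ y * ?B y \<partial>cube_lebesgue)" .
  have "integrable cube_lebesgue (\<lambda>y. fY y * ?A y)"
    using grid_cell_borel lebesgue_density_prob(1)[OF fst_density marginal_probs(1)]
    by (rule integrable_cube_lebesgue_indicator)
  moreover have "integrable cube_lebesgue (\<lambda>y. fZ y * ?B y)"
    using grid_cell_borel lebesgue_density_prob(1)[OF snd_density marginal_probs(2)]
    by (rule integrable_cube_lebesgue_indicator)
  ultimately have "q \<kappa> = (\<integral>x. (fY (fst x) * ?A (fst x)) * (fZ (snd x) * ?B (snd x)) \<partial>cube_lebesgue)"
    unfolding q_def a b by (rule integral_cube_lebesgue_times[symmetric])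
  also have "\<dots> = (\<integral>x. fYZ x * indicator (grid_cell N \<kappa>) x \<partial>cube_lebesgue)"
    unfolding grid_cell_prod[of N \<kappa>]
    by (intro Bochner_Integration.integral_cong refl) (auto simp: indicator_def)
  finally show ?thesis unfolding integral_cube_lebesgue indicator_cell_cube[OF k, where g = fYZ] .
qed

lemma integral_cell_bounds:
  assumes k: "\<kappa> \<in> grid N" and g: "g \<in> holder_class s L" and le: "\<And>x. x \<in> unit_cube \<Longrightarrow> g x \<le> (1 + L * (real DIM('a \<times> 'b))\<^sup>2)"
  shows "integrable lborel (\<lambda>x. indicator (grid_cell N \<kappa>) (x :: 'a \<times> 'b) * g x)"
    "(\<integral>x. indicator (grid_cell N \<kappa>) (x :: 'a \<times> 'b) * g x \<partial>lborel) \<le> (1 + L * (real DIM('a \<times> 'b))\<^sup>2) / real N ^ DIM('a \<times> 'b)"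
proof -
  have sub: "grid_cell N \<kappa> \<subseteq> (unit_cube :: ('a \<times> 'b) set)" using k by (intro grid_cell_subset_cube) auto
  have cell: "integrable lborel (\<lambda>x :: 'a \<times> 'b. indicator (grid_cell N \<kappa>) x * (c :: real))" for c
    using N by (intro integrable_mult_left integrable_real_indicator) (simp_all add: lborel_grid_cell)
  obtain M where M: "\<And>x. \<bar>indicator unit_cube x * g x\<bar> \<le> M"
    using holder_class_indicator_bounded[OF s L g] by metis
  have eq: "indicator (grid_cell N \<kappa>) x * g x = indicator (grid_cell N \<kappa>) x * (indicator unit_cube x * g x)" for x
    using sub by (auto simp: indicator_def)
  show int: "integrable lborel (\<lambda>x. indicator (grid_cell N \<kappa>) x * g x)"
  proof (rule Bochner_Integration.integrable_bound[OF cell[of M]])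
    show "(\<lambda>x. indicator (grid_cell N \<kappa>) x * g x) \<in> borel_measurable lborel"
      unfolding eq using holder_class_borel_measurable_indicator[OF s L g] by simp
    show "AE x in lborel. norm (indicator (grid_cell N \<kappa>) x * g x) \<le> norm (indicator (grid_cell N \<kappa>) x * M)"
    proof (rule AE_I2)
      fix x show "norm (indicator (grid_cell N \<kappa>) x * g x) \<le> norm (indicator (grid_cell N \<kappa>) x * M)"
        unfolding eq using M[of x] by (cases "x \<in> grid_cell N \<kappa>") auto
    qed
  qed
  have "(\<integral>x. indicator (grid_cell N \<kappa>) x * g x \<partial>lborel) \<le> (\<integral>x. indicator (grid_cell N \<kappa>) (x :: 'a \<times> 'b) * (1 + L * (real DIM('a \<times> 'b))\<^sup>2) \<partial>lborel)"
  proof (rule integral_mono[OF int cell])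
    fix x show "indicator (grid_cell N \<kappa>) x * g x \<le> indicator (grid_cell N \<kappa>) x * (1 + L * (real DIM('a \<times> 'b))\<^sup>2)"
      using sub le[of x] by (auto simp: indicator_def)
  qed
  also have "\<dots> = (1 + L * (real DIM('a \<times> 'b))\<^sup>2) / real N ^ DIM('a \<times> 'b)"
    using N lborel_grid_cell(2)[where 'a = "'a \<times> 'b", of N \<kappa>] by simp
  finally show "(\<integral>x. indicator (grid_cell N \<kappa>) (x :: 'a \<times> 'b) * g x \<partial>lborel) \<le> (1 + L * (real DIM('a \<times> 'b))\<^sup>2) / real N ^ DIM('a \<times> 'b)" .
qed

lemma u: "u \<ge> 0" and p_le: "\<kappa> \<in> grid N \<Longrightarrow> p \<kappa> \<le> u" and q_le: "\<kappa> \<in> grid N \<Longrightarrow> q \<kappa> \<le> u"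
  using L integral_cell_bounds(2)[OF _ f_holder f_le] integral_cell_bounds(2)[OF _ fYZ_holder fYZ_le]
  by (simp_all add: u_eq p_eq q_eq)

lemma \<theta>_eq: "\<kappa> \<in> grid N \<Longrightarrow> \<theta> \<kappa> = (\<integral>x. indicator (grid_cell N \<kappa>) x * (f x - fYZ x) \<partial>lborel)"
  using integral_cell_bounds(1)[OF _ f_holder f_le] integral_cell_bounds(1)[OF _ fYZ_holder fYZ_le]
  by (simp add: p_eq q_eq right_diff_distrib)

lemma \<Theta>_null:
  assumes "\<And>x. x \<in> unit_cube \<Longrightarrow> f x = fYZ x"
  shows "\<Theta> = 0"
  unfolding \<Theta>_def
proof (intro sum.neutral ballI)
  fix \<kappa> :: "'a \<times> 'b \<Rightarrow> nat" assume k: "\<kappa> \<in> grid N"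
  have "grid_cell N \<kappa> \<subseteq> (unit_cube :: ('a \<times> 'b) set)" using k by (intro grid_cell_subset_cube) auto
  then have "indicator (grid_cell N \<kappa>) x * (f x - fYZ x) = 0" for x
    using assms[of x] by (auto simp: indicator_def)
  then have zero: "(\<lambda>x. indicator (grid_cell N \<kappa>) x * (f x - fYZ x)) = (\<lambda>_. 0)" by (rule ext)
  show "(\<theta> \<kappa>)\<^sup>2 = 0" unfolding \<theta>_eq[OF k] zero by simp
qed

end

text \<open>The test rejects for large values of the statistic. \<open>E * sqrt u / m\<close> is a
  size of \<open>\<Theta>\<close> at which its error of the second kind is at most
  \<open>\<beta>\<close>. By \<open>key\<close>, \<open>\<epsilon>^2\<close> is at least the
  reconstruction bound evaluated at this size, which forces every alternative to have a
  \<open>\<Theta>\<close> at least as large.\<close>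

lemma minimax_risk_le_of_grid:
  fixes s L \<alpha> \<beta> \<epsilon> E u C :: real and r R m n :: nat
  assumes s: "s > 0" and L: "L > 0" and \<alpha>: "\<alpha> > 0"
    and rR: "r > 0" "R > 0" and m: "m > 0" and mn: "6 * m \<le> n" and C: "C > 0" and \<epsilon>: "\<epsilon> \<ge> 0"
    and rec: "\<And>f q :: 'a::euclidean_space \<times> 'b::euclidean_space \<Rightarrow> real. \<lbrakk>f \<in> holder_class s L; q \<in> holder_class s L\<rbrakk> \<Longrightarrow>
       (\<integral>x. indicator unit_cube x * (f x - q x)\<^sup>2 \<partial>lborel) \<le>
       C * (real R ^ DIM('a \<times> 'b) * (\<Sum>\<kappa>\<in>grid (r * R). (\<integral>y. indicator (grid_cell (r * R) \<kappa>) y * (f y - q y) \<partial>lborel)\<^sup>2)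
         + L\<^sup>2 * real R powr - (2 * s))"
    and u: "u = (1 + L * (real DIM('a \<times> 'b))\<^sup>2) / real (r * R) ^ DIM('a \<times> 'b)"
    and E: "E > 0" "8 / sqrt \<alpha> \<le> E" "64 / E\<^sup>2 + 32 * sqrt u / E \<le> \<beta>"
    and key: "C * (real R ^ DIM('a \<times> 'b) * (E * sqrt u / real m) + L\<^sup>2 * real R powr - (2 * s)) \<le> \<epsilon>\<^sup>2"
  shows "minimax_risk TYPE('a) TYPE('b) s L \<alpha> n \<epsilon> \<le> ennreal \<beta>"
proof -
  let ?N = "r * R"
  have N: "?N > 0" using rR by simp
  have u_pos: "u > 0" unfolding u using N L by (intro divide_pos_pos add_pos_nonneg) auto
  define stat where "stat = cell_family.T (grid ?N) (cell_fst ?N :: ('a \<times> 'b \<Rightarrow> nat) \<Rightarrow> 'a \<times> 'b \<Rightarrow> real) (cell_snd ?N) m"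
  \<comment> \<open>Chosen so that the Chebyshev bound \<open>16 m^2 u / \<tau>^2\<close> under the
    null hypothesis equals \<open>\<alpha>\<close>.\<close>
  define \<tau> where "\<tau> = 4 * real m * sqrt (u / \<alpha>)"
  have \<tau>: "\<tau> > 0" using m u_pos \<alpha> by (simp add: \<tau>_def)
  define \<phi> where "\<phi> \<omega> = (if \<tau> \<le> stat \<omega> then 1 else 0 :: nat)" for \<omega>
  have "\<phi> \<in> tests n"
  proof -
    \<comment> \<open>Measurability depends on the sigma-algebra only, which the uniform
      distribution shares with every distribution of the model.\<close>
    interpret cell_family "cube_lebesgue :: ('a \<times> 'b) measure" "grid ?N" "cell_fst ?N" "cell_snd ?N" m n
      using prob_space_cube_lebesgue refl N mn by (rule cell_family_grid)
    have [measurable]: "stat \<in> borel_measurable (iid_sample n cube_lebesgue)"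
      unfolding stat_def by (rule T_measurable)
    show ?thesis unfolding tests_def \<phi>_def[abs_def] by measurable
  qed
  moreover have "(SUP P\<in>null_class s L. prob_decision n P \<phi> 1) \<le> ennreal \<alpha>"
  proof (rule SUP_least)
    fix P :: "('a \<times> 'b) measure" assume "P \<in> null_class s L"
    then obtain f fY fZ where model: "holder_model s L P f fY fZ" and
      null: "\<forall>(y, z)\<in>unit_cube. f (y, z) = fY y * fZ z"
      by (auto simp: null_class_def)
    interpret holder_sample s L P f fY fZ ?N m n u
      using s L model N mn m u by unfold_locales
    have "\<Theta> = 0" by (rule \<Theta>_null) (use null in auto)
    then have "\<Omega>.prob {\<omega> \<in> space \<Omega>. \<tau> \<le> stat \<omega>} \<le> 16 * (real m)\<^sup>2 * u / \<tau>\<^sup>2"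
      unfolding stat_def by (intro null_error_le m p_le q_le u \<tau>) auto
    also have "\<dots> = \<alpha>" using m u_pos \<alpha> by (simp add: \<tau>_def power_mult_distrib)
    finally have "\<Omega>.prob {\<omega> \<in> space \<Omega>. \<tau> \<le> stat \<omega>} \<le> \<alpha>" .
    moreover have "{\<omega> \<in> space \<Omega>. \<phi> \<omega> = 1} = {\<omega> \<in> space \<Omega>. \<tau> \<le> stat \<omega>}" by (auto simp: \<phi>_def)
    ultimately show "prob_decision n P \<phi> 1 \<le> ennreal \<alpha>"
      unfolding prob_decision_def by (simp add: \<Omega>.emeasure_eq_measure ennreal_leI)
  qed
  ultimately have "\<phi> \<in> level_tests s L \<alpha> n" by (simp add: level_tests_def)
  moreover have "(SUP P\<in>alternative_class s L \<epsilon>. prob_decision n P \<phi> 0) \<le> ennreal \<beta>"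
  proof (rule SUP_least)
    fix P :: "('a \<times> 'b) measure" assume "P \<in> alternative_class s L \<epsilon>"
    then obtain f fY fZ where model: "holder_model s L P f fY fZ" and
      alt: "\<epsilon> \<le> L2_norm (\<lambda>(y, z). f (y, z) - fY y * fZ z)"
      by (auto simp: alternative_class_def)
    interpret holder_sample s L P f fY fZ ?N m n u
      using s L model N mn m u by unfold_locales
    let ?I = "\<integral>x. indicator unit_cube x * (f x - fYZ x)\<^sup>2 \<partial>lborel"
    have "L2_norm (\<lambda>(y, z). f (y, z) - fY y * fZ z) = sqrt ?I"
      unfolding L2_norm_def integral_cube_lebesgue by (simp add: split_beta)
    with alt have "\<epsilon> \<le> sqrt ?I" by simp
    then have "\<epsilon>\<^sup>2 \<le> (sqrt ?I)\<^sup>2" using \<epsilon> by (rule power_mono)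
    also have "(sqrt ?I)\<^sup>2 = ?I"
      by (intro real_sqrt_pow2 Bochner_Integration.integral_nonneg) simp
    also have "\<dots> \<le> C * (real R ^ DIM('a \<times> 'b) * (\<Sum>\<kappa>\<in>grid ?N. (\<integral>y. indicator (grid_cell ?N \<kappa>) y * (f y - fYZ y) \<partial>lborel)\<^sup>2)
         + L\<^sup>2 * real R powr - (2 * s))"
      by (rule rec[OF f_holder fYZ_holder])
    also have "(\<Sum>\<kappa>\<in>grid ?N. (\<integral>y. indicator (grid_cell ?N \<kappa>) y * (f y - fYZ y) \<partial>lborel)\<^sup>2) = \<Theta>"
      unfolding \<Theta>_def by (intro sum.cong refl) (simp only: \<theta>_eq)
    \<comment> \<open>Separation and \<open>key\<close> are combined; cancelling \<open>C\<close>,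
      the smoothness term and the power of \<open>R\<close> isolates
      \<open>\<Theta>\<close>.\<close>
    finally have "C * (real R ^ DIM('a \<times> 'b) * (E * sqrt u / real m) + L\<^sup>2 * real R powr - (2 * s)) \<le>
        C * (real R ^ DIM('a \<times> 'b) * \<Theta> + L\<^sup>2 * real R powr - (2 * s))"
      using key by linarith
    moreover have "0 < real R ^ DIM('a \<times> 'b)" using rR by simp
    ultimately have "E * sqrt u / real m \<le> \<Theta>"
      by (simp only: mult_le_cancel_left_pos[OF C] add_le_cancel_right mult_le_cancel_left_pos)
    then have m\<Theta>: "E * sqrt u \<le> real m * \<Theta>" using m by (simp add: divide_le_eq mult.commute)
    have Eu: "0 < E * sqrt u" using E u_pos by simp
    then have pos: "0 < real m * \<Theta>" using m\<Theta> by linarith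
    then have \<Theta>: "\<Theta> > 0" using m by (simp add: zero_less_mult_iff)
    \<comment> \<open>The condition \<open>8 / sqrt \<alpha> \<le> E\<close> places twice the
      threshold below the mean of the statistic.\<close>
    have "2 * \<tau> = real m * (8 / sqrt \<alpha> * sqrt u)" by (simp add: \<tau>_def real_sqrt_divide)
    also have "\<dots> \<le> real m * (E * sqrt u)" using E u_pos by (intro mult_left_mono mult_right_mono) auto
    also have "\<dots> \<le> real m * (real m * \<Theta>)" using m\<Theta> by (intro mult_left_mono) auto
    finally have "2 * \<tau> \<le> (real m)\<^sup>2 * \<Theta>" by (simp add: power2_eq_square mult.assoc)
    then have "\<Omega>.prob {\<omega> \<in> space \<Omega>. stat \<omega> < \<tau>} \<le> 64 * u / (real m * \<Theta>)\<^sup>2 + 32 * u / (real m * \<Theta>)"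
      unfolding stat_def using \<Theta> by (intro alternative_error_le m p_le q_le u) auto
    also have "\<dots> \<le> 64 * u / (E * sqrt u)\<^sup>2 + 32 * u / (E * sqrt u)"
      using Eu m\<Theta> u_pos m \<Theta> E(1) by (intro add_mono divide_left_mono power_mono mult_pos_pos zero_less_power pos) auto
    also have "\<dots> = 64 / E\<^sup>2 + 32 * sqrt u / E"
    proof -
      have "u / (E * sqrt u) = sqrt u / E" using u_pos E by (simp add: field_simps)
      then show ?thesis using u_pos E by (simp add: power_mult_distrib)
    qed
    also have "\<dots> \<le> \<beta>" by (rule E(3))
    finally have "\<Omega>.prob {\<omega> \<in> space \<Omega>. stat \<omega> < \<tau>} \<le> \<beta>" .
    moreover have "{\<omega> \<in> space \<Omega>. \<phi> \<omega> = 0} = {\<omega> \<in> space \<Omega>. stat \<omega> < \<tau>}" by (auto simp: \<phi>_def)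
    ultimately show "prob_decision n P \<phi> 0 \<le> ennreal \<beta>"
      unfolding prob_decision_def by (simp add: \<Omega>.emeasure_eq_measure ennreal_leI)
  qed
  ultimately show ?thesis unfolding minimax_risk_def
    by (rule INF_lower2[where f = "\<lambda>\<phi>. SUP P\<in>alternative_class s L \<epsilon>. prob_decision n P \<phi> 0"])
qed

lemma minimax_risk_upper_rate:
  fixes s L \<alpha> \<beta> :: real
  assumes s: "s > 0" and L: "L > 0" and \<alpha>: "\<alpha> > 0" and \<beta>: "\<beta> > 0"
  defines "d \<equiv> real DIM('a::euclidean_space \<times> 'b::euclidean_space)"
  obtains D where "D > 0"
    "\<And>n. n \<ge> 6 \<Longrightarrow> minimax_risk TYPE('a) TYPE('b) s L \<alpha> n (D * real n powr (- (2 * s) / (4 * s + d))) \<le> ennreal \<beta>"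
proof -
  let ?d = "DIM('a \<times> 'b)"
  obtain C :: real and r :: nat where C: "C > 0" and r: "r > 0" and rec:
    "\<And>L (f :: 'a \<times> 'b \<Rightarrow> real) q R. \<lbrakk>L > 0; f \<in> holder_class s L; q \<in> holder_class s L; R > 0\<rbrakk> \<Longrightarrow>
       (\<integral>x. indicator unit_cube x * (f x - q x)\<^sup>2 \<partial>lborel) \<le>
       C * (real R ^ ?d * (\<Sum>\<kappa>\<in>grid (r * R). (\<integral>y. indicator (grid_cell (r * R) \<kappa>) y * (f y - q y) \<partial>lborel)\<^sup>2)
         + L\<^sup>2 * real R powr - (2 * s))"
    by (rule holder_L2_reconstruction[OF s, where 'a = "'a \<times> 'b"]) blast
  define M where "M = 1 + L * (real ?d)\<^sup>2"
  have M: "M > 0" unfolding M_def using L by (intro add_pos_nonneg) auto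
  \<comment> \<open>The second summand serves the threshold and the third the error of the second
    kind; the summand \<open>1\<close> allows \<open>64 / E^2 \<le> 64 / E\<close>.\<close>
  define E where "E = 1 + 8 / sqrt \<alpha> + (64 + 32 * sqrt M) / \<beta>"
  have q1: "0 \<le> (64 + 32 * sqrt M) / \<beta>" and q2: "0 \<le> 8 / sqrt \<alpha>" using \<alpha> \<beta> M by auto
  have E: "E \<ge> 1" "8 / sqrt \<alpha> \<le> E" "(64 + 32 * sqrt M) / \<beta> \<le> E"
    using q1 q2 unfolding E_def by linarith+
  \<comment> \<open>\<open>2 powr (d / 2)\<close> pays for the rounding
    \<open>R \<le> 2 * x\<close>, \<open>12\<close> for \<open>m \<ge> n / 12\<close>, and
    \<open>L^2\<close> is the smoothness term.\<close>
  define B where "B = C * (E * sqrt M * 2 powr (d / 2) * 12 + L\<^sup>2)"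
  have B: "B \<ge> 0" using C E M by (simp add: B_def)
  define D where "D = sqrt (B + 1)"
  have D: "D > 0" "D\<^sup>2 = B + 1" using B by (auto simp: D_def)
  have d: "d \<ge> 0" by (simp add: d_def)
  show ?thesis
  proof (rule that[OF D(1)])
    fix n :: nat assume n: "n \<ge> 6"
    \<comment> \<open>The solution of \<open>x powr (d / 2) / n = x powr - (2 * s)\<close>, which
      balances the stochastic error against the reconstruction error.\<close>
    define x where "x = real n powr (2 / (4 * s + d))"
    have sd: "4 * s + d > 0" using s d by simp
    have x: "x \<ge> 1" unfolding x_def using n sd by (intro ge_one_powr_ge_zero) auto
    define R where "R = nat \<lceil>x\<rceil>"
    have "real R = of_int \<lceil>x\<rceil>" using x by (simp add: R_def)
    then have R: "x \<le> real R" "real R \<le> 2 * x" using x by linarith+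
    then have R0: "R > 0" using x by linarith
    \<comment> \<open>For \<open>n \<ge> 6\<close> this is positive, and rounding loses at most a
      factor \<open>2\<close>.\<close>
    define m where "m = n div 6"
    have m0: "m > 0" "6 * m \<le> n" using n by (auto simp: m_def)
    have "n \<le> 12 * m" using n unfolding m_def by presburger
    then have m: "real n / 12 \<le> real m" by linarith
    define u where "u = M / real (r * R) ^ ?d"
    have "1 \<le> r * R" using r R0 by (simp add: Suc_leI)
    then have rR: "1 \<le> real (r * R)" by (simp only: real_of_nat_ge_one_iff)
    have "u \<le> M" unfolding u_def using rR M by (simp add: divide_le_eq mult_left_le one_le_power)
    then have sqrt_u: "sqrt u \<le> sqrt M" by simp
    have "64 / E\<^sup>2 + 32 * sqrt u / E \<le> 64 / E + 32 * sqrt M / E"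
    proof (intro add_mono divide_right_mono mult_left_mono sqrt_u)
      have "E \<le> E\<^sup>2" using E(1) by (simp add: power2_eq_square)
      then show "64 / E\<^sup>2 \<le> 64 / E" using E(1) by (intro divide_left_mono) auto
    qed (use E in auto)
    also have "\<dots> = (64 + 32 * sqrt M) / E" by (simp add: add_divide_distrib)
    also have "\<dots> \<le> \<beta>" using E(1,3) \<beta> by (simp add: pos_divide_le_eq mult.commute)
    finally have err: "64 / E\<^sup>2 + 32 * sqrt u / E \<le> \<beta>" .
    define \<epsilon> where "\<epsilon> = D * real n powr (- (2 * s) / (4 * s + d))"
    have x_s: "real n powr (- (2 * s) / (4 * s + d)) = x powr - s"
      unfolding x_def powr_powr by (simp add: mult.commute)
    have \<epsilon>2: "\<epsilon>\<^sup>2 = (B + 1) * x powr - (2 * s)"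
    proof -
      have "(x powr - s)\<^sup>2 = x powr - (2 * s)" by (simp add: power2_eq_square powr_add[symmetric])
      then show ?thesis unfolding \<epsilon>_def x_s power_mult_distrib D(2) by (rule arg_cong)
    qed
    have n_x: "real n = x powr ((4 * s + d) / 2)"
    proof -
      have "2 / a * (a / 2) = 1" if "a > 0" for a :: real using that by simp
      note one = this[OF sd]
      show ?thesis unfolding x_def powr_powr one using n by simp
    qed
    have Rd: "real R ^ ?d * sqrt u \<le> sqrt M * (2 powr (d / 2) * x powr (d / 2))"
    proof -
      have "real R ^ ?d * sqrt u \<le> real R ^ ?d * sqrt (M / real R ^ ?d)"
      proof (intro mult_left_mono real_sqrt_le_mono)
        have "real R ^ ?d \<le> real (r * R) ^ ?d" 
        proof (rule power_mono)
          have "R \<le> r * R" using r by simp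
          then show "real R \<le> real (r * R)" by (simp only: of_nat_le_iff)
        qed simp
        then show "u \<le> M / real R ^ ?d" unfolding u_def using M R0 by (intro divide_left_mono) auto
      qed simp
      also have "\<dots> = sqrt M * sqrt (real R ^ ?d)"
      proof -
        have "real R ^ ?d = sqrt (real R ^ ?d) * sqrt (real R ^ ?d)" by simp
        then show ?thesis using R0 by (simp add: real_sqrt_divide field_simps)
      qed
      also have "sqrt (real R ^ ?d) = real R powr (d / 2)"
        using R0 by (simp add: powr_half_sqrt[symmetric] powr_realpow[symmetric] powr_powr d_def)
      also have "\<dots> \<le> (2 * x) powr (d / 2)" using R d by (intro powr_mono2) auto
      also have "\<dots> = 2 powr (d / 2) * x powr (d / 2)" using x by (simp add: powr_mult)
      finally show ?thesis using M by (simp add: mult_left_mono)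
    qed
    have key: "C * (real R ^ ?d * (E * sqrt u / real m) + L\<^sup>2 * real R powr - (2 * s)) \<le> \<epsilon>\<^sup>2"
    proof -
      have "real R ^ ?d * (E * sqrt u / real m) = E * (real R ^ ?d * sqrt u) / real m" by simp
      also have "\<dots> \<le> E * (sqrt M * (2 powr (d / 2) * x powr (d / 2))) / (real n / 12)"
        using Rd m n E(1) M by (intro frac_le mult_left_mono mult_nonneg_nonneg) auto
      also have "\<dots> = E * sqrt M * 2 powr (d / 2) * 12 * (x powr (d / 2) / real n)" by simp
      also have "x powr (d / 2) / real n = x powr - (2 * s)"
        unfolding n_x powr_diff[symmetric] by (simp add: add_divide_distrib)
      finally have 1: "real R ^ ?d * (E * sqrt u / real m) \<le> E * sqrt M * 2 powr (d / 2) * 12 * x powr - (2 * s)" .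
      have "real R powr - (2 * s) \<le> x powr - (2 * s)" using R x s by (intro powr_mono2') auto
      then have 2: "L\<^sup>2 * real R powr - (2 * s) \<le> L\<^sup>2 * x powr - (2 * s)" by (rule mult_left_mono) simp
      have "C * (real R ^ ?d * (E * sqrt u / real m) + L\<^sup>2 * real R powr - (2 * s)) \<le>
          C * (E * sqrt M * 2 powr (d / 2) * 12 * x powr - (2 * s) + L\<^sup>2 * x powr - (2 * s))"
        by (rule mult_left_mono[OF add_mono[OF 1 2]]) (use C in simp)
      also have "\<dots> = B * x powr - (2 * s)" by (simp add: B_def algebra_simps)
      also have "\<dots> \<le> \<epsilon>\<^sup>2" unfolding \<epsilon>2 by (intro mult_right_mono) auto
      finally show ?thesis .
    qed
    show "minimax_risk TYPE('a) TYPE('b) s L \<alpha> n (D * real n powr (- (2 * s) / (4 * s + d))) \<le> ennreal \<beta>"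
      unfolding \<epsilon>_def[symmetric]
    proof (rule minimax_risk_le_of_grid[OF s L \<alpha> r R0 m0 C _ _ _ _ E(2) err key])
      show "\<epsilon> \<ge> 0" using D by (simp add: \<epsilon>_def)
      show "E > 0" using E by simp
      show "u = (1 + L * (real ?d)\<^sup>2) / real (r * R) ^ ?d" by (simp add: u_def M_def)
    qed (rule rec[OF L _ _ R0])
  qed
qed


section \<open>Localised perturbations of the uniform density\<close>

text \<open>Where \<open>p\<close> and its derivative vanish, a function equal at each point to
  \<open>p\<close> or to \<open>0\<close> has difference quotients dominated by those of
  \<open>p\<close>.\<close>

lemma has_real_derivative_zero_glue:
  fixes p g :: "real \<Rightarrow> real"
  assumes p: "(p has_real_derivative 0) (at t)" "p t = 0" and g: "\<And>u. g u = p u \<or> g u = 0"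
  shows "(g has_real_derivative 0) (at t)"
proof -
  have "((\<lambda>h. (p (t + h) - p t) / h) \<longlongrightarrow> 0) (at 0)" using p(1) by (simp add: DERIV_def)
  then have lim: "((\<lambda>h. \<bar>p (t + h) / h\<bar>) \<longlongrightarrow> 0) (at 0)"
    unfolding p(2) diff_zero by (rule tendsto_rabs_zero)
  have gt: "g t = 0" using g[of t] p(2) by auto
  have "((\<lambda>h. (g (t + h) - g t) / h) \<longlongrightarrow> 0) (at 0)"
  proof (rule Lim_null_comparison[OF _ lim])
    show "\<forall>\<^sub>F h in at 0. norm ((g (t + h) - g t) / h) \<le> \<bar>p (t + h) / h\<bar>"
    proof (intro always_eventually allI)
      fix h show "norm ((g (t + h) - g t) / h) \<le> \<bar>p (t + h) / h\<bar>"
        using g[of "t + h"] gt by auto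
    qed
  qed
  then show ?thesis by (simp add: DERIV_def)
qed

text \<open>At \<open>0\<close> and \<open>1\<close> the polynomial vanishes to first order, so
  \<open>has_real_derivative_zero_glue\<close> applies; elsewhere the derivative is a local
  matter.\<close>

lemma glued_poly_derivative:
  fixes p :: "real poly"
  assumes zero: "poly p 0 = 0" "poly p 1 = 0" "poly (pderiv p) 0 = 0" "poly (pderiv p) 1 = 0"
  shows "((\<lambda>t. if 0 < t \<and> t < 1 then poly p t else 0) has_real_derivative
    (if 0 < t \<and> t < 1 then poly (pderiv p) t else 0)) (at t)"
    (is "(?g has_real_derivative _) _")
proof -
  consider "t \<in> {0<..<1}" | "t \<in> - {0..1}" | "t = 0 \<or> t = 1" by fastforce
  then show ?thesis
  proof cases
    case 1
    have "(?g has_real_derivative poly (pderiv p) t) (at t)"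
      by (rule has_field_derivative_transform_within_open[OF poly_DERIV, of "{0<..<1}"]) (use 1 in auto)
    then show ?thesis using 1 by simp
  next
    case 2
    have "(?g has_real_derivative 0) (at t)"
      by (rule has_field_derivative_transform_within_open[OF DERIV_const[of 0], of "- {0..1}"]) (use 2 in auto)
    then show ?thesis using 2 by auto
  next
    case 3
    have "(poly p has_real_derivative 0) (at t)"
    proof -
      have "poly (pderiv p) t = 0" using 3 zero by auto
      then show ?thesis using poly_DERIV[of p t] by simp
    qed
    from has_real_derivative_zero_glue[OF this, of ?g] 3 zero show ?thesis by auto
  qed
qed

lemma power_dvd_pderiv:
  assumes "a ^ Suc m dvd (p :: real poly)"
  shows "a ^ m dvd pderiv p"
proof -
  obtain r where "p = a ^ Suc m * r" using assms by auto
  then have "pderiv p = a ^ m * (a * pderiv r + smult (of_nat (Suc m)) (pderiv a) * r)"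
    by (simp only: pderiv_mult pderiv_power_Suc) (simp add: algebra_simps)
  then show ?thesis by simp
qed

text \<open>The bump is the derivative of \<open>b\<close>, a power of \<open>t (1 - t)\<close>, cut
  off outside the unit interval. It has mean zero as the derivative of a function vanishing at both
  ends. The exponent \<open>n + 3\<close> leaves zeros at the ends for all orders up to
  \<open>Suc n\<close>, so that \<open>n + 1\<close> differentiations across the ends are
  possible.\<close>

lemma smooth_bump:
  fixes n :: nat
  obtains \<phi> :: "nat \<Rightarrow> real \<Rightarrow> real" and B :: real
  where "B \<ge> 1"
    "\<And>j t. j \<le> n \<Longrightarrow> (\<phi> j has_real_derivative \<phi> (Suc j) t) (at t)"
    "\<And>j t. t \<notin> {0<..<1} \<Longrightarrow> \<phi> j t = 0"
    "\<And>j t. j \<le> Suc n \<Longrightarrow> \<bar>\<phi> j t\<bar> \<le> B"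
    "(\<integral>t. \<phi> 0 t \<partial>lborel) = 0" "(\<integral>t. (\<phi> 0 t)\<^sup>2 \<partial>lborel) > 0"
proof -
  define a :: "real poly" where "a = [:0, 1, -1:]"
  define b where "b = a ^ (n + 3)"
  define P where "P j = (pderiv ^^ Suc j) b" for j
  define \<phi> where "\<phi> j t = (if 0 < t \<and> t < 1 then poly (P j) t else 0)" for j and t :: real
  have dvd: "a ^ (n + 2 - j) dvd P j" if "j \<le> n + 2" for j
    using that
  proof (induction j)
    case 0
    have "n + 3 = Suc (n + 2)" by simp
    then have "a ^ Suc (n + 2) dvd b" unfolding b_def by (simp only: dvd_refl)
    from power_dvd_pderiv[OF this] show ?case by (simp add: P_def)
  next
    case (Suc j)
    have "Suc (n + 2 - Suc j) = n + 2 - j" using Suc.prems by simp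
    then have "a ^ Suc (n + 2 - Suc j) dvd P j" using Suc by (simp only: Suc_leD)
    from power_dvd_pderiv[OF this] show ?case by (simp add: P_def)
  qed
  have vanish: "poly (P j) 0 = 0 \<and> poly (P j) 1 = 0" if "j \<le> Suc n" for j
  proof -
    have "a dvd a ^ (n + 2 - j)" using that by (intro dvd_power) auto
    moreover have "a ^ (n + 2 - j) dvd P j" by (rule dvd) (use that in simp)
    ultimately have "a dvd P j" by (rule dvd_trans)
    then obtain r where "P j = a * r" by auto
    then show ?thesis by (simp add: a_def)
  qed
  have D: "(\<phi> j has_real_derivative \<phi> (Suc j) t) (at t)" if "j \<le> n" for j t
  proof -
    have "P (Suc j) = pderiv (P j)" by (simp add: P_def)
    moreover have "poly (P j) 0 = 0" "poly (P j) 1 = 0" "poly (P (Suc j)) 0 = 0" "poly (P (Suc j)) 1 = 0"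
      using vanish[of j] vanish[of "Suc j"] that by auto
    ultimately show ?thesis
      unfolding \<phi>_def[abs_def] by (simp only: glued_poly_derivative)
  qed
  have "\<exists>c. \<forall>t. \<bar>\<phi> j t\<bar> \<le> c" for j
  proof -
    have "compact (poly (P j) ` {0..1})" by (intro compact_continuous_image continuous_intros) auto
    then obtain c where c: "\<And>y. y \<in> poly (P j) ` {0..1} \<Longrightarrow> \<bar>y\<bar> \<le> c"
      by (metis compact_imp_bounded bounded_real)
    have "\<bar>\<phi> j t\<bar> \<le> max 0 c" for t
      using c[of "poly (P j) t"] by (auto simp: \<phi>_def)
    then show ?thesis by blast
  qed
  note ex = this
  define c where "c j = (SOME c. \<forall>t. \<bar>\<phi> j t\<bar> \<le> c)" for j
  have c: "\<bar>\<phi> j t\<bar> \<le> c j" for j t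
    using someI_ex[OF ex[of j]] unfolding c_def by (rule spec)
  have c0: "c j \<ge> 0" for j using c[of j 0] by linarith
  have \<phi>0: "\<phi> 0 t = indicator {0..1} t * poly (pderiv b) t" for t
    using vanish[of 0] by (cases "t = 0 \<or> t = 1") (auto simp: \<phi>_def P_def indicator_def)
  have a_half: "poly b 0 = 0" "poly b 1 = 0" "poly b (1/2) \<noteq> 0"
    by (simp_all add: b_def a_def)
  have cont: "continuous_on UNIV (\<phi> 0)"
    by (intro continuous_at_imp_continuous_on ballI DERIV_isCont[OF D]) simp
  then have [measurable]: "\<phi> 0 \<in> borel_measurable borel" by (rule borel_measurable_continuous_onI)
  have int: "(\<integral>t. \<phi> 0 t \<partial>lborel) = 0"
    unfolding \<phi>0 using integral_poly_Icc[of 0 1 b] a_half by simp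
  have "integrable lborel (\<lambda>t. (\<phi> 0 t)\<^sup>2)"
  proof (rule Bochner_Integration.integrable_bound)
    show "integrable lborel (\<lambda>t::real. indicator {0..1} t * (c 0)\<^sup>2)"
      by (intro integrable_mult_left integrable_real_indicator) auto
    have "(\<phi> 0 t)\<^sup>2 \<le> (c 0)\<^sup>2" for t using c[of 0 t] by (metis abs_ge_zero power2_abs power_mono)
    then show "AE t in lborel. norm ((\<phi> 0 t)\<^sup>2) \<le> norm (indicator {0..1} t * (c 0)\<^sup>2)"
    proof (intro AE_I2)
      fix t assume le: "\<And>t. (\<phi> 0 t)\<^sup>2 \<le> (c 0)\<^sup>2"
      have "\<phi> 0 t = 0" if "t \<notin> {0..1}" using that by (auto simp: \<phi>_def)
      then show "norm ((\<phi> 0 t)\<^sup>2) \<le> norm (indicator {0..1} t * (c 0)\<^sup>2)"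
        using le[of t] by (cases "t \<in> {0..1}") simp_all
    qed
  qed measurable
  then have "(\<integral>t. (\<phi> 0 t)\<^sup>2 \<partial>lborel) = 0 \<longleftrightarrow> (AE t in lborel. (\<phi> 0 t)\<^sup>2 = 0)"
    by (intro integral_nonneg_eq_0_iff_AE) auto
  moreover have "\<not> (AE t in lborel. (\<phi> 0 t)\<^sup>2 = 0)"
  proof
    \<comment> \<open>Otherwise the integral over the left half of the interval would vanish, yet it
      equals the nonzero value of \<open>b\<close> at the midpoint.\<close>
    assume "AE t in lborel. (\<phi> 0 t)\<^sup>2 = 0"
    then have "AE t in lborel. indicator {0..1/2} t * \<phi> 0 t = (0::real)" by eventually_elim simp
    then have "(\<integral>t. indicator {0..1/2} t * \<phi> 0 t \<partial>lborel) = 0"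
      using integral_cong_AE[of "\<lambda>t. indicator {0..1/2} t * \<phi> 0 t" lborel "\<lambda>_. 0"] by simp
    moreover have "(\<integral>t. indicator {0..1/2} t * \<phi> 0 t \<partial>lborel) = poly b (1/2) - poly b 0"
    proof -
      have "indicator {0..1/2} t * \<phi> 0 t = indicator {0..1/2} t * poly (pderiv b) t" for t
        unfolding \<phi>0 by (auto simp: indicator_def)
      then have e: "(\<lambda>t. indicator {0..1/2} t * \<phi> 0 t) = (\<lambda>t. indicator {0..1/2} t * poly (pderiv b) t)" by (rule ext)
      show ?thesis unfolding e using integral_poly_Icc[of 0 "1/2" b] by simp
    qed
    ultimately show False using a_half by simp
  qed
  moreover have "(\<integral>t. (\<phi> 0 t)\<^sup>2 \<partial>lborel) \<ge> 0" by (intro Bochner_Integration.integral_nonneg) simp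
  ultimately have pos: "(\<integral>t. (\<phi> 0 t)\<^sup>2 \<partial>lborel) > 0" by linarith
  show ?thesis
  proof (rule that[of "1 + (\<Sum>j\<le>Suc n. c j)" \<phi>])
    show "1 \<le> 1 + (\<Sum>j\<le>Suc n. c j)" using c0 by (simp add: sum_nonneg)
    show "\<bar>\<phi> j t\<bar> \<le> 1 + (\<Sum>j\<le>Suc n. c j)" if "j \<le> Suc n" for j t
    proof -
      have "c j \<le> (\<Sum>j\<le>Suc n. c j)" using that c0 by (intro member_le_sum) auto
      then show ?thesis using c[of j t] by linarith
    qed
    show "\<phi> j t = 0" if "t \<notin> {0<..<1}" for j t using that by (auto simp: \<phi>_def)
  qed (use D int pos in auto)
qed

lemma abs_sum_le_if_one_nonzero:
  fixes F :: "'k \<Rightarrow> real"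
  assumes "finite A" and "B \<ge> 0" and "\<And>k. k \<in> A \<Longrightarrow> \<bar>F k\<bar> \<le> B"
    and "\<And>k k'. k \<in> A \<Longrightarrow> k' \<in> A \<Longrightarrow> F k \<noteq> 0 \<Longrightarrow> F k' \<noteq> 0 \<Longrightarrow> k = k'"
  shows "\<bar>\<Sum>k\<in>A. F k\<bar> \<le> B"
proof (cases "\<exists>k\<in>A. F k \<noteq> 0")
  case True
  then obtain k where k: "k \<in> A" "F k \<noteq> 0" by auto
  have "(\<Sum>k\<in>A. F k) = (\<Sum>k\<in>{k}. F k)"
    by (rule sum.mono_neutral_right) (use assms k in auto)
  then show ?thesis using assms(3)[OF k(1)] by simp
next
  case False
  then show ?thesis using assms(2) by (simp add: sum.neutral)
qed

section \<open>Sums of signed bumps and their partial derivatives\<close>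

locale bump =
  fixes n :: nat and \<phi> :: "nat \<Rightarrow> real \<Rightarrow> real" and B :: real
  assumes B: "B \<ge> 1"
    and \<phi>_derivative: "\<And>j t. j \<le> n \<Longrightarrow> (\<phi> j has_real_derivative \<phi> (Suc j) t) (at t)"
    and \<phi>_support: "\<And>j t. t \<notin> {0<..<1} \<Longrightarrow> \<phi> j t = 0"
    and \<phi>_bound: "\<And>j t. j \<le> Suc n \<Longrightarrow> \<bar>\<phi> j t\<bar> \<le> B"
    and \<phi>_mean: "(\<integral>t. \<phi> 0 t \<partial>lborel) = 0" and \<phi>_square: "(\<integral>t. (\<phi> 0 t)\<^sup>2 \<partial>lborel) > 0"
begin

text \<open>\<open>c b\<close> is the order of differentiation in direction \<open>b\<close>, so
  that partial derivatives of bumps are again of this form; the powers of \<open>N\<close> from the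
  chain rule are kept outside.\<close>

definition cell_bump :: "nat \<Rightarrow> ('a::euclidean_space \<Rightarrow> nat) \<Rightarrow> ('a \<Rightarrow> nat) \<Rightarrow> 'a \<Rightarrow> real" where
  "cell_bump N c \<kappa> x = (\<Prod>b\<in>Basis. \<phi> (c b) (real N * (x \<bullet> b) - real (\<kappa> b)))"

definition signed_bumps :: "nat \<Rightarrow> (('a::euclidean_space \<Rightarrow> nat) \<Rightarrow> real) \<Rightarrow> ('a \<Rightarrow> nat) \<Rightarrow> 'a \<Rightarrow> real" where
  "signed_bumps N \<eta> c x = (\<Sum>\<kappa>\<in>grid N. \<eta> \<kappa> * cell_bump N c \<kappa> x)"

text \<open>Every \<open>\<phi> j\<close> vanishes off the open unit interval, so a point determines
  its cell, whatever the orders of differentiation.\<close>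

lemma cell_bump_nonzero_unique:
  fixes \<kappa> \<kappa>' :: "'a::euclidean_space \<Rightarrow> nat"
  assumes "\<kappa> \<in> grid N" "\<kappa>' \<in> grid N" "cell_bump N c \<kappa> x \<noteq> 0" "cell_bump N c' \<kappa>' x \<noteq> 0"
  shows "\<kappa> = \<kappa>'"
proof (rule PiE_ext[OF assms(1,2)])
  fix b :: 'a assume b: "b \<in> Basis"
  have "\<phi> (c b) (real N * (x \<bullet> b) - real (\<kappa> b)) \<noteq> 0" "\<phi> (c' b) (real N * (x \<bullet> b) - real (\<kappa>' b)) \<noteq> 0"
    using assms(3,4) b by (auto simp: cell_bump_def)
  then have "real N * (x \<bullet> b) - real (\<kappa> b) \<in> {0<..<1}" "real N * (x \<bullet> b) - real (\<kappa>' b) \<in> {0<..<1}"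
    using \<phi>_support by blast+
  then have "real (\<kappa> b) < real (\<kappa>' b) + 1" "real (\<kappa>' b) < real (\<kappa> b) + 1" by auto
  then show "\<kappa> b = \<kappa>' b" by linarith
qed

lemma cell_bump_bound:
  fixes x :: "'a::euclidean_space"
  assumes "\<And>b. b \<in> Basis \<Longrightarrow> c b \<le> Suc n"
  shows "\<bar>cell_bump N c \<kappa> x\<bar> \<le> B ^ DIM('a)"
proof -
  have "\<bar>cell_bump N c \<kappa> x\<bar> \<le> (\<Prod>b\<in>(Basis::'a set). B)"
    unfolding cell_bump_def abs_prod by (rule prod_mono) (use assms \<phi>_bound in auto)
  then show ?thesis by simp
qed

text \<open>At most one summand is nonzero at any point, so the bound is that of a single bump and
  does not grow with \<open>N\<close>.\<close>

lemma signed_bumps_bound: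
  fixes x :: "'a::euclidean_space"
  assumes "\<And>b. b \<in> Basis \<Longrightarrow> c b \<le> Suc n" and \<eta>: "\<And>\<kappa>. \<bar>\<eta> \<kappa>\<bar> \<le> 1"
  shows "\<bar>signed_bumps N \<eta> c x\<bar> \<le> B ^ DIM('a)"
  unfolding signed_bumps_def
proof (rule abs_sum_le_if_one_nonzero)
  show "0 \<le> B ^ DIM('a)" using B by simp
  fix \<kappa> :: "'a \<Rightarrow> nat" assume "\<kappa> \<in> grid N"
  show "\<bar>\<eta> \<kappa> * cell_bump N c \<kappa> x\<bar> \<le> B ^ DIM('a)"
    unfolding abs_mult using mult_mono[OF \<eta>[of \<kappa>] cell_bump_bound[of c N \<kappa> x]] assms(1) by simp
next
  fix \<kappa> \<kappa>' :: "'a \<Rightarrow> nat" assume "\<kappa> \<in> grid N" "\<kappa>' \<in> grid N" "\<eta> \<kappa> * cell_bump N c \<kappa> x \<noteq> 0" "\<eta> \<kappa>' * cell_bump N c \<kappa>' x \<noteq> 0"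
  then show "\<kappa> = \<kappa>'" by (intro cell_bump_nonzero_unique[of \<kappa> N \<kappa>' c x c]) auto
qed (rule finite_grid)

lemma signed_bumps_has_derivative:
  fixes x :: "'a::euclidean_space"
  assumes c: "\<And>b. b \<in> Basis \<Longrightarrow> c b \<le> n"
  shows "(signed_bumps N \<eta> c has_derivative
    (\<lambda>h. \<Sum>b\<in>Basis. (h \<bullet> b) * (real N * signed_bumps N \<eta> (c(b := Suc (c b))) x))) (at x within S)"
proof -
  have "(cell_bump N c \<kappa> has_derivative
      (\<lambda>h. \<Sum>b\<in>Basis. (h \<bullet> b) * (real N * cell_bump N (c(b := Suc (c b))) \<kappa> x))) (at x within S)" for \<kappa>
  proof -
    have factor: "((\<lambda>x. \<phi> (c b) (real N * (x \<bullet> b) - real (\<kappa> b))) has_derivative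
        (\<lambda>h. \<phi> (Suc (c b)) (real N * (x \<bullet> b) - real (\<kappa> b)) * (real N * (h \<bullet> b)))) (at x within S)"
      if b: "b \<in> Basis" for b
    proof -
      have inner: "((\<lambda>x. real N * (x \<bullet> b) - real (\<kappa> b)) has_derivative (\<lambda>h. real N * (h \<bullet> b))) (at x within S)"
        by (auto intro!: derivative_eq_intros)
      have outer: "(\<phi> (c b) has_derivative (\<lambda>h. \<phi> (Suc (c b)) (real N * (x \<bullet> b) - real (\<kappa> b)) * h))
          (at (real N * (x \<bullet> b) - real (\<kappa> b)))"
        using \<phi>_derivative[OF c[OF b]] by (simp add: has_field_derivative_def)
      show ?thesis using has_derivative_compose[OF inner outer] .
    qed
    have "(cell_bump N c \<kappa> has_derivative (\<lambda>h. \<Sum>b\<in>Basis.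
        (\<phi> (Suc (c b)) (real N * (x \<bullet> b) - real (\<kappa> b)) * (real N * (h \<bullet> b))) *
        (\<Prod>b'\<in>Basis - {b}. \<phi> (c b') (real N * (x \<bullet> b') - real (\<kappa> b'))))) (at x within S)"
      unfolding cell_bump_def[abs_def] by (rule has_derivative_prod) (rule factor)
    moreover have "(\<phi> (Suc (c b)) (real N * (x \<bullet> b) - real (\<kappa> b)) * (real N * (h \<bullet> b))) *
        (\<Prod>b'\<in>Basis - {b}. \<phi> (c b') (real N * (x \<bullet> b') - real (\<kappa> b')))
        = (h \<bullet> b) * (real N * cell_bump N (c(b := Suc (c b))) \<kappa> x)" if "b \<in> Basis" for b h
    proof -
      have "cell_bump N (c(b := Suc (c b))) \<kappa> x = \<phi> (Suc (c b)) (real N * (x \<bullet> b) - real (\<kappa> b)) *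
          (\<Prod>b'\<in>Basis - {b}. \<phi> ((c(b := Suc (c b))) b') (real N * (x \<bullet> b') - real (\<kappa> b')))"
        unfolding cell_bump_def using that by (subst prod.remove[of _ b]) auto
      also have "(\<Prod>b'\<in>Basis - {b}. \<phi> ((c(b := Suc (c b))) b') (real N * (x \<bullet> b') - real (\<kappa> b'))) =
          (\<Prod>b'\<in>Basis - {b}. \<phi> (c b') (real N * (x \<bullet> b') - real (\<kappa> b')))"
        by (rule prod.cong) auto
      finally show ?thesis by (simp only: mult_ac)
    qed
    ultimately show ?thesis by (simp cong: sum.cong)
  qed
  then have "(signed_bumps N \<eta> c has_derivative (\<lambda>h. \<Sum>\<kappa>\<in>grid N. \<eta> \<kappa> *
      (\<Sum>b\<in>Basis. (h \<bullet> b) * (real N * cell_bump N (c(b := Suc (c b))) \<kappa> x)))) (at x within S)"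
    unfolding signed_bumps_def[abs_def] by (intro has_derivative_sum has_derivative_mult_right)
  moreover have "(\<Sum>\<kappa>\<in>grid N. \<eta> \<kappa> * (\<Sum>b\<in>Basis. (h \<bullet> b) * (real N * cell_bump N (c(b := Suc (c b))) \<kappa> x))) =
      (\<Sum>b\<in>Basis. (h \<bullet> b) * (real N * signed_bumps N \<eta> (c(b := Suc (c b))) x))" for h
    unfolding signed_bumps_def sum_distrib_left by (subst sum.swap) (simp add: mult_ac)
  ultimately show ?thesis by simp
qed

definition perturbed :: "nat \<Rightarrow> real \<Rightarrow> (('a::euclidean_space \<Rightarrow> nat) \<Rightarrow> real) \<Rightarrow> 'a \<Rightarrow> real" where
  "perturbed N \<rho> \<eta> x = 1 + \<rho> * signed_bumps N \<eta> (\<lambda>_. 0) x"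

lemma count_list_le_length: "count_list bs b \<le> length bs"
  by (induction bs) auto

text \<open>A mixed partial derivative of a product of one-dimensional functions depends only on how
  often each direction occurs, which is \<open>count_list bs\<close>; each differentiation
  contributes a factor \<open>N\<close>.\<close>

lemma iterated_partial_perturbed:
  fixes x :: "'a::euclidean_space"
  assumes "set bs \<subseteq> Basis" "length bs \<le> Suc n" "x \<in> unit_cube"
  shows "iterated_partial bs (perturbed N \<rho> \<eta>) x =
    (if bs = [] then 1 else 0) + \<rho> * real N ^ length bs * signed_bumps N \<eta> (count_list bs) x"
  using assms
proof (induction bs arbitrary: x)
  case Nil
  have "count_list ([] :: 'a list) = (\<lambda>_. 0)" by auto
  then show ?case by (simp add: perturbed_def)
next
  case (Cons b bs)
  let ?g = "\<lambda>x. (if bs = [] then 1 else 0) + \<rho> * real N ^ length bs * signed_bumps N \<eta> (count_list bs) x"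
  let ?g' = "\<lambda>h. \<rho> * real N ^ length bs * (\<Sum>b\<in>Basis. (h \<bullet> b) *
      (real N * signed_bumps N \<eta> ((count_list bs)(b := Suc (count_list bs b))) x))"
  have b: "b \<in> Basis" using Cons.prems by simp
  have "(?g has_derivative ?g') (at x within unit_cube)"
  proof -
    have "((\<lambda>x. \<rho> * real N ^ length bs * signed_bumps N \<eta> (count_list bs) x) has_derivative ?g') (at x within unit_cube)"
    proof (intro has_derivative_mult_right signed_bumps_has_derivative)
      fix b :: 'a show "count_list bs b \<le> n" using count_list_le_length[of bs b] Cons.prems(2) by simp
    qed
    from has_derivative_add[OF has_derivative_const this] show ?thesis by simp
  qed
  \<comment> \<open>The induction hypothesis is an identity on the cube, which is enough to transfer
    the derivative within the cube; uniqueness of the latter then identifies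
    \<open>frechet_derivative\<close>.\<close>
  then have "(iterated_partial bs (perturbed N \<rho> \<eta>) has_derivative ?g') (at x within unit_cube)"
    by (rule has_derivative_transform[rotated 2]) (use Cons in auto)
  then have "frechet_derivative (iterated_partial bs (perturbed N \<rho> \<eta>)) (at x within unit_cube) = ?g'"
    by (intro frechet_derivative_within_cbox) (use Cons.prems in auto)
  then have "iterated_partial (b # bs) (perturbed N \<rho> \<eta>) x = ?g' b" by simp
  also have "(\<Sum>b'\<in>Basis. (b \<bullet> b') *
      (real N * signed_bumps N \<eta> ((count_list bs)(b' := Suc (count_list bs b'))) x)) =
      real N * signed_bumps N \<eta> ((count_list bs)(b := Suc (count_list bs b))) x"
    using b by (simp add: inner_Basis if_distrib[where f = "\<lambda>u. u * _"] cong: if_cong)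
  also have "(count_list bs)(b := Suc (count_list bs b)) = count_list (b # bs)" by auto
  finally show ?case by (simp add: mult_ac)
qed

lemma iterated_partial_perturbed_differentiable:
  fixes bs :: "'a::euclidean_space list"
  assumes "set bs \<subseteq> Basis" "length bs \<le> n"
  shows "iterated_partial bs (perturbed N \<rho> \<eta>) differentiable_on unit_cube"
proof -
  have "(\<lambda>x. (if bs = [] then 1 else 0) + \<rho> * real N ^ length bs * signed_bumps N \<eta> (count_list bs) x)
      differentiable (at x within unit_cube)" for x
  proof (intro derivative_intros)
    show "signed_bumps N \<eta> (count_list bs) differentiable (at x within unit_cube)"
      unfolding differentiable_def
      using signed_bumps_has_derivative[of "count_list bs" N \<eta> x unit_cube] count_list_le_length[of bs] assms(2)
      by (meson order_trans)
  qed
  then show ?thesis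
    unfolding differentiable_on_def
    using iterated_partial_perturbed[of bs _ N \<rho> \<eta>] assms
    by (metis (no_types, lifting) differentiable_transform_within le_SucI zero_less_one)
qed

text \<open>One differentiation raises an order to at most \<open>Suc n\<close>, where
  \<open>\<phi>_bound\<close> still holds; the derivative has \<open>DIM('a)\<close> entries of size
  at most \<open>N B^d\<close>.\<close>

lemma signed_bumps_lipschitz:
  fixes x x' :: "'a::euclidean_space"
  assumes c: "\<And>b. b \<in> Basis \<Longrightarrow> c b \<le> n" and \<eta>: "\<And>\<kappa>. \<bar>\<eta> \<kappa>\<bar> \<le> 1"
  shows "\<bar>signed_bumps N \<eta> c x - signed_bumps N \<eta> c x'\<bar> \<le> real DIM('a) * B ^ DIM('a) * (real N * norm (x - x'))"
proof -
  have "norm (signed_bumps N \<eta> c x - signed_bumps N \<eta> c x') \<le> (real DIM('a) * (real N * B ^ DIM('a))) * norm (x - x')"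
  proof (rule differentiable_bound[OF convex_UNIV signed_bumps_has_derivative[OF c]])
    fix y :: 'a
    show "onorm (\<lambda>h. \<Sum>b\<in>Basis. (h \<bullet> b) * (real N * signed_bumps N \<eta> (c(b := Suc (c b))) y)) \<le> real DIM('a) * (real N * B ^ DIM('a))"
    proof (rule onorm_bound)
      fix h :: 'a
      have "\<bar>\<Sum>b\<in>Basis. (h \<bullet> b) * (real N * signed_bumps N \<eta> (c(b := Suc (c b))) y)\<bar> \<le>
          (\<Sum>b\<in>(Basis::'a set). norm h * (real N * B ^ DIM('a)))"
      proof (intro order_trans[OF sum_abs] sum_mono)
        fix b :: 'a assume b: "b \<in> Basis"
        have "\<bar>signed_bumps N \<eta> (c(b := Suc (c b))) y\<bar> \<le> B ^ DIM('a)"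
          by (rule signed_bumps_bound) (use c \<eta> in \<open>auto intro: le_SucI\<close>)
        then show "\<bar>(h \<bullet> b) * (real N * signed_bumps N \<eta> (c(b := Suc (c b))) y)\<bar> \<le> norm h * (real N * B ^ DIM('a))"
          unfolding abs_mult using Basis_le_norm[OF b, of h] by (intro mult_mono) auto
      qed
      then show "norm (\<Sum>b\<in>Basis. (h \<bullet> b) * (real N * signed_bumps N \<eta> (c(b := Suc (c b))) y))
          \<le> real DIM('a) * (real N * B ^ DIM('a)) * norm h"
        by (simp add: mult_ac)
    qed (use B in simp)
  qed auto
  then show ?thesis by (simp add: mult_ac)
qed

text \<open>Interpolation between the supremum bound, used for
  \<open>N * norm (x - x') \<ge> 1\<close>, and the Lipschitz bound, used otherwise: a number below
  \<open>1\<close> is at most its power with exponent \<open>\<gamma>\<close>.\<close>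

lemma signed_bumps_increment:
  fixes x x' :: "'a::euclidean_space"
  assumes c: "\<And>b. b \<in> Basis \<Longrightarrow> c b \<le> n" and \<eta>: "\<And>\<kappa>. \<bar>\<eta> \<kappa>\<bar> \<le> 1" and \<gamma>: "0 \<le> \<gamma>" "\<gamma> \<le> 1" and N: "N > 0"
  shows "\<bar>signed_bumps N \<eta> c x - signed_bumps N \<eta> c x'\<bar> \<le>
    2 * real DIM('a) * B ^ DIM('a) * (real N powr \<gamma> * norm (x - x') powr \<gamma>)"
proof (cases "x = x'")
  case False
  let ?A = "B ^ DIM('a)" and ?t = "real N * norm (x - x')"
  have A: "?A \<ge> 0" using B by simp
  have d: "1 \<le> real DIM('a)" using DIM_positive[where 'a = 'a] by linarith
  have t: "?t > 0" using N False by simp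
  have tp: "real N powr \<gamma> * norm (x - x') powr \<gamma> = ?t powr \<gamma>" by (simp add: powr_mult)
  show ?thesis
  proof (cases "?t \<ge> 1")
    case True
    have "c b \<le> Suc n" if "b \<in> Basis" for b using c[OF that] by simp
    then have "\<bar>signed_bumps N \<eta> c y\<bar> \<le> ?A" for y by (intro signed_bumps_bound \<eta>) auto
    from this[of x] this[of x'] have "\<bar>signed_bumps N \<eta> c x - signed_bumps N \<eta> c x'\<bar> \<le> 2 * 1 * ?A * 1" by simp
    also have "\<dots> \<le> 2 * real DIM('a) * ?A * (?t powr \<gamma>)"
      using A d True \<gamma> by (intro mult_mono) (auto intro: ge_one_powr_ge_zero)
    finally show ?thesis unfolding tp .
  next
    case lt: False
    have "?t = ?t powr 1" using t by simp
    also have "\<dots> \<le> ?t powr \<gamma>" using lt t \<gamma> by (intro powr_mono') auto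
    finally have "real DIM('a) * ?A * ?t \<le> (2 * real DIM('a) * ?A) * (?t powr \<gamma>)"
      using A t by (intro mult_mono) auto
    moreover have "\<bar>signed_bumps N \<eta> c x - signed_bumps N \<eta> c x'\<bar> \<le> real DIM('a) * ?A * ?t"
      by (rule signed_bumps_lipschitz[OF c \<eta>])
    ultimately show ?thesis unfolding tp by linarith
  qed
qed simp

end

text \<open>Derivatives of order \<open>k\<close> have size \<open>\<rho> N^k\<close>, and
  increments of those of order \<open>n\<close> have size
  \<open>\<rho> N^(n + \<gamma>) = \<rho> N^s\<close> with the fractional part
  \<open>\<gamma>\<close> of \<open>s\<close>. The latter scale dominates because
  \<open>N \<ge> 1\<close>; \<open>W\<close> absorbs the dimension and the number of direction
  lists.\<close>

lemma (in bump) perturbed_holder: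
  fixes s L :: real
  assumes s: "s > 0" and n: "n = nat \<lfloor>s\<rfloor>"
  obtains W where "W > 0"
    "\<And>N \<rho> L \<eta>. \<lbrakk>N > 0; \<rho> \<ge> 0; \<And>\<kappa>. \<bar>\<eta> \<kappa>\<bar> \<le> 1; \<rho> * real N powr s * W \<le> L\<rbrakk> \<Longrightarrow>
       (perturbed N \<rho> \<eta> :: 'a::euclidean_space \<Rightarrow> real) \<in> holder_class s L"
proof -
  define A where "A = 2 * real DIM('a) * B ^ DIM('a)"
  have d: "1 \<le> real DIM('a)" using DIM_positive[where 'a = 'a] by linarith
  have A0: "A > 0" using B by (simp add: A_def)
  have BA: "B ^ DIM('a) \<le> A"
  proof -
    have "1 * B ^ DIM('a) \<le> 2 * real DIM('a) * B ^ DIM('a)" using d B by (intro mult_right_mono) (linarith, simp)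
    then show ?thesis by (simp add: A_def)
  qed
  define W where "W = (\<Sum>k\<le>n. real (card (directions k :: 'a list set))) * A + 1"
  have W: "W > 0" using A0 unfolding W_def by (intro add_nonneg_pos mult_nonneg_nonneg sum_nonneg) auto
  have card_W: "real (card (directions k :: 'a list set)) * A \<le> W" if "k \<le> n" for k
  proof -
    have "real (card (directions k :: 'a list set)) \<le> (\<Sum>k\<le>n. real (card (directions k :: 'a list set)))"
      using that by (intro member_le_sum) auto
    then have "real (card (directions k :: 'a list set)) * A \<le> (\<Sum>k\<le>n. real (card (directions k :: 'a list set))) * A"
      using A0 by (intro mult_right_mono) auto
    then show ?thesis unfolding W_def by linarith
  qed
  show ?thesis
  proof (rule that[OF W])
    fix N :: nat and \<rho> L :: real and \<eta> :: "('a \<Rightarrow> nat) \<Rightarrow> real"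
    assume N: "N > 0" and \<rho>: "\<rho> \<ge> 0" and \<eta>: "\<And>\<kappa>. \<bar>\<eta> \<kappa>\<bar> \<le> 1" and small: "\<rho> * real N powr s * W \<le> L"
    let ?f = "perturbed N \<rho> \<eta> :: 'a \<Rightarrow> real"
    let ?\<gamma> = "s - of_int \<lfloor>s\<rfloor>"
    have \<gamma>: "0 \<le> ?\<gamma>" "?\<gamma> \<le> 1" by linarith+
    have ns: "real n = of_int \<lfloor>s\<rfloor>" using n s by simp
    have N1: "1 \<le> real N" using N by simp
    have dir: "set bs \<subseteq> Basis" "length bs = k" if "bs \<in> directions k" for bs :: "'a list" and k
      using that by (auto simp: directions_def)
    have top: "L2_set (\<lambda>bs. iterated_partial bs ?f x - iterated_partial bs ?f x') (directions n) \<le> L * norm (x - x') powr ?\<gamma>"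
      if x: "x \<in> unit_cube" "x' \<in> unit_cube" for x x'
    proof -
      have "L2_set (\<lambda>bs. iterated_partial bs ?f x - iterated_partial bs ?f x') (directions n)
          \<le> (\<Sum>bs\<in>directions n. \<bar>iterated_partial bs ?f x - iterated_partial bs ?f x'\<bar>)"
        by (rule L2_set_le_sum_abs)
      also have "\<dots> \<le> (\<Sum>bs\<in>(directions n :: 'a list set). \<rho> * real N ^ n * (A * (real N powr ?\<gamma> * norm (x - x') powr ?\<gamma>)))"
      proof (rule sum_mono)
        fix bs :: "'a list" assume bs: "bs \<in> directions n"
        have "iterated_partial bs ?f x - iterated_partial bs ?f x' =
            \<rho> * real N ^ n * (signed_bumps N \<eta> (count_list bs) x - signed_bumps N \<eta> (count_list bs) x')"
          using iterated_partial_perturbed[of bs x N \<rho> \<eta>] iterated_partial_perturbed[of bs x' N \<rho> \<eta>] dir[OF bs] x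
          by (simp add: right_diff_distrib)
        then have "\<bar>iterated_partial bs ?f x - iterated_partial bs ?f x'\<bar> =
            \<rho> * real N ^ n * \<bar>signed_bumps N \<eta> (count_list bs) x - signed_bumps N \<eta> (count_list bs) x'\<bar>"
          using \<rho> by (simp add: abs_mult)
        also have "\<dots> \<le> \<rho> * real N ^ n * (A * (real N powr ?\<gamma> * norm (x - x') powr ?\<gamma>))"
        proof (rule mult_left_mono)
          show "\<bar>signed_bumps N \<eta> (count_list bs) x - signed_bumps N \<eta> (count_list bs) x'\<bar> \<le>
              A * (real N powr ?\<gamma> * norm (x - x') powr ?\<gamma>)"
            unfolding A_def
            by (rule signed_bumps_increment) (use count_list_le_length[of bs] dir[OF bs] \<eta> \<gamma> N in auto)
        qed (use \<rho> in simp)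
        finally show "\<bar>iterated_partial bs ?f x - iterated_partial bs ?f x'\<bar> \<le>
            \<rho> * real N ^ n * (A * (real N powr ?\<gamma> * norm (x - x') powr ?\<gamma>))" .
      qed
      also have "\<dots> = (\<rho> * (real N ^ n * real N powr ?\<gamma>)) * (real (card (directions n :: 'a list set)) * A) * norm (x - x') powr ?\<gamma>"
        by (simp add: mult_ac)
      also have "real N ^ n * real N powr ?\<gamma> = real N powr s"
        using N by (simp add: powr_realpow[symmetric] powr_add[symmetric] ns)
      also have "(\<rho> * real N powr s) * (real (card (directions n :: 'a list set)) * A) * norm (x - x') powr ?\<gamma>
          \<le> (\<rho> * real N powr s) * W * norm (x - x') powr ?\<gamma>"
        using \<rho> card_W[of n] by (intro mult_right_mono mult_left_mono) auto
      also have "\<dots> \<le> L * norm (x - x') powr ?\<gamma>" using small by (intro mult_right_mono) auto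
      finally show ?thesis .
    qed
    have mid: "L2_set (\<lambda>bs. iterated_partial bs ?f x) (directions k) \<le> L" if k: "1 \<le> k" "k \<le> n" and x: "x \<in> unit_cube" for k x
    proof -
      have "L2_set (\<lambda>bs. iterated_partial bs ?f x) (directions k) \<le> (\<Sum>bs\<in>directions k. \<bar>iterated_partial bs ?f x\<bar>)"
        by (rule L2_set_le_sum_abs)
      also have "\<dots> \<le> (\<Sum>bs\<in>(directions k :: 'a list set). \<rho> * real N powr s * A)"
      proof (rule sum_mono)
        fix bs :: "'a list" assume bs: "bs \<in> directions k"
        have ne: "bs \<noteq> []" using dir[OF bs] k by auto
        have "\<bar>iterated_partial bs ?f x\<bar> = \<rho> * real N ^ k * \<bar>signed_bumps N \<eta> (count_list bs) x\<bar>"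
          using iterated_partial_perturbed[of bs x N \<rho> \<eta>] dir[OF bs] x k ne \<rho> by (simp add: abs_mult)
        also have "\<dots> \<le> \<rho> * real N powr s * A"
        proof (intro mult_mono mult_left_mono)
          have "real N ^ k = real N powr real k" using N by (simp add: powr_realpow)
          also have "\<dots> \<le> real N powr s" using N1 k ns by (intro powr_mono) linarith+
          finally show "real N ^ k \<le> real N powr s" .
          have "count_list bs b \<le> Suc n" for b using count_list_le_length[of bs b] dir[OF bs] k by simp
          then show "\<bar>signed_bumps N \<eta> (count_list bs) x\<bar> \<le> A"
            by (intro order_trans[OF signed_bumps_bound BA] \<eta>) auto
        qed (use \<rho> in auto)
        finally show "\<bar>iterated_partial bs ?f x\<bar> \<le> \<rho> * real N powr s * A" .
      qed
      also have "\<dots> = (\<rho> * real N powr s) * (real (card (directions k :: 'a list set)) * A)" by simp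
      also have "\<dots> \<le> (\<rho> * real N powr s) * W" using \<rho> card_W[OF k(2)] by (intro mult_left_mono) auto
      also have "\<dots> \<le> L" using small .
      finally show ?thesis .
    qed
    have "times_differentiable n ?f"
      unfolding times_differentiable_def using iterated_partial_perturbed_differentiable dir by fastforce
    then show "?f \<in> holder_class s L"
      unfolding holder_class_def using top mid by (auto simp: n[symmetric])
  qed
qed


section \<open>The lower bound\<close>

text \<open>The likelihood of an i.i.d. sample with respect to \<open>U\<close>. The two measures
  are compared on rectangles, where both are products.\<close>

lemma PiM_density:
  fixes f :: "'a \<Rightarrow> real"
  assumes U: "prob_space U" and P: "prob_space (density U (\<lambda>x. ennreal (f x)))"
    and f[measurable]: "f \<in> borel_measurable U" and nonneg: "\<And>x. x \<in> space U \<Longrightarrow> 0 \<le> f x" and I: "finite I"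
  shows "(\<Pi>\<^sub>M i\<in>I. density U (\<lambda>x. ennreal (f x))) =
    density (\<Pi>\<^sub>M i\<in>I. U) (\<lambda>\<omega>. ennreal (\<Prod>i\<in>I. f (\<omega> i)))"
proof -
  let ?P = "density U (\<lambda>x. ennreal (f x))"
  interpret U: prob_space U by fact
  interpret P: prob_space ?P by fact
  interpret UU: product_prob_space "\<lambda>_. U" I by standard
  interpret PP: product_prob_space "\<lambda>_. ?P" I by standard
  have sets: "sets (\<Pi>\<^sub>M i\<in>I. U) = sets (\<Pi>\<^sub>M i\<in>I. ?P)" by (intro sets_PiM_cong) auto
  have [measurable]: "(\<lambda>\<omega>. \<Prod>i\<in>I. f (\<omega> i)) \<in> borel_measurable (\<Pi>\<^sub>M i\<in>I. U)" by measurable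
  show ?thesis
  proof (rule PP.PiM_eqI[OF I, symmetric])
    fix A assume "\<And>i. i \<in> I \<Longrightarrow> A i \<in> sets ?P"
    then have A[measurable]: "\<And>i. i \<in> I \<Longrightarrow> A i \<in> sets U" by simp
    have PA: "Pi\<^sub>E I A \<in> sets (\<Pi>\<^sub>M i\<in>I. U)" using A I by (intro sets_PiM_I_finite) auto
    have "emeasure (density (\<Pi>\<^sub>M i\<in>I. U) (\<lambda>\<omega>. ennreal (\<Prod>i\<in>I. f (\<omega> i)))) (Pi\<^sub>E I A) =
        (\<integral>\<^sup>+\<omega>. ennreal (\<Prod>i\<in>I. f (\<omega> i)) * indicator (Pi\<^sub>E I A) \<omega> \<partial>(\<Pi>\<^sub>M i\<in>I. U))"
      using PA by (intro emeasure_density) auto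
    also have "\<dots> = (\<integral>\<^sup>+\<omega>. (\<Prod>i\<in>I. ennreal (f (\<omega> i)) * indicator (A i) (\<omega> i)) \<partial>(\<Pi>\<^sub>M i\<in>I. U))"
    proof (rule nn_integral_cong)
      fix \<omega> assume \<omega>: "\<omega> \<in> space (\<Pi>\<^sub>M i\<in>I. U)"
      then have "\<And>i. i \<in> I \<Longrightarrow> 0 \<le> f (\<omega> i)" using nonneg by (auto simp: space_PiM)
      then have 1: "ennreal (\<Prod>i\<in>I. f (\<omega> i)) = (\<Prod>i\<in>I. ennreal (f (\<omega> i)))" by (rule prod_ennreal[symmetric])
      have 2: "indicator (Pi\<^sub>E I A) \<omega> = (\<Prod>i\<in>I. indicator (A i) (\<omega> i) :: ennreal)"
      proof (cases "\<forall>i\<in>I. \<omega> i \<in> A i")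
        case True
        then have "\<omega> \<in> Pi\<^sub>E I A" using \<omega> by (auto simp: space_PiM)
        then show ?thesis using True by simp
      next
        case False
        then have "\<omega> \<notin> Pi\<^sub>E I A" by auto
        moreover obtain i where "i \<in> I" "\<omega> i \<notin> A i" using False by auto
        then have "(\<Prod>i\<in>I. indicator (A i) (\<omega> i) :: ennreal) = 0"
          by (intro prod_zero[OF I] bexI[of _ i]) auto
        ultimately show ?thesis by simp
      qed
      show "ennreal (\<Prod>i\<in>I. f (\<omega> i)) * indicator (Pi\<^sub>E I A) \<omega> = (\<Prod>i\<in>I. ennreal (f (\<omega> i)) * indicator (A i) (\<omega> i))"
        unfolding 1 2 prod.distrib ..
    qed
    also have "\<dots> = (\<Prod>i\<in>I. \<integral>\<^sup>+x. ennreal (f x) * indicator (A i) x \<partial>U)"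
      using I A by (intro UU.product_nn_integral_prod) auto
    also have "\<dots> = (\<Prod>i\<in>I. emeasure ?P (A i))" using A by (intro prod.cong refl emeasure_density[symmetric]) auto
    finally show "emeasure (density (\<Pi>\<^sub>M i\<in>I. U) (\<lambda>\<omega>. ennreal (\<Prod>i\<in>I. f (\<omega> i)))) (Pi\<^sub>E I A) = (\<Prod>i\<in>I. emeasure ?P (A i))" .
  qed (simp add: sets)
qed

section \<open>Integrals, marginals and inner products of perturbed densities\<close>

context bump
begin

abbreviation "bump0 N \<kappa> \<equiv> cell_bump N (\<lambda>_. 0) \<kappa>"

lemma \<phi>0_continuous: "continuous_on UNIV (\<phi> 0)"
  by (intro continuous_at_imp_continuous_on ballI DERIV_isCont[OF \<phi>_derivative]) simp

lemma \<phi>0_measurable[measurable]: "\<phi> 0 \<in> borel_measurable borel"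
  using \<phi>0_continuous by (rule borel_measurable_continuous_onI)

lemma \<phi>0_integrable: "integrable lborel (\<phi> 0)" "integrable lborel (\<lambda>t. (\<phi> 0 t)\<^sup>2)"
proof -
  have dom: "integrable lborel (\<lambda>t::real. indicator {0..1} t * (c::real))" for c
    by (intro integrable_mult_left integrable_real_indicator) auto
  have out: "\<phi> 0 t = 0" if "t \<notin> {0..1}" for t using that by (intro \<phi>_support) auto
  show "integrable lborel (\<phi> 0)"
  proof (rule Bochner_Integration.integrable_bound[OF dom[of B]])
    show "AE t in lborel. norm (\<phi> 0 t) \<le> norm (indicator {0..1} t * B)"
    proof (rule AE_I2)
      fix t show "norm (\<phi> 0 t) \<le> norm (indicator {0..1} t * B)"
        using \<phi>_bound[of 0 t] out[of t] B by (cases "t \<in> {0..1}") simp_all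
    qed
  qed simp
  show "integrable lborel (\<lambda>t. (\<phi> 0 t)\<^sup>2)"
  proof (rule Bochner_Integration.integrable_bound[OF dom[of "B\<^sup>2"]])
    show "AE t in lborel. norm ((\<phi> 0 t)\<^sup>2) \<le> norm (indicator {0..1} t * B\<^sup>2)"
    proof (rule AE_I2)
      fix t show "norm ((\<phi> 0 t)\<^sup>2) \<le> norm (indicator {0..1} t * B\<^sup>2)"
        using power_mono[OF \<phi>_bound[of 0 t] abs_ge_zero, of 2] out[of t] by (cases "t \<in> {0..1}") simp_all
    qed
  qed simp
qed

lemma affine_integral:
  fixes g :: "real \<Rightarrow> real"
  assumes "N > 0"
  shows "(\<integral>u. g (real N * u - c) \<partial>lborel) = (\<integral>t. g t \<partial>lborel) / real N"
  using lborel_integral_real_affine[of "real N" g "- c"] assms by simp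

lemma affine_integrable:
  fixes g :: "real \<Rightarrow> real"
  assumes "N > 0" "integrable lborel g"
  shows "integrable lborel (\<lambda>u. g (real N * u - c))"
  using lborel_integrable_real_affine[of g "real N" "- c"] assms by simp

text \<open>The squared L2 norm of the product bump on a cell of side \<open>1\<close> in dimension
  \<open>d\<close>; on a cell of side \<open>1 / N\<close> it becomes
  \<open>v d / N^d\<close>.\<close>

definition v :: "nat \<Rightarrow> real" where "v d = (\<integral>t. (\<phi> 0 t)\<^sup>2 \<partial>lborel) ^ d"

lemma v_pos: "v d > 0"
  unfolding v_def using \<phi>_square by simp

lemma bump0_outside:
  assumes "\<kappa> \<in> grid N" "x \<notin> unit_cube" "N > 0"
  shows "bump0 N \<kappa> x = 0"
proof (rule ccontr)
  assume nz: "bump0 N \<kappa> x \<noteq> 0"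
  have "0 \<le> x \<bullet> b \<and> x \<bullet> b \<le> 1" if b: "b \<in> Basis" for b
  proof -
    have "\<phi> 0 (real N * (x \<bullet> b) - real (\<kappa> b)) \<noteq> 0" using nz b by (auto simp: cell_bump_def)
    then have "real N * (x \<bullet> b) - real (\<kappa> b) \<in> {0<..<1}" using \<phi>_support by blast
    moreover have "\<kappa> b < N" using assms(1) b by auto
    then have "real (\<kappa> b) + 1 \<le> real N" by linarith
    moreover have "0 \<le> real (\<kappa> b)" by simp
    ultimately have le: "real N * 0 \<le> real N * (x \<bullet> b)" "real N * (x \<bullet> b) \<le> real N * 1"
      unfolding greaterThanLessThan_iff mult_zero_right mult_1_right by linarith+
    have "0 < real N" using assms(3) by simp
    then show ?thesis
      using mult_left_le_imp_le[OF le(1)] mult_left_le_imp_le[OF le(2)] by blast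
  qed
  then show False using assms(2) by (simp add: mem_box)
qed

lemma
  fixes \<kappa> :: "'a::euclidean_space \<Rightarrow> nat"
  assumes N: "N > 0" and k: "\<kappa> \<in> grid N"
  shows bump0_integrable: "integrable cube_lebesgue (bump0 N \<kappa>)"
    and bump0_mean: "(\<integral>x. bump0 N \<kappa> x \<partial>cube_lebesgue) = 0"
    and bump0_square_integrable: "integrable cube_lebesgue (\<lambda>x. (bump0 N \<kappa> x)\<^sup>2)"
    and bump0_square: "(\<integral>x. (bump0 N \<kappa> x)\<^sup>2 \<partial>cube_lebesgue) = v DIM('a) / real N ^ DIM('a)"
proof -
  let ?g = "\<lambda>b u. \<phi> 0 (real N * u - real (\<kappa> b))"
  have eq: "indicator unit_cube x * bump0 N \<kappa> x = (\<Prod>b\<in>Basis. ?g b (x \<bullet> b))" for x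
    using bump0_outside[OF k _ N, of x] unfolding cell_bump_def by (cases "x \<in> unit_cube") auto
  have eq2: "indicator unit_cube x * (bump0 N \<kappa> x)\<^sup>2 = (\<Prod>b\<in>Basis. (?g b (x \<bullet> b))\<^sup>2)" for x
    using bump0_outside[OF k _ N, of x] unfolding cell_bump_def prod_power_distrib[symmetric]
    by (cases "x \<in> unit_cube") auto
  have int: "integrable lborel (?g b)" for b by (rule affine_integrable[OF N \<phi>0_integrable(1)])
  have int2: "integrable lborel (\<lambda>u. (?g b u)\<^sup>2)" for b by (rule affine_integrable[OF N \<phi>0_integrable(2)])
  show "integrable cube_lebesgue (bump0 N \<kappa>)"
    unfolding integrable_cube_lebesgue eq by (rule integrable_prod_lborel[OF int])
  show "integrable cube_lebesgue (\<lambda>x. (bump0 N \<kappa> x)\<^sup>2)"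
    unfolding integrable_cube_lebesgue eq2 by (rule integrable_prod_lborel[OF int2])
  show "(\<integral>x. bump0 N \<kappa> x \<partial>cube_lebesgue) = 0"
    unfolding integral_cube_lebesgue eq integral_prod_lborel[OF int] affine_integral[OF N] \<phi>_mean
    by (simp add: zero_power)
  show "(\<integral>x. (bump0 N \<kappa> x)\<^sup>2 \<partial>cube_lebesgue) = v DIM('a) / real N ^ DIM('a)"
    unfolding integral_cube_lebesgue eq2 integral_prod_lborel[OF int2]
      affine_integral[OF N, of "\<lambda>t. (\<phi> 0 t)\<^sup>2"]
    by (simp add: v_def power_divide)
qed

lemma bump0_mult:
  assumes "\<kappa> \<in> grid N" "\<kappa>' \<in> grid N"
  shows "bump0 N \<kappa> x * bump0 N \<kappa>' x = (if \<kappa> = \<kappa>' then (bump0 N \<kappa> x)\<^sup>2 else 0)"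
  using cell_bump_nonzero_unique[OF assms, of "\<lambda>_. 0" x "\<lambda>_. 0"] by (auto simp: power2_eq_square)

text \<open>Each bump splits into one bump per component. Both factors have mean zero, so
  integrating out either component annihilates the bump; this keeps the marginals uniform.\<close>

lemma bump0_prod:
  fixes \<kappa> :: "'a::euclidean_space \<times> 'b::euclidean_space \<Rightarrow> nat"
  shows "bump0 N \<kappa> x = bump0 N (\<lambda>b. \<kappa> (b, 0)) (fst x) * bump0 N (\<lambda>b. \<kappa> (0, b)) (snd x)"
proof -
  let ?h = "\<lambda>b. \<phi> 0 (real N * (x \<bullet> b) - real (\<kappa> b))"
  have "bump0 N \<kappa> x = prod ?h ((\<lambda>u. (u, 0)) ` Basis \<union> (\<lambda>v. (0, v)) ` Basis)"
    unfolding cell_bump_def Basis_prod_def ..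
  also have "\<dots> = prod ?h ((\<lambda>u. (u, 0)) ` Basis) * prod ?h ((\<lambda>v. (0, v)) ` Basis)"
    by (rule prod.union_disjoint) auto
  also have "prod ?h ((\<lambda>u. (u, 0)) ` Basis) = bump0 N (\<lambda>b. \<kappa> (b, 0)) (fst x)"
    unfolding cell_bump_def by (subst prod.reindex) (auto simp: inj_on_def inner_prod_def intro!: prod.cong)
  also have "prod ?h ((\<lambda>v. (0, v)) ` Basis) = bump0 N (\<lambda>b. \<kappa> (0, b)) (snd x)"
    unfolding cell_bump_def by (subst prod.reindex) (auto simp: inj_on_def inner_prod_def intro!: prod.cong)
  finally show ?thesis .
qed

lemma grid_components:
  fixes \<kappa> :: "'a::euclidean_space \<times> 'b::euclidean_space \<Rightarrow> nat"
  assumes "\<kappa> \<in> grid N"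
  shows "(\<lambda>b\<in>Basis. \<kappa> (b, 0)) \<in> grid N" "(\<lambda>b\<in>Basis. \<kappa> (0, b)) \<in> grid N"
  using assms by (auto simp: PiE_def Pi_def Basis_prod_def)

lemma bump0_restrict: "bump0 N (restrict \<kappa> Basis) = bump0 N \<kappa>"
  by (auto simp: cell_bump_def intro!: prod.cong)

lemma perturbed_eq:
  "perturbed N \<rho> \<eta> x = 1 + (\<Sum>\<kappa>\<in>grid N. \<rho> * \<eta> \<kappa> * bump0 N \<kappa> x)"
  unfolding perturbed_def signed_bumps_def by (simp add: sum_distrib_left mult.assoc)

lemma perturbed_measurable[measurable]: "perturbed N \<rho> \<eta> \<in> borel_measurable (borel :: 'a::euclidean_space measure)"
proof -
  have "continuous_on UNIV (signed_bumps N \<eta> (\<lambda>_. 0) :: 'a \<Rightarrow> real)"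
    by (intro has_derivative_continuous_on[OF signed_bumps_has_derivative]) simp
  then have "signed_bumps N \<eta> (\<lambda>_. 0) \<in> borel_measurable (borel :: 'a measure)"
    by (rule borel_measurable_continuous_onI)
  then show ?thesis unfolding perturbed_def[abs_def] by simp
qed

lemma perturbed_bounds:
  fixes x :: "'a::euclidean_space"
  assumes \<eta>: "\<And>\<kappa>. \<bar>\<eta> \<kappa>\<bar> \<le> 1" and \<rho>: "0 \<le> \<rho>" "\<rho> * B ^ DIM('a) \<le> 1"
  shows "0 \<le> perturbed N \<rho> \<eta> x" "perturbed N \<rho> \<eta> x \<le> 2"
proof -
  have "\<bar>signed_bumps N \<eta> (\<lambda>_. 0) x\<bar> \<le> B ^ DIM('a)" by (rule signed_bumps_bound) (use \<eta> in auto)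
  then have "\<bar>\<rho> * signed_bumps N \<eta> (\<lambda>_. 0) x\<bar> \<le> \<rho> * B ^ DIM('a)"
    using \<rho>(1) by (simp add: abs_mult mult_left_mono)
  then show "0 \<le> perturbed N \<rho> \<eta> x" "perturbed N \<rho> \<eta> x \<le> 2"
    using \<rho>(2) unfolding perturbed_def by linarith+
qed

text \<open>If one of the sets contains the cube, the corresponding factor of every bump is
  integrated over its whole support and gives zero, so only the constant \<open>1\<close>
  contributes.\<close>

lemma perturbed_marginal_integral:
  fixes A :: "'a::euclidean_space set" and C :: "'b::euclidean_space set"
  assumes N: "N > 0" and A: "A \<in> sets borel" and C: "C \<in> sets borel"
    and trivial: "unit_cube \<subseteq> A \<or> unit_cube \<subseteq> C"
  shows "(\<integral>x. perturbed N \<rho> \<eta> x * (indicator A (fst x) * indicator C (snd x)) \<partial>cube_lebesgue) =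
    (\<integral>x. indicator A x \<partial>cube_lebesgue) * (\<integral>x. indicator C x \<partial>cube_lebesgue)"
proof -
  interpret UA: prob_space "cube_lebesgue :: 'a measure" by (rule prob_space_cube_lebesgue)
  interpret UC: prob_space "cube_lebesgue :: 'b measure" by (rule prob_space_cube_lebesgue)
  let ?iA = "indicator A :: 'a \<Rightarrow> real" and ?iC = "indicator C :: 'b \<Rightarrow> real"
  let ?f1 = "\<lambda>\<kappa>::'a \<times> 'b \<Rightarrow> nat. bump0 N (\<lambda>b. \<kappa> (b, 0))" and ?f2 = "\<lambda>\<kappa>::'a \<times> 'b \<Rightarrow> nat. bump0 N (\<lambda>b. \<kappa> (0, b))"
  have iA: "integrable cube_lebesgue ?iA" and iC: "integrable cube_lebesgue ?iC"
    using integrable_cube_lebesgue_indicator[OF A UA.integrable_const[of 1]]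
      integrable_cube_lebesgue_indicator[OF C UC.integrable_const[of 1]] by simp_all
  have b1: "integrable cube_lebesgue (?f1 \<kappa>)" "(\<integral>x. ?f1 \<kappa> x \<partial>cube_lebesgue) = 0" if "\<kappa> \<in> grid N" for \<kappa>
    using bump0_integrable[OF N grid_components(1)[OF that]] bump0_mean[OF N grid_components(1)[OF that]]
    by (simp_all add: bump0_restrict)
  have b2: "integrable cube_lebesgue (?f2 \<kappa>)" "(\<integral>x. ?f2 \<kappa> x \<partial>cube_lebesgue) = 0" if "\<kappa> \<in> grid N" for \<kappa>
    using bump0_integrable[OF N grid_components(2)[OF that]] bump0_mean[OF N grid_components(2)[OF that]]
    by (simp_all add: bump0_restrict)
  have t1: "integrable cube_lebesgue (\<lambda>x. ?f1 \<kappa> x * ?iA x)" and t2: "integrable cube_lebesgue (\<lambda>x. ?f2 \<kappa> x * ?iC x)"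
    if "\<kappa> \<in> grid N" for \<kappa>
    using integrable_cube_lebesgue_indicator[OF A b1(1)[OF that]] integrable_cube_lebesgue_indicator[OF C b2(1)[OF that]] by auto
  have zero: "(\<integral>x. ?f1 \<kappa> x * ?iA x \<partial>cube_lebesgue) * (\<integral>x. ?f2 \<kappa> x * ?iC x \<partial>cube_lebesgue) = 0" if k: "\<kappa> \<in> grid N" for \<kappa>
    using trivial
  proof
    assume "unit_cube \<subseteq> A"
    then have "(\<integral>x. ?f1 \<kappa> x * ?iA x \<partial>cube_lebesgue) = (\<integral>x. ?f1 \<kappa> x \<partial>cube_lebesgue)"
      by (intro Bochner_Integration.integral_cong) (auto simp: indicator_def)
    then show ?thesis using b1(2)[OF k] by simp
  next
    assume "unit_cube \<subseteq> C"
    then have "(\<integral>x. ?f2 \<kappa> x * ?iC x \<partial>cube_lebesgue) = (\<integral>x. ?f2 \<kappa> x \<partial>cube_lebesgue)"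
      by (intro Bochner_Integration.integral_cong) (auto simp: indicator_def)
    then show ?thesis using b2(2)[OF k] by simp
  qed
  have eq: "perturbed N \<rho> \<eta> x * (?iA (fst x) * ?iC (snd x)) = ?iA (fst x) * ?iC (snd x) +
      (\<Sum>\<kappa>\<in>grid N. \<rho> * \<eta> \<kappa> * ((?f1 \<kappa> (fst x) * ?iA (fst x)) * (?f2 \<kappa> (snd x) * ?iC (snd x))))" for x
    unfolding perturbed_eq bump0_prod[of N _ x] distrib_right sum_distrib_right by (simp add: mult_ac)
  have int: "integrable cube_lebesgue (\<lambda>x. \<rho> * \<eta> \<kappa> * ((?f1 \<kappa> (fst x) * ?iA (fst x)) * (?f2 \<kappa> (snd x) * ?iC (snd x))))"
    if "\<kappa> \<in> grid N" for \<kappa>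
    by (intro integrable_mult_right integrable_cube_lebesgue_times[OF t1[OF that] t2[OF that]])
  have "(\<integral>x. perturbed N \<rho> \<eta> x * (?iA (fst x) * ?iC (snd x)) \<partial>cube_lebesgue) =
      (\<integral>x. ?iA (fst x) * ?iC (snd x) \<partial>cube_lebesgue) +
      (\<Sum>\<kappa>\<in>grid N. \<integral>x. \<rho> * \<eta> \<kappa> * ((?f1 \<kappa> (fst x) * ?iA (fst x)) * (?f2 \<kappa> (snd x) * ?iC (snd x))) \<partial>cube_lebesgue)"
    unfolding eq using int integrable_cube_lebesgue_times[OF iA iC]
    by (subst Bochner_Integration.integral_add) (auto intro!: Bochner_Integration.integral_sum Bochner_Integration.integrable_sum)
  also have "(\<Sum>\<kappa>\<in>grid N. \<integral>x. \<rho> * \<eta> \<kappa> * ((?f1 \<kappa> (fst x) * ?iA (fst x)) * (?f2 \<kappa> (snd x) * ?iC (snd x))) \<partial>cube_lebesgue) = 0"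
  proof (intro sum.neutral ballI)
    fix \<kappa> :: "'a \<times> 'b \<Rightarrow> nat" assume k: "\<kappa> \<in> grid N"
    show "(\<integral>x. \<rho> * \<eta> \<kappa> * ((?f1 \<kappa> (fst x) * ?iA (fst x)) * (?f2 \<kappa> (snd x) * ?iC (snd x))) \<partial>cube_lebesgue) = 0"
      using zero[OF k] by (simp only: integral_mult_right_zero integral_cube_lebesgue_times[OF t1[OF k] t2[OF k]] mult_zero_right)
  qed
  finally show ?thesis unfolding integral_cube_lebesgue_times[OF iA iC] by simp
qed

end

lemma sets_cube_lebesgue_D:
  "A \<in> sets (cube_lebesgue :: 'a::euclidean_space measure) \<Longrightarrow> A \<in> sets borel \<and> A \<inter> unit_cube = A"
  unfolding cube_lebesgue_def by (auto simp: sets_restrict_space_iff)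

lemma lebesgue_density_cube_lebesgue: "lebesgue_density cube_lebesgue (\<lambda>_. 1)"
  by (simp add: lebesgue_density_def density_1)

context bump
begin

text \<open>Rectangles with one trivial side determine the two marginals; with both sides trivial,
  the total mass is obtained.\<close>

lemma perturbed_emeasure:
  fixes A :: "'a::euclidean_space set" and C :: "'b::euclidean_space set"
  assumes N: "N > 0" and A: "A \<in> sets borel" and C: "C \<in> sets borel"
    and trivial: "unit_cube \<subseteq> A \<or> unit_cube \<subseteq> C"
    and \<eta>: "\<And>\<kappa>. \<bar>\<eta> \<kappa>\<bar> \<le> 1" and \<rho>: "0 \<le> \<rho>" "\<rho> * B ^ DIM('a \<times> 'b) \<le> 1"
  shows "emeasure (density cube_lebesgue (\<lambda>x. ennreal (perturbed N \<rho> \<eta> x))) (A \<times> C \<inter> unit_cube) =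
    emeasure cube_lebesgue (A \<inter> unit_cube) * emeasure cube_lebesgue (C \<inter> unit_cube)"
proof -
  let ?f = "perturbed N \<rho> \<eta> :: 'a \<times> 'b \<Rightarrow> real"
  let ?U = "cube_lebesgue :: ('a \<times> 'b) measure"
  interpret U: prob_space ?U by (rule prob_space_cube_lebesgue)
  interpret UA: prob_space "cube_lebesgue :: 'a measure" by (rule prob_space_cube_lebesgue)
  interpret UC: prob_space "cube_lebesgue :: 'b measure" by (rule prob_space_cube_lebesgue)
  have f_meas: "?f \<in> borel_measurable ?U" by (intro borel_measurable_cube_lebesgue perturbed_measurable)
  have AC: "A \<times> C \<in> sets (borel :: ('a \<times> 'b) measure)" using A C by (rule borel_Times)
  have set: "A \<times> C \<inter> unit_cube \<in> sets ?U"
    unfolding cube_lebesgue_def using AC by (auto simp: sets_restrict_space)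
  let ?g = "\<lambda>x. ?f x * (indicator A (fst x) * indicator C (snd x))"
  have g_meas: "?g \<in> borel_measurable ?U"
  proof -
    have "(indicator (A \<times> C) :: 'a \<times> 'b \<Rightarrow> real) \<in> borel_measurable ?U"
      using AC by (intro borel_measurable_cube_lebesgue borel_measurable_indicator)
    moreover have "indicator A (fst x) * indicator C (snd x) = (indicator (A \<times> C) x :: real)" for x
      by (cases x) (auto simp: indicator_def)
    ultimately show ?thesis using f_meas by simp
  qed
  have "emeasure (density ?U (\<lambda>x. ennreal (?f x))) (A \<times> C \<inter> unit_cube) = (\<integral>\<^sup>+x. ennreal (?f x) * indicator (A \<times> C \<inter> unit_cube) x \<partial>?U)"
    using set f_meas by (intro emeasure_density) auto
  also have "\<dots> = (\<integral>\<^sup>+x. ennreal (?g x) \<partial>?U)"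
    by (intro nn_integral_cong) (auto simp: indicator_def)
  also have "\<dots> = ennreal (\<integral>x. ?g x \<partial>?U)"
  proof (rule nn_integral_eq_integral)
    have "\<bar>?g x\<bar> \<le> 2" for x
      using perturbed_bounds[OF \<eta> \<rho>, where N = N and x = x] by (auto simp: indicator_def)
    then show "integrable ?U ?g" by (intro U.integrable_const_bound[where B = 2]) (use g_meas in auto)
    show "AE x in ?U. 0 \<le> ?g x" using perturbed_bounds(1)[OF \<eta> \<rho>] by (intro AE_I2) auto
  qed
  also have "(\<integral>x. ?g x \<partial>?U) = (\<integral>x. indicator A x \<partial>cube_lebesgue) * (\<integral>x. indicator C x \<partial>cube_lebesgue)"
    by (rule perturbed_marginal_integral[OF N A C trivial])
  also have "\<dots> = UA.prob (A \<inter> unit_cube) * UC.prob (C \<inter> unit_cube)" by simp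
  also have "ennreal \<dots> = emeasure cube_lebesgue (A \<inter> unit_cube) * emeasure cube_lebesgue (C \<inter> unit_cube)"
    by (simp add: ennreal_mult UA.emeasure_eq_measure UC.emeasure_eq_measure)
  finally show ?thesis .
qed

lemma perturbed_holder_model:
  fixes s L :: real
  assumes N: "N > 0" and \<eta>: "\<And>\<kappa>. \<bar>\<eta> \<kappa>\<bar> \<le> 1" and \<rho>: "0 \<le> \<rho>" "\<rho> * B ^ DIM('a::euclidean_space \<times> 'b::euclidean_space) \<le> 1"
    and holder: "perturbed N \<rho> \<eta> \<in> holder_class s L" "(\<lambda>_. 1) \<in> (holder_class s L :: ('a \<times> 'b \<Rightarrow> real) set)"
  shows "holder_model s L (density cube_lebesgue (\<lambda>x. ennreal (perturbed N \<rho> \<eta> x)))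
    (perturbed N \<rho> \<eta> :: 'a \<times> 'b \<Rightarrow> real) (\<lambda>_. 1) (\<lambda>_. 1)"
proof -
  let ?f = "perturbed N \<rho> \<eta> :: 'a \<times> 'b \<Rightarrow> real"
  let ?P = "density cube_lebesgue (\<lambda>x. ennreal (?f x))"
  note rect = perturbed_emeasure[where 'a = 'a and 'b = 'b, OF N _ _ _ \<eta> \<rho>]
  have P_fst: "fst \<in> ?P \<rightarrow>\<^sub>M cube_lebesgue" and P_snd: "snd \<in> ?P \<rightarrow>\<^sub>M cube_lebesgue"
    using measurable_cube_lebesgue_fst measurable_cube_lebesgue_snd by auto
  have fst: "distr ?P cube_lebesgue fst = cube_lebesgue"
  proof (rule measure_eqI)
    fix A assume "A \<in> sets (distr ?P cube_lebesgue fst)"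
    then have A: "A \<in> sets cube_lebesgue" by simp
    have "emeasure (distr ?P cube_lebesgue fst) A = emeasure ?P (A \<times> UNIV \<inter> unit_cube)"
      unfolding emeasure_distr[OF P_fst A] by (rule arg_cong[where f = "emeasure ?P"]) auto
    also have "\<dots> = emeasure cube_lebesgue A"
      using sets_cube_lebesgue_D[OF A] by (subst rect) (auto simp: emeasure_cube_lebesgue_space)
    finally show "emeasure (distr ?P cube_lebesgue fst) A = emeasure cube_lebesgue A" .
  qed simp
  have snd: "distr ?P cube_lebesgue snd = cube_lebesgue"
  proof (rule measure_eqI)
    fix A assume "A \<in> sets (distr ?P cube_lebesgue snd)"
    then have A: "A \<in> sets cube_lebesgue" by simp
    have "emeasure (distr ?P cube_lebesgue snd) A = emeasure ?P (UNIV \<times> A \<inter> unit_cube)"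
      unfolding emeasure_distr[OF P_snd A] by (rule arg_cong[where f = "emeasure ?P"]) auto
    also have "\<dots> = emeasure cube_lebesgue A"
      using sets_cube_lebesgue_D[OF A] by (subst rect) (auto simp: emeasure_cube_lebesgue_space)
    finally show "emeasure (distr ?P cube_lebesgue snd) A = emeasure cube_lebesgue A" .
  qed simp
  have "emeasure ?P (UNIV \<times> UNIV \<inter> unit_cube) = 1"
    by (subst rect) (auto simp: emeasure_cube_lebesgue_space)
  then have "prob_space ?P" by (intro prob_spaceI) simp
  moreover have "lebesgue_density ?P ?f"
    unfolding lebesgue_density_def using perturbed_bounds(1)[OF \<eta> \<rho>]
    by (auto intro: borel_measurable_cube_lebesgue perturbed_measurable)
  moreover have "(\<lambda>(y :: 'a, z :: 'b). 1 :: real) = (\<lambda>_. 1)" by auto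
  ultimately show ?thesis
    unfolding holder_model_def fst snd using holder by (simp add: lebesgue_density_cube_lebesgue)
qed

lemma bump0_orthogonal:
  fixes \<kappa> \<kappa>' :: "'a::euclidean_space \<Rightarrow> nat"
  assumes N: "N > 0" and k: "\<kappa> \<in> grid N" "\<kappa>' \<in> grid N"
  shows "integrable cube_lebesgue (\<lambda>x. bump0 N \<kappa> x * bump0 N \<kappa>' x)"
    "(\<integral>x. bump0 N \<kappa> x * bump0 N \<kappa>' x \<partial>cube_lebesgue) = (if \<kappa> = \<kappa>' then v DIM('a) / real N ^ DIM('a) else 0)"
  unfolding bump0_mult[OF k] using bump0_square_integrable[OF N k(1)] bump0_square[OF N k(1)]
  by (cases "\<kappa> = \<kappa>'"; simp)+

lemma perturbed_inner:
  fixes \<eta> \<eta>' :: "('a::euclidean_space \<Rightarrow> nat) \<Rightarrow> real"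
  assumes N: "N > 0"
  shows "(\<integral>x. (\<Sum>\<kappa>\<in>grid N. \<rho> * \<eta> \<kappa> * bump0 N \<kappa> x) * (\<Sum>\<kappa>\<in>grid N. \<rho> * \<eta>' \<kappa> * bump0 N \<kappa> x) \<partial>cube_lebesgue) =
    \<rho>\<^sup>2 * (v DIM('a) / real N ^ DIM('a)) * (\<Sum>\<kappa>\<in>grid N. \<eta> \<kappa> * \<eta>' \<kappa>)"
    "integrable cube_lebesgue (\<lambda>x. (\<Sum>\<kappa>\<in>grid N. \<rho> * \<eta> \<kappa> * bump0 N \<kappa> x) * (\<Sum>\<kappa>\<in>grid N. \<rho> * \<eta>' \<kappa> * bump0 N \<kappa> x))"
proof -
  have eq: "(\<Sum>\<kappa>\<in>grid N. \<rho> * \<eta> \<kappa> * bump0 N \<kappa> x) * (\<Sum>\<kappa>\<in>grid N. \<rho> * \<eta>' \<kappa> * bump0 N \<kappa> x) =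
      (\<Sum>\<kappa>\<in>grid N. \<Sum>\<kappa>'\<in>grid N. \<rho>\<^sup>2 * \<eta> \<kappa> * \<eta>' \<kappa>' * (bump0 N \<kappa> x * bump0 N \<kappa>' x))" for x
    unfolding sum_product by (simp add: power2_eq_square mult_ac)
  have int: "integrable cube_lebesgue (\<lambda>x. \<rho>\<^sup>2 * \<eta> \<kappa> * \<eta>' \<kappa>' * (bump0 N \<kappa> x * bump0 N \<kappa>' x))"
    if "\<kappa> \<in> grid N" "\<kappa>' \<in> grid N" for \<kappa> \<kappa>'
    by (intro integrable_mult_right bump0_orthogonal(1)[OF N that])
  then show "integrable cube_lebesgue (\<lambda>x. (\<Sum>\<kappa>\<in>grid N. \<rho> * \<eta> \<kappa> * bump0 N \<kappa> x) * (\<Sum>\<kappa>\<in>grid N. \<rho> * \<eta>' \<kappa> * bump0 N \<kappa> x))"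
    unfolding eq by (intro Bochner_Integration.integrable_sum)
  have "(\<integral>x. (\<Sum>\<kappa>\<in>grid N. \<rho> * \<eta> \<kappa> * bump0 N \<kappa> x) * (\<Sum>\<kappa>\<in>grid N. \<rho> * \<eta>' \<kappa> * bump0 N \<kappa> x) \<partial>cube_lebesgue) =
      (\<Sum>\<kappa>\<in>grid N. \<Sum>\<kappa>'\<in>grid N. \<integral>x. \<rho>\<^sup>2 * \<eta> \<kappa> * \<eta>' \<kappa>' * (bump0 N \<kappa> x * bump0 N \<kappa>' x) \<partial>cube_lebesgue)"
    unfolding eq using int
    by (subst Bochner_Integration.integral_sum, (intro Bochner_Integration.integrable_sum; simp)?,
        intro sum.cong refl Bochner_Integration.integral_sum) auto
  also have "\<dots> = (\<Sum>\<kappa>\<in>grid N. \<Sum>\<kappa>'\<in>grid N. if \<kappa>' = \<kappa> then \<rho>\<^sup>2 * \<eta> \<kappa> * \<eta>' \<kappa> * (v DIM('a) / real N ^ DIM('a)) else 0)"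
    by (intro sum.cong refl) (auto simp: bump0_orthogonal(2)[OF N])
  also have "\<dots> = \<rho>\<^sup>2 * (v DIM('a) / real N ^ DIM('a)) * (\<Sum>\<kappa>\<in>grid N. \<eta> \<kappa> * \<eta>' \<kappa>)"
    by (simp add: finite_grid sum_distrib_left sum_divide_distrib mult_ac)
  finally show "(\<integral>x. (\<Sum>\<kappa>\<in>grid N. \<rho> * \<eta> \<kappa> * bump0 N \<kappa> x) * (\<Sum>\<kappa>\<in>grid N. \<rho> * \<eta>' \<kappa> * bump0 N \<kappa> x) \<partial>cube_lebesgue) =
    \<rho>\<^sup>2 * (v DIM('a) / real N ^ DIM('a)) * (\<Sum>\<kappa>\<in>grid N. \<eta> \<kappa> * \<eta>' \<kappa>)" .
qed

lemma perturbed_mean: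
  fixes \<eta> :: "('a::euclidean_space \<Rightarrow> nat) \<Rightarrow> real"
  assumes N: "N > 0"
  shows "integrable cube_lebesgue (\<lambda>x. \<Sum>\<kappa>\<in>grid N. \<rho> * \<eta> \<kappa> * bump0 N \<kappa> x)"
    "(\<integral>x. (\<Sum>\<kappa>\<in>grid N. \<rho> * \<eta> \<kappa> * bump0 N \<kappa> x) \<partial>cube_lebesgue) = 0"
proof -
  have int: "integrable cube_lebesgue (\<lambda>x. \<rho> * \<eta> \<kappa> * bump0 N \<kappa> x)" if "\<kappa> \<in> grid N" for \<kappa>
    by (intro integrable_mult_right bump0_integrable[OF N that])
  then show "integrable cube_lebesgue (\<lambda>x. \<Sum>\<kappa>\<in>grid N. \<rho> * \<eta> \<kappa> * bump0 N \<kappa> x)"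
    by (rule Bochner_Integration.integrable_sum)
  show "(\<integral>x. (\<Sum>\<kappa>\<in>grid N. \<rho> * \<eta> \<kappa> * bump0 N \<kappa> x) \<partial>cube_lebesgue) = 0"
    using int by (subst Bochner_Integration.integral_sum) (auto simp: bump0_mean[OF N])
qed

text \<open>Terms linear in the bumps vanish by their zero means, and among the products only those
  of a cell with itself survive. The result is the mean, under the uniform distribution, of the
  product of two likelihood ratios for one observation.\<close>

lemma perturbed_product_integral:
  fixes \<eta> \<eta>' :: "('a::euclidean_space \<Rightarrow> nat) \<Rightarrow> real"
  assumes N: "N > 0"
  shows "integrable cube_lebesgue (\<lambda>x. perturbed N \<rho> \<eta> x * perturbed N \<rho> \<eta>' x)"
    "(\<integral>x. perturbed N \<rho> \<eta> x * perturbed N \<rho> \<eta>' x \<partial>cube_lebesgue) =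
      1 + \<rho>\<^sup>2 * (v DIM('a) / real N ^ DIM('a)) * (\<Sum>\<kappa>\<in>grid N. \<eta> \<kappa> * \<eta>' \<kappa>)"
    "integrable cube_lebesgue (perturbed N \<rho> \<eta>)" "(\<integral>x. perturbed N \<rho> \<eta> x \<partial>cube_lebesgue) = 1"
proof -
  interpret prob_space "cube_lebesgue :: 'a measure" by (rule prob_space_cube_lebesgue)
  let ?g = "\<lambda>\<eta> x. \<Sum>\<kappa>\<in>grid N. \<rho> * \<eta> \<kappa> * bump0 N \<kappa> (x :: 'a)"
  have eq: "perturbed N \<rho> \<eta> x * perturbed N \<rho> \<eta>' x = ((1 + ?g \<eta> x) + ?g \<eta>' x) + ?g \<eta> x * ?g \<eta>' x" for x
    unfolding perturbed_eq by (simp add: algebra_simps)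
  have i0: "integrable cube_lebesgue (\<lambda>_::'a. 1 :: real)" by simp
  note i = i0 perturbed_mean(1)[OF N, of \<rho> \<eta>] perturbed_mean(1)[OF N, of \<rho> \<eta>'] perturbed_inner(2)[OF N, of \<rho> \<eta> \<eta>']
  note i1 = Bochner_Integration.integrable_add[OF i(1,2)]
  note i2 = Bochner_Integration.integrable_add[OF i1 i(3)]
  show "integrable cube_lebesgue (\<lambda>x. perturbed N \<rho> \<eta> x * perturbed N \<rho> \<eta>' x)"
    unfolding eq by (rule Bochner_Integration.integrable_add[OF i2 i(4)])
  show "(\<integral>x. perturbed N \<rho> \<eta> x * perturbed N \<rho> \<eta>' x \<partial>cube_lebesgue) =
      1 + \<rho>\<^sup>2 * (v DIM('a) / real N ^ DIM('a)) * (\<Sum>\<kappa>\<in>grid N. \<eta> \<kappa> * \<eta>' \<kappa>)"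
    unfolding eq Bochner_Integration.integral_add[OF i2 i(4)] Bochner_Integration.integral_add[OF i1 i(3)]
      Bochner_Integration.integral_add[OF i(1,2)] perturbed_mean(2)[OF N] perturbed_inner(1)[OF N]
    by (simp add: prob_space[unfolded space_cube_lebesgue])
  show "integrable cube_lebesgue (perturbed N \<rho> \<eta>)"
    unfolding perturbed_eq[abs_def] by (rule i1)
  show "(\<integral>x. perturbed N \<rho> \<eta> x \<partial>cube_lebesgue) = 1"
    unfolding perturbed_eq Bochner_Integration.integral_add[OF i(1,2)] perturbed_mean(2)[OF N]
    by (simp add: prob_space[unfolded space_cube_lebesgue])
qed

text \<open>All \<open>N^d\<close> cells contribute \<open>v DIM('a) / N^d\<close> irrespective of
  their signs, so the separation depends on the amplitude only.\<close>

lemma perturbed_L2_norm: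
  fixes \<eta> :: "('a::euclidean_space \<Rightarrow> nat) \<Rightarrow> real"
  assumes N: "N > 0" and \<rho>: "\<rho> \<ge> 0" and \<eta>: "\<And>\<kappa>. \<kappa> \<in> grid N \<Longrightarrow> \<bar>\<eta> \<kappa>\<bar> = 1"
  shows "L2_norm (\<lambda>x. perturbed N \<rho> \<eta> x - 1) = \<rho> * sqrt (v DIM('a))"
proof -
  have "(\<Sum>\<kappa>\<in>grid N. \<eta> \<kappa> * \<eta> \<kappa>) = (\<Sum>\<kappa>\<in>(grid N :: ('a \<Rightarrow> nat) set). 1)"
    by (intro sum.cong refl) (use \<eta> in \<open>metis abs_mult_self_eq mult_1\<close>)
  also have "\<dots> = real N ^ DIM('a)" by (simp add: card_grid)
  finally have "(\<integral>x. (perturbed N \<rho> \<eta> x - 1)\<^sup>2 \<partial>cube_lebesgue) = \<rho>\<^sup>2 * v DIM('a)"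
    using perturbed_inner(1)[OF N, of \<rho> \<eta> \<eta>] N unfolding perturbed_eq by (simp add: power2_eq_square)
  then show ?thesis using \<rho> by (simp add: L2_norm_def real_sqrt_mult)
qed

end

text \<open>Half of the left-hand side is the moment generating function of a random sign. Both
  exponentials have quadratic upper bounds, and \<open>1 + t^2 \<le> exp (t^2)\<close>
  finishes.\<close>

lemma exp_add_exp_minus_le:
  fixes t :: real
  assumes t: "0 \<le> t" "t \<le> 1"
  shows "exp t + exp (- t) \<le> 2 * exp (t\<^sup>2)"
proof -
  have "exp t \<le> 1 + t + t\<^sup>2" using exp_bound[OF t] .
  moreover have "exp (- t) \<le> 1 - t + t\<^sup>2"
  proof -
    \<comment> \<open>The product equals \<open>1 + t^3\<close>.\<close>
    have "1 \<le> (1 - t + t\<^sup>2) * (1 + t)" using t by (simp add: power2_eq_square algebra_simps)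
    also have "\<dots> \<le> (1 - t + t\<^sup>2) * exp t"
      using t exp_ge_add_one_self[of t] by (intro mult_left_mono) (auto intro: add_nonneg_nonneg)
    finally have "1 / exp t \<le> 1 - t + t\<^sup>2" by (simp add: pos_divide_le_eq)
    then show ?thesis by (simp add: exp_minus inverse_eq_divide)
  qed
  moreover have "1 + t\<^sup>2 \<le> exp (t\<^sup>2)" by (rule exp_ge_add_one_self)
  ultimately show ?thesis by linarith
qed

text \<open>The exponential factorises over the cells. For either value of
  \<open>\<eta> \<kappa>\<close>, the sum over \<open>\<eta>' \<kappa>\<close> produces both
  \<open>exp t\<close> and \<open>exp (- t)\<close>, so the inner sum is the same for every
  \<open>\<eta>\<close>.\<close>

lemma sum_sign_vectors_exp:
  fixes t :: real
  assumes G: "finite G"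
  shows "(\<Sum>\<eta>\<in>G \<rightarrow>\<^sub>E {-1, 1}. \<Sum>\<eta>'\<in>G \<rightarrow>\<^sub>E {-1, 1}. exp (t * (\<Sum>\<kappa>\<in>G. \<eta> \<kappa> * \<eta>' \<kappa>))) =
    2 ^ card G * (exp t + exp (- t)) ^ card G"
proof -
  have "(\<Sum>\<eta>'\<in>G \<rightarrow>\<^sub>E {-1, 1}. exp (t * (\<Sum>\<kappa>\<in>G. \<eta> \<kappa> * \<eta>' \<kappa>))) = (exp t + exp (- t)) ^ card G"
    if \<eta>: "\<eta> \<in> G \<rightarrow>\<^sub>E {-1, 1}" for \<eta>
  proof -
    have "(\<Sum>\<eta>'\<in>G \<rightarrow>\<^sub>E {-1, 1}. exp (t * (\<Sum>\<kappa>\<in>G. \<eta> \<kappa> * \<eta>' \<kappa>))) =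
        (\<Sum>\<eta>'\<in>G \<rightarrow>\<^sub>E {-1, 1}. \<Prod>\<kappa>\<in>G. exp (t * (\<eta> \<kappa> * \<eta>' \<kappa>)))"
      using G by (simp add: sum_distrib_left exp_sum)
    also have "\<dots> = (\<Prod>\<kappa>\<in>G. \<Sum>e\<in>{-1, 1}. exp (t * (\<eta> \<kappa> * e)))"
      by (rule prod_sum_PiE[symmetric]) (use G in auto)
    also have "\<dots> = (\<Prod>\<kappa>\<in>G. exp t + exp (- t))"
    proof (rule prod.cong[OF refl])
      fix \<kappa> assume "\<kappa> \<in> G"
      then have "\<eta> \<kappa> = -1 \<or> \<eta> \<kappa> = 1" using \<eta> by auto
      then show "(\<Sum>e\<in>{-1, 1}. exp (t * (\<eta> \<kappa> * e))) = exp t + exp (- t)" by auto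
    qed
    finally show ?thesis by simp
  qed
  then have "(\<Sum>\<eta>\<in>G \<rightarrow>\<^sub>E {-1, 1}. \<Sum>\<eta>'\<in>G \<rightarrow>\<^sub>E {-1, 1}. exp (t * (\<Sum>\<kappa>\<in>G. \<eta> \<kappa> * \<eta>' \<kappa>))) =
      real (card (G \<rightarrow>\<^sub>E {-1, 1 :: real})) * (exp t + exp (- t)) ^ card G" by simp
  also have "card (G \<rightarrow>\<^sub>E {-1, 1 :: real}) = 2 ^ card G"
    using G by (simp add: card_PiE numeral_2_eq_2)
  finally show ?thesis by simp
qed

section \<open>Indistinguishability of the mixture from the uniform distribution\<close>

context bump
begin

text \<open>
  Ingster's method: the likelihood ratio of the uniform mixture over sign vectors against the
  uniform distribution has second moment at most \<open>exp (K t\<^sup>2)\<close>, where \<open>K\<close> is the number of cells.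
\<close>

lemma mixture_test_bound:
  fixes A :: "(nat \<Rightarrow> 'a::euclidean_space) set" and k :: nat
  assumes N: "N > 0" and \<rho>: "0 \<le> \<rho>" "\<rho> * B ^ DIM('a) \<le> 1"
    and A: "A \<in> sets (iid_sample k cube_lebesgue)"
    and t: "t = real k * (\<rho>\<^sup>2 * (v DIM('a) / real N ^ DIM('a)))" "t \<le> 1"
    and \<delta>: "\<delta> > 0" "2 * (real N ^ DIM('a) * t\<^sup>2) \<le> \<delta>\<^sup>2" "real N ^ DIM('a) * t\<^sup>2 \<le> 1"
    and prob: "\<And>\<eta>. (\<And>\<kappa>. \<bar>\<eta> \<kappa>\<bar> \<le> 1) \<Longrightarrow> prob_space (density (cube_lebesgue :: 'a measure) (\<lambda>x. ennreal (perturbed N \<rho> \<eta> x)))"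
    and bound: "\<And>\<eta>. (\<And>\<kappa>. \<bar>\<eta> \<kappa>\<bar> \<le> 1) \<Longrightarrow> (\<And>\<kappa>. \<kappa> \<in> grid N \<Longrightarrow> \<bar>\<eta> \<kappa>\<bar> = 1) \<Longrightarrow>
      measure (iid_sample k (density cube_lebesgue (\<lambda>x. ennreal (perturbed N \<rho> \<eta> x)))) A \<le> \<beta>"
  shows "measure (iid_sample k cube_lebesgue) A - \<delta> \<le> \<beta>"
proof -
  let ?U = "cube_lebesgue :: 'a measure"
  let ?V = "\<Pi>\<^sub>M i\<in>{..<k}. ?U"
  let ?G = "grid N :: ('a \<Rightarrow> nat) set"
  let ?H = "?G \<rightarrow>\<^sub>E {-1, 1 :: real}"
  interpret U: prob_space ?U by (rule prob_space_cube_lebesgue)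
  interpret UU: product_sigma_finite "\<lambda>_::nat. ?U" by standard
  interpret V: prob_space ?V by (rule prob_space_PiM) (rule prob_space_cube_lebesgue)
  define K where "K = N ^ DIM('a)"
  have cardG: "card ?G = K" by (simp add: K_def card_grid)
  have cardH: "real (card ?H) = 2 ^ K"
    using finite_grid[of N, where 'a = 'a] by (simp add: card_PiE cardG numeral_2_eq_2)
  have H0: "real (card ?H) > 0" unfolding cardH by simp
  \<comment> \<open>Members of \<open>?H\<close> are \<open>undefined\<close> outside the grid;
    extension by \<open>0\<close> makes them bounded by \<open>1\<close> everywhere.\<close>
  define sg where "sg \<eta> \<kappa> = (if \<kappa> \<in> ?G then \<eta> \<kappa> else 0 :: real)" for \<eta> \<kappa>
  have sg1: "\<bar>sg \<eta> \<kappa>\<bar> = 1" if "\<eta> \<in> ?H" "\<kappa> \<in> ?G" for \<eta> \<kappa>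
    using PiE_mem[OF that] that(2) by (auto simp: sg_def)
  have sg_le: "\<bar>sg \<eta> \<kappa>\<bar> \<le> 1" if "\<eta> \<in> ?H" for \<eta> \<kappa> using sg1[OF that, of \<kappa>] by (cases "\<kappa> \<in> ?G") (auto simp: sg_def)
  define f where "f \<eta> = (perturbed N \<rho> (sg \<eta>) :: 'a \<Rightarrow> real)" for \<eta>
  have f_nn: "0 \<le> f \<eta> x" if "\<eta> \<in> ?H" for \<eta> x
    unfolding f_def using perturbed_bounds(1)[OF sg_le[OF that] \<rho>] .
  have f_meas: "f \<eta> \<in> borel_measurable ?U" for \<eta>
    unfolding f_def by (intro borel_measurable_cube_lebesgue perturbed_measurable)
  have f_int: "integrable ?U (f \<eta>)" "(\<integral>x. f \<eta> x \<partial>?U) = 1"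
    "integrable ?U (\<lambda>x. f \<eta> x * f \<eta>' x)" for \<eta> \<eta>'
    unfolding f_def by (rule perturbed_product_integral[OF N])+
  define c where "c = \<rho>\<^sup>2 * (v DIM('a) / real N ^ DIM('a))"
  have ff: "(\<integral>x. f \<eta> x * f \<eta>' x \<partial>?U) = 1 + c * (\<Sum>\<kappa>\<in>?G. \<eta> \<kappa> * \<eta>' \<kappa>)" for \<eta> \<eta>'
    unfolding f_def perturbed_product_integral(2)[OF N] c_def by (simp add: sg_def)
  \<comment> \<open>The likelihood ratio of the whole sample against the uniform distribution;
    \<open>M\<close> below averages it over all sign vectors.\<close>
  define Lr where "Lr \<eta> \<omega> = (\<Prod>i<k. f \<eta> (\<omega> i))" for \<eta> \<omega>
  have L_int: "integrable ?V (Lr \<eta>)" "(\<integral>\<omega>. Lr \<eta> \<omega> \<partial>?V) = 1" for \<eta>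
  proof -
    show "integrable ?V (Lr \<eta>)" unfolding Lr_def by (intro UU.product_integrable_prod f_int) auto
    have "(\<integral>\<omega>. Lr \<eta> \<omega> \<partial>?V) = (\<Prod>i<k. \<integral>x. f \<eta> x \<partial>?U)"
      unfolding Lr_def by (intro UU.product_integral_prod f_int) auto
    then show "(\<integral>\<omega>. Lr \<eta> \<omega> \<partial>?V) = 1" by (simp add: f_int)
  qed
  have LL: "integrable ?V (\<lambda>\<omega>. Lr \<eta> \<omega> * Lr \<eta>' \<omega>)"
    "(\<integral>\<omega>. Lr \<eta> \<omega> * Lr \<eta>' \<omega> \<partial>?V) = (1 + c * (\<Sum>\<kappa>\<in>?G. \<eta> \<kappa> * \<eta>' \<kappa>)) ^ k" for \<eta> \<eta>'
  proof -
    show "integrable ?V (\<lambda>\<omega>. Lr \<eta> \<omega> * Lr \<eta>' \<omega>)"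
      unfolding Lr_def prod.distrib[symmetric] by (intro UU.product_integrable_prod f_int) auto
    have "(\<integral>\<omega>. Lr \<eta> \<omega> * Lr \<eta>' \<omega> \<partial>?V) = (\<Prod>i<k. \<integral>x. f \<eta> x * f \<eta>' x \<partial>?U)"
      unfolding Lr_def prod.distrib[symmetric] by (intro UU.product_integral_prod f_int) auto
    then show "(\<integral>\<omega>. Lr \<eta> \<omega> * Lr \<eta>' \<omega> \<partial>?V) = (1 + c * (\<Sum>\<kappa>\<in>?G. \<eta> \<kappa> * \<eta>' \<kappa>)) ^ k" by (simp add: ff)
  qed
  have A': "A \<in> sets ?V" using A by (simp add: iid_sample_def)
  have meas: "measure (iid_sample k (density ?U (\<lambda>x. ennreal (perturbed N \<rho> (sg \<eta>) x)))) A = (\<integral>\<omega>. Lr \<eta> \<omega> * indicator A \<omega> \<partial>?V)"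
    if \<eta>: "\<eta> \<in> ?H" for \<eta>
  proof -
    have P: "iid_sample k (density ?U (\<lambda>x. ennreal (perturbed N \<rho> (sg \<eta>) x))) = density ?V (\<lambda>\<omega>. ennreal (Lr \<eta> \<omega>))"
      unfolding iid_sample_def Lr_def f_def
      by (rule PiM_density[OF prob_space_cube_lebesgue prob[OF sg_le[OF \<eta>]]])
         (use f_meas f_nn[OF \<eta>] in \<open>auto simp: f_def\<close>)
    have Lm: "Lr \<eta> \<in> borel_measurable ?V" using L_int(1)[of \<eta>] by simp
    have "emeasure (density ?V (\<lambda>\<omega>. ennreal (Lr \<eta> \<omega>))) A = (\<integral>\<^sup>+\<omega>. ennreal (Lr \<eta> \<omega>) * indicator A \<omega> \<partial>?V)"
      using Lm A' by (intro emeasure_density) auto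
    also have "\<dots> = (\<integral>\<^sup>+\<omega>. ennreal (Lr \<eta> \<omega> * indicator A \<omega>) \<partial>?V)"
      by (intro nn_integral_cong) (simp add: indicator_def)
    finally have e: "emeasure (density ?V (\<lambda>\<omega>. ennreal (Lr \<eta> \<omega>))) A = (\<integral>\<^sup>+\<omega>. ennreal (Lr \<eta> \<omega> * indicator A \<omega>) \<partial>?V)" .
    have Lnn: "0 \<le> Lr \<eta> \<omega>" for \<omega> unfolding Lr_def using f_nn[OF \<eta>] by (intro prod_nonneg) auto
    have "(\<lambda>\<omega>. Lr \<eta> \<omega> * indicator A \<omega>) \<in> borel_measurable ?V" using Lm A' by simp
    then show ?thesis unfolding P measure_def e using Lnn by (intro integral_eq_nn_integral[symmetric]) auto
  qed
  define M where "M \<omega> = (\<Sum>\<eta>\<in>?H. Lr \<eta> \<omega>) / real (card ?H)" for \<omega>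
  have M_int: "integrable ?V M" "(\<integral>\<omega>. M \<omega> \<partial>?V) = 1"
    unfolding M_def using L_int H0 by (auto simp: Bochner_Integration.integral_sum)
  have M2_eq: "(M \<omega>)\<^sup>2 = (\<Sum>\<eta>\<in>?H. \<Sum>\<eta>'\<in>?H. Lr \<eta> \<omega> * Lr \<eta>' \<omega>) / (real (card ?H))\<^sup>2" for \<omega>
    unfolding M_def power_divide sum_product[symmetric] power2_eq_square[of "sum f A" for f A] ..
  have M2_int: "integrable ?V (\<lambda>\<omega>. (M \<omega>)\<^sup>2)"
    unfolding M2_eq using LL(1) by (intro integrable_divide Bochner_Integration.integrable_sum)
  have "(\<integral>\<omega>. (M \<omega>)\<^sup>2 \<partial>?V) = (\<Sum>\<eta>\<in>?H. \<Sum>\<eta>'\<in>?H. (1 + c * (\<Sum>\<kappa>\<in>?G. \<eta> \<kappa> * \<eta>' \<kappa>)) ^ k) / (real (card ?H))\<^sup>2"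
    unfolding M2_eq using LL by (simp add: Bochner_Integration.integral_sum Bochner_Integration.integrable_sum)
  also have "\<dots> \<le> (\<Sum>\<eta>\<in>?H. \<Sum>\<eta>'\<in>?H. exp (t * (\<Sum>\<kappa>\<in>?G. \<eta> \<kappa> * \<eta>' \<kappa>))) / (real (card ?H))\<^sup>2"
  proof (intro divide_right_mono sum_mono)
    fix \<eta> \<eta>' assume h: "\<eta> \<in> ?H" "\<eta>' \<in> ?H"
    let ?s = "\<Sum>\<kappa>\<in>?G. \<eta> \<kappa> * \<eta>' \<kappa>"
    \<comment> \<open>Monotonicity of the power needs a nonnegative base; the base is an integral of
      a product of densities.\<close>
    have "0 \<le> (\<integral>x. f \<eta> x * f \<eta>' x \<partial>?U)"
      using f_nn[OF h(1)] f_nn[OF h(2)] by (intro Bochner_Integration.integral_nonneg) simp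
    then have "0 \<le> 1 + c * ?s" unfolding ff .
    then have "(1 + c * ?s) ^ k \<le> exp (c * ?s) ^ k"
      by (intro power_mono exp_ge_add_one_self)
    also have "\<dots> = exp (t * ?s)" unfolding t(1) c_def[symmetric] by (simp add: exp_of_nat_mult[symmetric] mult_ac)
    finally show "(1 + c * ?s) ^ k \<le> exp (t * ?s)" .
  qed simp
  also have "\<dots> = (2 ^ K * (exp t + exp (- t)) ^ K) / (2 ^ K)\<^sup>2"
    unfolding sum_sign_vectors_exp[OF finite_grid] cardG cardH ..
  also have "\<dots> \<le> (2 ^ K * (2 * exp (t\<^sup>2)) ^ K) / (2 ^ K)\<^sup>2"
  proof (intro divide_right_mono mult_left_mono power_mono exp_add_exp_minus_le t(2))
    show "0 \<le> t" unfolding t(1) using v_pos[of "DIM('a)"] by simp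
  qed (auto intro: add_nonneg_nonneg)
  also have "\<dots> = exp (t\<^sup>2) ^ K" by (simp add: power_mult_distrib power2_eq_square)
  also have "\<dots> = exp (real K * t\<^sup>2)" by (rule exp_of_nat_mult[symmetric])
  also have "\<dots> \<le> 1 + 2 * (real K * t\<^sup>2)"
  proof -
    have y: "0 \<le> real K * t\<^sup>2" "real K * t\<^sup>2 \<le> 1" using \<delta>(3) by (simp_all add: K_def)
    have "exp (real K * t\<^sup>2) \<le> 1 + real K * t\<^sup>2 + (real K * t\<^sup>2)\<^sup>2" by (rule exp_bound[OF y])
    moreover have "(real K * t\<^sup>2)\<^sup>2 \<le> real K * t\<^sup>2"
      using mult_left_le[OF y(2,1)] by (simp add: power2_eq_square)
    ultimately show ?thesis by linarith
  qed
  also have "\<dots> \<le> 1 + \<delta>\<^sup>2" using \<delta>(2) by (simp add: K_def)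
  finally have M2: "(\<integral>\<omega>. (M \<omega>)\<^sup>2 \<partial>?V) \<le> 1 + \<delta>\<^sup>2" .
  have dev_eq: "(M \<omega> - 1)\<^sup>2 = (M \<omega>)\<^sup>2 - 2 * M \<omega> + 1" for \<omega> by (simp add: power2_diff)
  have dev_int: "integrable ?V (\<lambda>\<omega>. (M \<omega> - 1)\<^sup>2)"
    unfolding dev_eq using M2_int M_int by simp
  have dev: "(\<integral>\<omega>. (M \<omega> - 1)\<^sup>2 \<partial>?V) \<le> \<delta>\<^sup>2"
    unfolding dev_eq using M2_int M_int M2 by (simp add: V.prob_space)
  have iA: "integrable ?V (\<lambda>\<omega>. indicator A \<omega> :: real)" using A' by (simp add: V.emeasure_eq_measure)
  have MA_int: "integrable ?V (\<lambda>\<omega>. M \<omega> * indicator A \<omega>)"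
    using integrable_real_mult_indicator[OF A' M_int(1)] .
  \<comment> \<open>The integrand comes from the inequality of means: the absolute value of
    \<open>M - 1\<close> is at most \<open>((M - 1)^2 / \<delta> + \<delta>) / 2\<close>, whose
    integral is at most \<open>\<delta>\<close> by \<open>dev\<close>. Integrals of squares thus
    suffice.\<close>
  have "measure ?V A - \<delta> \<le> (\<integral>\<omega>. indicator A \<omega> - ((M \<omega> - 1)\<^sup>2 / \<delta> + \<delta>) / 2 \<partial>?V)"
  proof -
    have "(\<integral>\<omega>. indicator A \<omega> - ((M \<omega> - 1)\<^sup>2 / \<delta> + \<delta>) / 2 \<partial>?V) =
        measure ?V A - ((\<integral>\<omega>. (M \<omega> - 1)\<^sup>2 \<partial>?V) / \<delta> + \<delta>) / 2"
      using iA dev_int A' by (simp add: V.prob_space)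
    moreover have "(\<integral>\<omega>. (M \<omega> - 1)\<^sup>2 \<partial>?V) / \<delta> \<le> \<delta>"
      using dev \<delta>(1) by (simp add: pos_divide_le_eq power2_eq_square)
    ultimately show ?thesis by simp
  qed
  also have "\<dots> \<le> (\<integral>\<omega>. M \<omega> * indicator A \<omega> \<partial>?V)"
  proof (rule integral_mono)
    fix \<omega>
    have "0 \<le> (\<bar>M \<omega> - 1\<bar> - \<delta>)\<^sup>2" by simp
    then have "2 * \<bar>M \<omega> - 1\<bar> * \<delta> \<le> (M \<omega> - 1)\<^sup>2 + \<delta>\<^sup>2" by (simp add: power2_diff)
    then have "\<bar>M \<omega> - 1\<bar> \<le> ((M \<omega> - 1)\<^sup>2 / \<delta> + \<delta>) / 2"
      using \<delta>(1) by (simp add: field_simps power2_eq_square)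
    note le = this
    show "indicator A \<omega> - ((M \<omega> - 1)\<^sup>2 / \<delta> + \<delta>) / 2 \<le> M \<omega> * indicator A \<omega>"
    proof (cases "\<omega> \<in> A")
      case True
      then have i: "indicator A \<omega> = (1 :: real)" by simp
      show ?thesis using le unfolding i by linarith
    next
      case False
      then have i: "indicator A \<omega> = (0 :: real)" by simp
      show ?thesis using le unfolding i by linarith
    qed
  qed (use iA dev_int MA_int in auto)
  also have "\<dots> = (\<Sum>\<eta>\<in>?H. \<integral>\<omega>. Lr \<eta> \<omega> * indicator A \<omega> \<partial>?V) / real (card ?H)"
  proof -
    have "M \<omega> * indicator A \<omega> = (\<Sum>\<eta>\<in>?H. Lr \<eta> \<omega> * indicator A \<omega>) / real (card ?H)" for \<omega>
      by (simp add: M_def sum_distrib_right)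
    then show ?thesis
      using integrable_real_mult_indicator[OF A' L_int(1)] by (simp add: Bochner_Integration.integral_sum)
  qed
  also have "\<dots> \<le> (\<Sum>\<eta>\<in>?H. \<beta>) / real (card ?H)"
  proof (intro divide_right_mono sum_mono)
    fix \<eta> assume h: "\<eta> \<in> ?H"
    show "(\<integral>\<omega>. Lr \<eta> \<omega> * indicator A \<omega> \<partial>?V) \<le> \<beta>"
      unfolding meas[OF h, symmetric] by (rule bound) (use sg_le[OF h] sg1[OF h] in auto)
  qed simp
  also have "\<dots> = \<beta>" using H0 by simp
  finally show ?thesis by (simp add: iid_sample_def)
qed

end

text \<open>The acceptance region of a test of level \<open>\<alpha>\<close> has probability at
  least \<open>1 - \<alpha>\<close> under the uniform distribution. At the cost of
  \<open>\<delta>\<close>, \<open>mixture_test_bound\<close> carries this over to the supremum over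
  the perturbations, all of which are alternatives.\<close>

lemma minimax_risk_lower_rate:
  fixes s L \<alpha> \<beta> :: real
  assumes s: "s > 0" and L: "L > 0" and \<alpha>: "\<alpha> > 0" and \<beta>: "\<beta> > 0" "\<beta> < 1 - \<alpha>"
  defines "d \<equiv> real DIM('a::euclidean_space \<times> 'b::euclidean_space)"
  obtains c where "c > 0"
    "\<And>n \<epsilon>. \<lbrakk>n \<ge> 1; \<epsilon> \<le> c * real n powr (- (2 * s) / (4 * s + d))\<rbrakk> \<Longrightarrow>
      \<not> minimax_risk TYPE('a) TYPE('b) s L \<alpha> n \<epsilon> \<le> ennreal \<beta>"
proof -
  let ?d = "DIM('a \<times> 'b)"
  obtain \<phi> B where \<phi>: "B \<ge> (1::real)"
    "\<And>j t. j \<le> nat \<lfloor>s\<rfloor> \<Longrightarrow> (\<phi> j has_real_derivative \<phi> (Suc j) t) (at t)"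
    "\<And>j t. t \<notin> {0<..<1} \<Longrightarrow> \<phi> j t = 0"
    "\<And>j t. j \<le> Suc (nat \<lfloor>s\<rfloor>) \<Longrightarrow> \<bar>\<phi> j t\<bar> \<le> B"
    "(\<integral>t. \<phi> 0 t \<partial>lborel) = 0" "(\<integral>t. (\<phi> 0 t)\<^sup>2 \<partial>lborel) > 0"
    by (rule smooth_bump[of "nat \<lfloor>s\<rfloor>"]) blast
  interpret bump "nat \<lfloor>s\<rfloor>" \<phi> B
    by unfold_locales (use \<phi> in auto)
  obtain W where W: "W > 0" and holder:
    "\<And>N \<rho> L \<eta>. \<lbrakk>N > 0; \<rho> \<ge> 0; \<And>\<kappa>. \<bar>\<eta> \<kappa>\<bar> \<le> 1; \<rho> * real N powr s * W \<le> L\<rbrakk> \<Longrightarrow>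
       (perturbed N \<rho> \<eta> :: 'a \<times> 'b \<Rightarrow> real) \<in> holder_class s L"
    using perturbed_holder[OF s refl, where 'a = "'a \<times> 'b"] by metis
  define V where "V = v ?d"
  have V: "V > 0" unfolding V_def by (rule v_pos)
  \<comment> \<open>Half of the gap, so that \<open>1 - \<alpha> - \<delta>\<close> still strictly
    exceeds \<open>\<beta>\<close>.\<close>
  define \<delta> where "\<delta> = (1 - \<alpha> - \<beta>) / 2"
  have \<delta>: "\<delta> > 0" using \<beta> by (simp add: \<delta>_def)
  \<comment> \<open>The bounds give, in this order, \<open>c1^2 \<le> c1\<close>, membership in the
    class, nonnegativity of the density, the exponents at most \<open>1\<close>, and closeness
    \<open>\<delta>\<close> of the mixture.\<close>
  define c1 where "c1 = min 1 (min (L / W) (min (1 / B ^ ?d) (min (1 / V) (\<delta> / (2 * V)))))"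
  have Bd: "B ^ ?d > 0" using \<phi>(1) by simp
  have c1: "c1 > 0" using L W Bd V \<delta> by (simp add: c1_def)
  have c1_le: "c1 \<le> 1" "c1 \<le> L / W" "c1 \<le> 1 / B ^ ?d" "c1 \<le> 1 / V" "c1 \<le> \<delta> / (2 * V)"
    unfolding c1_def by linarith+
  have c1_W: "c1 * W \<le> L" using c1_le(2) W by (simp add: pos_le_divide_eq)
  have c1_B: "c1 * B ^ ?d \<le> 1" using c1_le(3) Bd by (simp only: pos_le_divide_eq)
  have c1_V: "c1\<^sup>2 * V \<le> 1" "c1\<^sup>2 * V \<le> \<delta> / 2"
  proof -
    have "c1\<^sup>2 \<le> c1" using mult_left_le[OF c1_le(1), of c1] c1 by (simp add: power2_eq_square)
    then have le: "c1\<^sup>2 * V \<le> c1 * V" using V by (intro mult_right_mono) auto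
    have "c1 * V \<le> 1" using c1_le(4) V by (simp add: pos_le_divide_eq)
    with le show "c1\<^sup>2 * V \<le> 1" by linarith
    have "c1 * (2 * V) \<le> \<delta>" using c1_le(5) V by (simp add: pos_le_divide_eq)
    with le show "c1\<^sup>2 * V \<le> \<delta> / 2" by linarith
  qed
  \<comment> \<open>The factor \<open>2 powr - s\<close> pays for the rounding
    \<open>N \<le> 2 * x\<close>.\<close>
  define c where "c = c1 * sqrt V * 2 powr - s"
  have c: "c > 0" using c1 V by (simp add: c_def)
  have d: "d \<ge> 0" by (simp add: d_def)
  show ?thesis
  proof (rule that[OF c])
    fix n :: nat and \<epsilon> :: real
    assume n: "n \<ge> 1" and \<epsilon>: "\<epsilon> \<le> c * real n powr (- (2 * s) / (4 * s + d))"
    define x where "x = real n powr (2 / (4 * s + d))"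
    have sd: "4 * s + d > 0" using s d by simp
    have x: "x \<ge> 1" unfolding x_def using n sd by (intro ge_one_powr_ge_zero) auto
    define N where "N = nat \<lceil>x\<rceil>"
    have "real N = of_int \<lceil>x\<rceil>" using x by (simp add: N_def)
    then have N: "x \<le> real N" "real N \<le> 2 * x" using x by linarith+
    then have N0: "N > 0" and N1: "1 \<le> real N" using x by linarith+
    \<comment> \<open>The amplitude has the order that the class permits for bumps of width
      \<open>1 / N\<close>.\<close>
    define \<rho> where "\<rho> = c1 * real N powr - s"
    have Ns: "real N powr - s \<le> 1" using N1 s by (simp add: powr_minus_divide ge_one_powr_ge_zero)
    have \<rho>: "\<rho> \<ge> 0" using c1 by (simp add: \<rho>_def)
    have \<rho>_B: "\<rho> * B ^ ?d \<le> 1"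
    proof -
      have "\<rho> * B ^ ?d = (c1 * B ^ ?d) * real N powr - s" by (simp add: \<rho>_def)
      also have "\<dots> \<le> 1 * 1" using c1_B Ns c1 Bd by (intro mult_mono) auto
      finally show ?thesis by simp
    qed
    have \<rho>_W: "\<rho> * real N powr s * W \<le> L"
    proof -
      have "\<rho> * real N powr s * W = c1 * W * (real N powr - s * real N powr s)" by (simp add: \<rho>_def)
      also have "real N powr - s * real N powr s = 1" using N0 by (simp add: powr_add[symmetric])
      finally show ?thesis using c1_W by (simp only: mult_1_right)
    qed
    have hold: "perturbed N \<rho> \<eta> \<in> (holder_class s L :: ('a \<times> 'b \<Rightarrow> real) set)" if "\<And>\<kappa>. \<bar>\<eta> \<kappa>\<bar> \<le> 1" for \<eta>
      by (rule holder[OF N0 \<rho> that \<rho>_W])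
    have hold1: "(\<lambda>_. 1) \<in> (holder_class s L :: ('a \<times> 'b \<Rightarrow> real) set)"
    proof -
      \<comment> \<open>The uniform density is the perturbation of amplitude zero and thus inherits
        its membership in the class.\<close>
      have "perturbed N 0 (\<lambda>_. 0) = (\<lambda>_ :: 'a \<times> 'b. 1 :: real)" by (rule ext) (simp add: perturbed_def)
      moreover have "(perturbed N 0 (\<lambda>_. 0) :: 'a \<times> 'b \<Rightarrow> real) \<in> holder_class s L"
        by (rule holder[OF N0]) (use L in auto)
      ultimately show ?thesis by simp
    qed
    let ?P = "\<lambda>\<eta>. density (cube_lebesgue :: ('a \<times> 'b) measure) (\<lambda>x. ennreal (perturbed N \<rho> \<eta> x))"
    have model: "holder_model s L (?P \<eta>) (perturbed N \<rho> \<eta>) (\<lambda>_. 1) (\<lambda>_. 1)" if "\<And>\<kappa>. \<bar>\<eta> \<kappa>\<bar> \<le> 1" for \<eta>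
      by (rule perturbed_holder_model[OF N0 that \<rho> \<rho>_B hold[OF that] hold1])
    have \<epsilon>_le: "\<epsilon> \<le> \<rho> * sqrt V"
    proof -
      have "real n powr (- (2 * s) / (4 * s + d)) = x powr - s"
        unfolding x_def powr_powr by (simp add: mult.commute)
      then have "\<epsilon> \<le> c1 * sqrt V * (2 * x) powr - s"
        using \<epsilon> x by (simp add: c_def powr_mult mult_ac)
      also have "\<dots> \<le> c1 * sqrt V * real N powr - s"
        using N N0 s c1 V by (intro mult_left_mono powr_mono2') auto
      finally show ?thesis by (simp add: \<rho>_def mult_ac)
    qed
    have alt: "?P \<eta> \<in> alternative_class s L \<epsilon>"
      if "\<And>\<kappa>. \<bar>\<eta> \<kappa>\<bar> \<le> 1" "\<And>\<kappa>. \<kappa> \<in> grid N \<Longrightarrow> \<bar>\<eta> \<kappa>\<bar> = 1" for \<eta>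
    proof -
      have "(\<lambda>(y, z). perturbed N \<rho> \<eta> (y, z) - 1 * 1) = (\<lambda>x. perturbed N \<rho> \<eta> x - 1)" by auto
      moreover have "L2_norm (\<lambda>x. perturbed N \<rho> \<eta> x - 1) = \<rho> * sqrt V"
        unfolding V_def by (rule perturbed_L2_norm[OF N0 \<rho>]) (rule that(2))
      ultimately have "L2_norm (\<lambda>(y, z). perturbed N \<rho> \<eta> (y, z) - 1 * 1) = \<rho> * sqrt V"
        by (simp only:)
      then show ?thesis unfolding alternative_class_def using model[OF that(1)] \<epsilon>_le by fastforce
    qed
    have null: "(cube_lebesgue :: ('a \<times> 'b) measure) \<in> null_class s L"
    proof -
      have "holder_model s L (density (cube_lebesgue :: ('a \<times> 'b) measure) (\<lambda>x. ennreal (perturbed N 0 (\<lambda>_. 0) x)))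
          (perturbed N 0 (\<lambda>_. 0)) (\<lambda>_. 1) (\<lambda>_. 1)"
        by (rule perturbed_holder_model[OF N0 _ _ _ holder[OF N0] hold1]) (use L in auto)
      moreover have "perturbed N 0 (\<lambda>_. 0) = (\<lambda>_::'a \<times> 'b. 1 :: real)" by (rule ext) (simp add: perturbed_def)
      ultimately have "holder_model s L (cube_lebesgue :: ('a \<times> 'b) measure) (\<lambda>_. 1) (\<lambda>_. 1) (\<lambda>_. 1)"
        by (simp add: density_1)
      then show ?thesis unfolding null_class_def by fastforce
    qed
    define t where "t = real n * (\<rho>\<^sup>2 * (V / real N ^ ?d))"
    \<comment> \<open>\<open>y^2\<close> is \<open>N^d t^2\<close>, the exponent in the
      second-moment bound for the mixture. With \<open>\<rho>\<close> of order
      \<open>N powr - s\<close> it stays bounded because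
      \<open>n \<le> N powr ((4 * s + d) / 2)\<close>.\<close>
    define y where "y = t * real N powr (d / 2)"
    have Nd: "real N ^ ?d = real N powr d" unfolding d_def using N0 by (intro powr_realpow[symmetric]) simp
    have t0: "t \<ge> 0" unfolding t_def using V by simp
    have y_le: "y \<le> c1\<^sup>2 * V"
    proof -
      have "real n = x powr ((4 * s + d) / 2)"
      proof -
        have "2 / a * (a / 2) = 1" if "a > 0" for a :: real using that by simp
        note one = this[OF sd]
        show ?thesis unfolding x_def powr_powr one using n by simp
      qed
      also have "\<dots> \<le> real N powr ((4 * s + d) / 2)" using N x sd by (intro powr_mono2) auto
      finally have n_le: "real n \<le> real N powr ((4 * s + d) / 2)" .
      have "\<rho>\<^sup>2 = c1\<^sup>2 * real N powr (- 2 * s)"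
        by (simp add: \<rho>_def power_mult_distrib power2_eq_square powr_add[symmetric])
      then have "y = real n * (c1\<^sup>2 * V) * (real N powr (- 2 * s) * real N powr (d / 2) / real N powr d)"
        unfolding y_def t_def Nd by simp
      also have "real N powr (- 2 * s) * real N powr (d / 2) / real N powr d = real N powr (- ((4 * s + d) / 2))"
      proof -
        have "- 2 * s + d / 2 - d = - ((4 * s + d) / 2)" by (simp add: field_simps)
        then show ?thesis unfolding powr_add[symmetric] powr_diff[symmetric] by (rule arg_cong)
      qed
      also have "real n * (c1\<^sup>2 * V) * real N powr (- ((4 * s + d) / 2)) \<le>
          real N powr ((4 * s + d) / 2) * (c1\<^sup>2 * V) * real N powr (- ((4 * s + d) / 2))"
        using n_le V by (intro mult_right_mono) auto
      also have "\<dots> = c1\<^sup>2 * V" using N0 by (simp add: powr_minus)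
      finally show ?thesis .
    qed
    have y0: "y \<ge> 0" unfolding y_def using t0 by simp
    have t_y: "t \<le> y" unfolding y_def using t0 N1 d mult_left_mono[of 1 "real N powr (d / 2)" t] by (simp add: ge_one_powr_ge_zero)
    have y2: "real N ^ ?d * t\<^sup>2 = y\<^sup>2"
      unfolding y_def Nd power_mult_distrib by (simp add: power2_eq_square powr_add[symmetric])
    have y_1: "y \<le> 1" and y_\<delta>: "y \<le> \<delta> / 2" using y_le c1_V by linarith+
    have t1: "t \<le> 1" using t_y y_1 by linarith
    have c2: "real N ^ ?d * t\<^sup>2 \<le> 1" unfolding y2 using y0 y_1 by (rule power_le_one)
    have c3: "2 * (real N ^ ?d * t\<^sup>2) \<le> \<delta>\<^sup>2"
    proof -
      have "y\<^sup>2 \<le> (\<delta> / 2)\<^sup>2" using y_\<delta> y0 by (rule power_mono)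
      then have "4 * y\<^sup>2 \<le> \<delta>\<^sup>2" by (simp add: power_divide)
      moreover have "0 \<le> y\<^sup>2" by simp
      ultimately show ?thesis unfolding y2 by linarith
    qed
    have "ennreal (1 - \<alpha> - \<delta>) \<le> minimax_risk TYPE('a) TYPE('b) s L \<alpha> n \<epsilon>"
      unfolding minimax_risk_def
    proof (rule INF_greatest, rule ccontr)
      fix \<psi> :: "(nat \<Rightarrow> 'a \<times> 'b) \<Rightarrow> nat"
      assume lev: "\<psi> \<in> level_tests s L \<alpha> n"
      let ?S = "SUP P\<in>alternative_class s L \<epsilon>. prob_decision n P \<psi> 0"
      assume "\<not> ennreal (1 - \<alpha> - \<delta>) \<le> ?S"
      then have S: "?S < ennreal (1 - \<alpha> - \<delta>)" by simp
      then obtain b where b: "?S = ennreal b" "0 \<le> b" by (cases ?S) auto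
      have b_lt: "b < 1 - \<alpha> - \<delta>" using S unfolding b(1) by (simp add: ennreal_less_iff b(2))
      let ?\<Omega> = "iid_sample n (cube_lebesgue :: ('a \<times> 'b) measure)"
      interpret \<Omega>: prob_space ?\<Omega>
        unfolding iid_sample_def by (rule prob_space_PiM) (rule prob_space_cube_lebesgue)
      define A where "A = {\<omega> \<in> space ?\<Omega>. \<psi> \<omega> = 0}"
      have test: "\<psi> \<in> ?\<Omega> \<rightarrow>\<^sub>M count_space {0, 1}" using lev by (simp add: level_tests_def tests_def)
      have A: "A \<in> sets ?\<Omega>"
      proof -
        have "A = \<psi> -` {0} \<inter> space ?\<Omega>" by (auto simp: A_def)
        then show ?thesis using measurable_sets[OF test, of "{0}"] by simp
      qed
      have "\<Omega>.prob A - \<delta> \<le> b"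
      proof (rule mixture_test_bound[OF N0 \<rho> \<rho>_B A _ t1 \<delta> c3 c2])
        show "t = real n * (\<rho>\<^sup>2 * (v ?d / real N ^ ?d))" by (simp add: t_def V_def)
        fix \<eta> :: "('a \<times> 'b \<Rightarrow> nat) \<Rightarrow> real" assume \<eta>: "\<And>\<kappa>. \<bar>\<eta> \<kappa>\<bar> \<le> 1"
        show P: "prob_space (?P \<eta>)" using model[OF \<eta>] by (simp add: holder_model_def)
        assume \<eta>1: "\<And>\<kappa>. \<kappa> \<in> grid N \<Longrightarrow> \<bar>\<eta> \<kappa>\<bar> = 1"
        interpret Q: prob_space "iid_sample n (?P \<eta>)"
          unfolding iid_sample_def by (rule prob_space_PiM) (rule P)
        have sp: "space (iid_sample n (?P \<eta>)) = space ?\<Omega>" by (simp add: iid_sample_def space_PiM)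
        have "ennreal (Q.prob A) = prob_decision n (?P \<eta>) \<psi> 0"
          unfolding prob_decision_def sp A_def by (simp add: Q.emeasure_eq_measure)
        also have "\<dots> \<le> ?S" by (rule SUP_upper[OF alt[OF \<eta> \<eta>1]])
        finally show "Q.prob A \<le> b" unfolding b(1) using b(2) by simp
      qed
      moreover have "1 - \<alpha> \<le> \<Omega>.prob A"
      proof -
        have "prob_decision n (cube_lebesgue :: ('a \<times> 'b) measure) \<psi> 1 \<le> ennreal \<alpha>"
          using lev SUP_upper[OF null, of "\<lambda>P. prob_decision n P \<psi> 1"] by (auto simp: level_tests_def intro: order_trans)
        moreover have "{\<omega> \<in> space ?\<Omega>. \<psi> \<omega> = 1} = space ?\<Omega> - A"
        proof (rule set_eqI)
          fix \<omega>
          show "\<omega> \<in> {\<omega> \<in> space ?\<Omega>. \<psi> \<omega> = 1} \<longleftrightarrow> \<omega> \<in> space ?\<Omega> - A"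
            using measurable_space[OF test, of \<omega>] by (cases "\<omega> \<in> space ?\<Omega>") (auto simp: A_def)
        qed
        ultimately have "\<Omega>.prob (space ?\<Omega> - A) \<le> \<alpha>"
          unfolding prob_decision_def using \<alpha> by (simp add: \<Omega>.emeasure_eq_measure)
        then show ?thesis using \<Omega>.prob_compl[OF A] by simp
      qed
      ultimately show False using b_lt by simp
    qed
    moreover have "\<beta> < 1 - \<alpha> - \<delta>" using \<beta> by (simp add: \<delta>_def field_simps)
    ultimately show "\<not> minimax_risk TYPE('a) TYPE('b) s L \<alpha> n \<epsilon> \<le> ennreal \<beta>"
      using \<beta>(1) by (metis ennreal_le_iff2 less_imp_le linorder_not_less order_trans)
  qed
qed

text \<open>The upper bound exhibits one member of the set whose infimum is taken. The lower bound
  excludes every \<open>\<epsilon>\<close> up to a multiple of the rate, so that multiple bounds the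
  whole set from below.\<close>

lemma minimum_separation_rate:
  fixes s L \<alpha> \<beta> :: real
  assumes s: "s > 0" and L: "L > 0" and \<alpha>: "\<alpha> > 0" and \<beta>: "\<beta> > 0" "\<beta> < 1 - \<alpha>"
  shows "(\<lambda>n. minimum_separation TYPE('a::euclidean_space) TYPE('b::euclidean_space) s L \<alpha> \<beta> n)
     \<in> \<Theta>(\<lambda>n. real n powr (- (2 * s) / (4 * s + real DIM('a \<times> 'b))))"
proof -
  let ?r = "\<lambda>n. real n powr (- (2 * s) / (4 * s + real DIM('a \<times> 'b)))"
  obtain D where D: "D > 0" and upper: "\<And>n. n \<ge> 6 \<Longrightarrow> minimax_risk TYPE('a) TYPE('b) s L \<alpha> n (D * ?r n) \<le> ennreal \<beta>"
    using minimax_risk_upper_rate[OF s L \<alpha> \<beta>(1), where 'a = 'a and 'b = 'b] by blast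
  obtain c where c: "c > 0" and lower: "\<And>n \<epsilon>. \<lbrakk>n \<ge> 1; \<epsilon> \<le> c * ?r n\<rbrakk> \<Longrightarrow>
      \<not> minimax_risk TYPE('a) TYPE('b) s L \<alpha> n \<epsilon> \<le> ennreal \<beta>"
    using minimax_risk_lower_rate[OF s L \<alpha> \<beta>, where 'a = 'a and 'b = 'b] by blast
  show ?thesis
  proof (rule bigthetaI'[OF c D])
    show "\<forall>\<^sub>F n in at_top. c * norm (?r n) \<le> norm (minimum_separation TYPE('a) TYPE('b) s L \<alpha> \<beta> n) \<and>
        norm (minimum_separation TYPE('a) TYPE('b) s L \<alpha> \<beta> n) \<le> D * norm (?r n)"
      using eventually_ge_at_top[of 6]
    proof eventually_elim
      case (elim n)
      let ?E = "{\<epsilon>. \<epsilon> > 0 \<and> minimax_risk TYPE('a) TYPE('b) s L \<alpha> n \<epsilon> \<le> ennreal \<beta>}"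
      have r: "?r n > 0" using elim by simp
      have mem: "D * ?r n \<in> ?E" using upper[OF elim] D r by simp
      have "c * ?r n \<le> Inf ?E"
      proof (rule cInf_greatest)
        show "?E \<noteq> {}" using mem by blast
        fix \<epsilon> assume "\<epsilon> \<in> ?E"
        then show "c * ?r n \<le> \<epsilon>" using lower[of n \<epsilon>] elim by force
      qed
      moreover have "Inf ?E \<le> D * ?r n"
        using mem by (rule cInf_lower) (auto intro: bdd_belowI[of _ 0])
      moreover have "0 \<le> c * ?r n" using c r by simp
      ultimately show ?case unfolding minimum_separation_def using r by simp
    qed
  qed
qed

theorem proposition5p6:
  fixes s L \<alpha> \<beta> :: real
  assumes "s > 0" and "L > 0"
    and "0 < \<alpha>" and "\<alpha> < 1"
    and "0 < \<beta>" and "\<beta> < 1 - \<alpha>"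
  shows "(\<lambda>n. minimum_separation TYPE(real ^ 'd1::finite) TYPE(real ^ 'd2::finite) s L \<alpha> \<beta> n)
     \<in> \<Theta>(\<lambda>n. real n powr (- (2 * s) / (4 * s + real CARD('d1) + real CARD('d2))))"
  using minimum_separation_rate[OF assms(1,2,3,5,6), where 'a = "real ^ 'd1" and 'b = "real ^ 'd2"]
  by (simp add: add.assoc)

end
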